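(* Let $(G,\chi)$ be a $k$-coloured graph with $k\leq 2$, $G=(V,E)$ and $|V|\ge 3$, and let $(G,\chi,p)$ be a generic framework on $r\mathbb{S}^2$ (so $d=2$). Then $(G,\chi,p)$ is isostatic on $r\mathbb{S}^2$ if and only if $G$ is a simple $f_2$-tight graph.
   Context: $G=(V,E)$ is a finite simple graph with $V=\{1,\dots,n\}$. A colouring is a map $\chi:V\to\mathcal{C}\cup\{\bullet\}$, where $\mathcal{C}$ is a set of colours and $\chi(v)=\bullet$ means that $v$ is uncoloured; every colour of $\mathcal{C}$ is used. $(G,\chi)$ is $k$-coloured if $|\mathcal{C}|=k$ ($\bullet$ is not counted). Given $r:\mathcal{C}\to\mathbb{R}_{>0}$, a framework $(G,\chi,p)$ on $r\mathbb{S}^d$ is given by a map $p:V\to\mathbb{R}^{d+1}$ such that $\|p(v)\|=r(\chi(v))$ for every coloured $v$ and $\|p(v)\|=1$ for every uncoloured $v$. It is generic if the coordinates of $p$ and $r$ satisfy no nonzero polynomial with rational coefficients except those in the ideal generated by the defining polynomials $p(v)\cdot p(v)-r(\chi(v))^2$ ($v$ coloured) and $p(v)\cdot p(v)-1$ ($v$ uncoloured). The rigidity matrix $R(G,\chi,p)$ is the $(|E|+n)\times((d+1)n+k)$ matrix of the following linear system in unknowns $\dot p:V\to\mathbb{R}^{d+1}$, $\dot r:\mathcal{C}\to\mathbb{R}$ (with $\dot r(\bullet)=0$): $(p(u)-p(v))\cdot(\dot p(u)-\dot p(v))=0$ for $uv\in E$, and $p(v)\cdot\dot p(v)=\dot r(\chi(v))$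 for $v\in V$ (one row per edge and one row per vertex). $(G,\chi,p)$ is infinitesimally rigid if $\mathrm{rank}\,R(G,\chi,p)=(d+1)n-\binom{d+1}{2}+\min\{k,n-(d+1)\}$; it is independent if the rows of $R(G,\chi,p)$ are linearly independent; it is isostatic if it is independent and infinitesimally rigid. For a set $F$ of edges of the complete graph on $V$: $V(F)$ is the set of endvertices of edges in $F$, $k(F)$ is the number of colours in $\mathcal{C}$ appearing on $V(F)$, $r_d(F)$ is the rank of $F$ in the $d$-dimensional generic (Euclidean bar-joint) rigidity matroid on $V$, and $f_d(F)=r_d(F)+k(F)$. $\mathcal{N}_d(V,\chi)$ is the matroid on the edge set of the complete graph on $V$ in which a set $I$ is independent iff $|F|\le f_d(F)$ for every nonempty $F\subseteq I$. $G=(V,E)$ is $f_d$-tight if $E$ is a base of $\mathcal{N}_d(V,\chi)$. *)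

theory Defs
  imports
    "HOL-Analysis.Analysis"
    "HOL-Library.Poly_Mapping"
    "HOL-Library.Function_Algebras"
begin

section \<open>Matrices indexed by arbitrary finite sets\<close>

text \<open>A matrix is a function \<open>M\<close> together with a finite row index set \<open>I\<close> and a finite column
  index set \<open>J\<close>, so that rows and columns need not be numbered. Its rows are regarded as vectors
  in a function space, with entries outside \<open>J\<close> set to zero.\<close>

global_interpretation fun_vs: vector_space "\<lambda>(a::real) (f::'j \<Rightarrow> real) j. a * f j"
  by unfold_locales (simp_all add: fun_eq_iff algebra_simps)

definition mat_row :: "('i \<Rightarrow> 'j \<Rightarrow> real) \<Rightarrow> 'j set \<Rightarrow> 'i \<Rightarrow> 'j \<Rightarrow> real" where
  "mat_row M J i = (\<lambda>j. if j \<in> J then M i j else 0)"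

definition mat_rank :: "'i set \<Rightarrow> 'j set \<Rightarrow> ('i \<Rightarrow> 'j \<Rightarrow> real) \<Rightarrow> nat" where
  "mat_rank I J M = fun_vs.dim (mat_row M J ` I)"

text \<open>Linear independence of the rows as a family: in particular no row is repeated.\<close>

definition rows_independent :: "'i set \<Rightarrow> 'j set \<Rightarrow> ('i \<Rightarrow> 'j \<Rightarrow> real) \<Rightarrow> bool" where
  "rows_independent I J M \<longleftrightarrow>
     inj_on (mat_row M J) I \<and> fun_vs.independent (mat_row M J ` I)"


section \<open>Polynomials with rational coefficients\<close>

text \<open>A monomial maps each variable to its exponent, a polynomial maps each monomial to its
  coefficient.\<close>

type_synonym 'x qpoly = "('x \<Rightarrow>\<^sub>0 nat) \<Rightarrow>\<^sub>0 rat"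

definition qpolys :: "'x set \<Rightarrow> 'x qpoly set" where
  "qpolys X = {f. \<forall>m \<in> Poly_Mapping.keys f. Poly_Mapping.keys m \<subseteq> X}"

definition qvar :: "'x \<Rightarrow> 'x qpoly" where
  "qvar x = Poly_Mapping.single (Poly_Mapping.single x 1) 1"

definition qeval :: "('x \<Rightarrow> real) \<Rightarrow> 'x qpoly \<Rightarrow> real" where
  "qeval a f = (\<Sum>m \<in> Poly_Mapping.keys f. of_rat (Poly_Mapping.lookup f m) *
                  (\<Prod>x \<in> Poly_Mapping.keys m. a x ^ Poly_Mapping.lookup m x))"

text \<open>The ideal generated by the finite family \<open>(g v)\<^sub>v\<^sub>\<in>\<^sub>V\<close> in the polynomial ring with
  variables \<open>X\<close>.\<close>

definition qideal :: "'x set \<Rightarrow> 'v set \<Rightarrow> ('v \<Rightarrow> 'x qpoly) \<Rightarrow> 'x qpoly set" where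
  "qideal X V g = {f. \<exists>q. (\<forall>v\<in>V. q v \<in> qpolys X) \<and> f = (\<Sum>v\<in>V. q v * g v)}"


section \<open>Graphs and colourings\<close>

definition complete_edges :: "'v set \<Rightarrow> 'v set set" where
  "complete_edges V = {e. e \<subseteq> V \<and> card e = 2}"

definition simple_graph :: "'v set \<Rightarrow> 'v set set \<Rightarrow> bool" where
  "simple_graph V E \<longleftrightarrow> finite V \<and> E \<subseteq> complete_edges V"

text \<open>\<open>col v = None\<close> means that \<open>v\<close> is uncoloured.\<close>

definition colouring :: "'v set \<Rightarrow> 'c set \<Rightarrow> ('v \<Rightarrow> 'c option) \<Rightarrow> bool" where
  "colouring V C col \<longleftrightarrow> col ` V \<subseteq> insert None (Some ` C) \<and> Some ` C \<subseteq> col ` V"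

definition coloured_graph ::
  "nat \<Rightarrow> 'v set \<Rightarrow> 'v set set \<Rightarrow> 'c set \<Rightarrow> ('v \<Rightarrow> 'c option) \<Rightarrow> bool" where
  "coloured_graph k V E C col \<longleftrightarrow> simple_graph V E \<and> colouring V C col \<and> card C = k"


section \<open>Frameworks on concentric spheres\<close>

text \<open>A point of \<open>\<real>\<^sup>d\<^sup>+\<^sup>1\<close> is given by its coordinates with indices in \<open>{..d}\<close>; the values at
  other indices are irrelevant.\<close>

definition framework ::
  "nat \<Rightarrow> 'v set \<Rightarrow> 'c set \<Rightarrow> ('v \<Rightarrow> 'c option) \<Rightarrow> ('c \<Rightarrow> real) \<Rightarrow> ('v \<Rightarrow> nat \<Rightarrow> real) \<Rightarrow> bool" where
  "framework d V C col r p \<longleftrightarrow>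
     (\<forall>c\<in>C. r c > 0) \<and>
     (\<forall>v\<in>V. L2_set (p v) {..d} = (case col v of None \<Rightarrow> 1 | Some c \<Rightarrow> r c))"

text \<open>\<open>Inl (v, i)\<close> stands for the \<open>i\<close>-th coordinate of vertex \<open>v\<close>, and \<open>Inr c\<close> for the radius of
  colour \<open>c\<close>. This set indexes both the variables in the definition of genericity and the
  columns of the rigidity matrix.\<close>

definition coords :: "nat \<Rightarrow> 'v set \<Rightarrow> 'c set \<Rightarrow> (('v \<times> nat) + 'c) set" where
  "coords d V C = (V \<times> {..d}) <+> C"

definition sphere_poly :: "nat \<Rightarrow> ('v \<Rightarrow> 'c option) \<Rightarrow> 'v \<Rightarrow> (('v \<times> nat) + 'c) qpoly" where
  "sphere_poly d col v =
     (\<Sum>i\<le>d. qvar (Inl (v, i)) * qvar (Inl (v, i))) -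
     (case col v of None \<Rightarrow> 1 | Some c \<Rightarrow> (qvar (Inr c))\<^sup>2)"

definition generic_framework ::
  "nat \<Rightarrow> 'v set \<Rightarrow> 'c set \<Rightarrow> ('v \<Rightarrow> 'c option) \<Rightarrow> ('c \<Rightarrow> real) \<Rightarrow> ('v \<Rightarrow> nat \<Rightarrow> real) \<Rightarrow> bool" where
  "generic_framework d V C col r p \<longleftrightarrow>
     framework d V C col r p \<and>
     (\<forall>f \<in> qpolys (coords d V C).
        f \<noteq> 0 \<and> qeval (case_sum (\<lambda>(v, i). p v i) r) f = 0 \<longrightarrow>
        f \<in> qideal (coords d V C) V (sphere_poly d col))"

text \<open>The row of an edge \<open>e = uv\<close> has the entries of \<open>p u - p v\<close> in the columns of \<open>u\<close>, those of
  \<open>p v - p u\<close> in the columns of \<open>v\<close>, and zeros elsewhere. For \<open>w \<in> e\<close>, the sum below is the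
  difference of \<open>p w\<close> and the other end, as the term for \<open>u = w\<close> vanishes.\<close>

definition edge_row :: "('v \<Rightarrow> nat \<Rightarrow> real) \<Rightarrow> 'v set \<Rightarrow> 'v \<times> nat \<Rightarrow> real" where
  "edge_row p e = (\<lambda>(w, i). if w \<in> e then (\<Sum>u\<in>e. p w i - p u i) else 0)"

text \<open>Rows are indexed by edges (\<open>Inl\<close>) and vertices (\<open>Inr\<close>). The row of a vertex \<open>v\<close> encodes the
  equation \<open>p v \<bullet> p' v - r' (col v) = 0\<close> in the unknown velocities \<open>p'\<close> and \<open>r'\<close>, where the
  second term is absent if \<open>v\<close> is uncoloured.\<close>

definition rigidity_matrix ::
  "('v \<Rightarrow> 'c option) \<Rightarrow> ('v \<Rightarrow> nat \<Rightarrow> real) \<Rightarrow> 'v set + 'v \<Rightarrow> ('v \<times> nat) + 'c \<Rightarrow> real" where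
  "rigidity_matrix col p x y =
     (case x of
        Inl e \<Rightarrow> (case y of Inl wi \<Rightarrow> edge_row p e wi | Inr c \<Rightarrow> 0)
      | Inr v \<Rightarrow> (case y of Inl (w, i) \<Rightarrow> (if w = v then p v i else 0)
                         | Inr c \<Rightarrow> (if col v = Some c then - 1 else 0)))"

definition infinitesimally_rigid ::
  "nat \<Rightarrow> 'v set \<Rightarrow> 'v set set \<Rightarrow> 'c set \<Rightarrow> ('v \<Rightarrow> 'c option) \<Rightarrow> ('v \<Rightarrow> nat \<Rightarrow> real) \<Rightarrow> bool" where
  "infinitesimally_rigid d V E C col p \<longleftrightarrow>
     int (mat_rank (E <+> V) (coords d V C) (rigidity_matrix col p)) =
       int ((d + 1) * card V) - int ((d + 1) choose 2) +
       min (int (card C)) (int (card V) - int (d + 1))"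

definition independent_framework ::
  "nat \<Rightarrow> 'v set \<Rightarrow> 'v set set \<Rightarrow> 'c set \<Rightarrow> ('v \<Rightarrow> 'c option) \<Rightarrow> ('v \<Rightarrow> nat \<Rightarrow> real) \<Rightarrow> bool" where
  "independent_framework d V E C col p \<longleftrightarrow>
     rows_independent (E <+> V) (coords d V C) (rigidity_matrix col p)"

definition isostatic ::
  "nat \<Rightarrow> 'v set \<Rightarrow> 'v set set \<Rightarrow> 'c set \<Rightarrow> ('v \<Rightarrow> 'c option) \<Rightarrow> ('v \<Rightarrow> nat \<Rightarrow> real) \<Rightarrow> bool" where
  "isostatic d V E C col p \<longleftrightarrow>
     independent_framework d V E C col p \<and> infinitesimally_rigid d V E C col p"


section \<open>Matroids\<close>

text \<open>Matroids on a finite ground set are given by their independence predicates.\<close>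

definition matroid_rank :: "('a set \<Rightarrow> bool) \<Rightarrow> 'a set \<Rightarrow> nat" where
  "matroid_rank indep F = Max (card ` {I. I \<subseteq> F \<and> indep I})"

definition matroid_base :: "('a set \<Rightarrow> bool) \<Rightarrow> 'a set \<Rightarrow> bool" where
  "matroid_base indep B \<longleftrightarrow> indep B \<and> (\<forall>B'. indep B' \<and> B \<subseteq> B' \<longrightarrow> B' = B)"

text \<open>The generic rigidity matroid in \<open>\<real>\<^sup>d\<close>: a set of edges is independent iff its rows in the
  Euclidean rigidity matrix of a generic realisation are linearly independent. All generic
  realisations give the same matroid.\<close>

definition generic_points :: "nat \<Rightarrow> 'v set \<Rightarrow> ('v \<Rightarrow> nat \<Rightarrow> real) \<Rightarrow> bool" where
  "generic_points d V q \<longleftrightarrow>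
     (\<forall>f \<in> qpolys (V \<times> {..<d}). qeval (\<lambda>(v, i). q v i) f = 0 \<longrightarrow> f = 0)"

definition generic_rigidity_indep :: "nat \<Rightarrow> 'v set \<Rightarrow> 'v set set \<Rightarrow> bool" where
  "generic_rigidity_indep d V I \<longleftrightarrow>
     I \<subseteq> complete_edges V \<and>
     (\<exists>q. generic_points d V q \<and> rows_independent I (V \<times> {..<d}) (edge_row q))"

definition generic_rigidity_rank :: "nat \<Rightarrow> 'v set \<Rightarrow> 'v set set \<Rightarrow> nat" where
  "generic_rigidity_rank d V F = matroid_rank (generic_rigidity_indep d V) F"

definition colour_count :: "('v \<Rightarrow> 'c option) \<Rightarrow> 'v set set \<Rightarrow> nat" where
  "colour_count col F = card {c. Some c \<in> col ` \<Union>F}"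

definition f_fun :: "nat \<Rightarrow> 'v set \<Rightarrow> ('v \<Rightarrow> 'c option) \<Rightarrow> 'v set set \<Rightarrow> nat" where
  "f_fun d V col F = generic_rigidity_rank d V F + colour_count col F"

definition N_indep :: "nat \<Rightarrow> 'v set \<Rightarrow> ('v \<Rightarrow> 'c option) \<Rightarrow> 'v set set \<Rightarrow> bool" where
  "N_indep d V col I \<longleftrightarrow>
     I \<subseteq> complete_edges V \<and> (\<forall>F. F \<subseteq> I \<and> F \<noteq> {} \<longrightarrow> card F \<le> f_fun d V col F)"

definition f_tight :: "nat \<Rightarrow> 'v set \<Rightarrow> 'v set set \<Rightarrow> ('v \<Rightarrow> 'c option) \<Rightarrow> bool" where
  "f_tight d V E col \<longleftrightarrow> matroid_base (N_indep d V col) E"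

end

theory Submission
  imports Defs "HOL-Computational_Algebra.Polynomial"
begin

text \<open>The left kernel of the rigidity matrix consists of the stresses of the framework on which
  one linear form per colour, the load, vanishes. By central projection, the stresses of an edge
  set \<open>F\<close> form a space of dimension \<open>card F - r\<^sub>2(F)\<close>, so a set \<open>E\<close> whose rows are independent
  satisfies the count that defines \<open>\<N>\<^sub>2\<close>. Conversely let \<open>E\<close> satisfy the count and be a minimal
  set with dependent rows. If stresses of \<open>E\<close> are unique up to scaling, reflecting points in the
  origin, which scales each \<open>\<omega>(uv)\<close> by a sign, shows that a load is nonzero. The same argument
  applies if a stress avoids a colour. Otherwise \<open>E\<close> has a vertex of degree 3, and
  moving it to special positions on its sphere produces a stress that avoids a colour.\<close>

section \<open>Linear algebra\<close>

text \<open>The main tool is specialisation: by genericity a dependency of the rows at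
  \<open>p\<close> persists at every real point of the variety of the sphere polynomials. Points may
  be reflected, may coincide or may use other radii, so positions can be chosen at which stresses
  are computable. The obstacle is the dimension of the stress space. In dimension 1 a load-free
  stress of a reflected framework is a signed copy of the original one, and reflections decide. The
  count allows as many dimensions as there are colours, and in dimension 2 the load-free stress may
  change with the position. This is why a vertex has to move. A set of edges on a vertex set W
  satisfying the count has at most 2|W| - 3 + k edges, hence at most 2|W| - 1 for k \<le> 2, so the
  average degree is below 4; for k = 3 every degree could be 4. Degree at most 3 matters because any
  three points of a generic framework are linearly independent: the stress at the moved vertex is
  then forced by its new position.\<close>

lemma fun_sum_apply: "(\<Sum>i\<in>I. f i) j = (\<Sum>i\<in>I. f i j)" for f :: "'a \<Rightarrow> 'b \<Rightarrow> real"
  by (induction I rule: infinite_finite_induct) auto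

text \<open>This is the working form of independence: a dependency is a family \<open>x\<close> of
  coefficients, which later becomes a stress together with the coefficients of the vertex
  rows.\<close>

lemma rows_independent_iff:
  assumes "finite I"
  shows "rows_independent I J M \<longleftrightarrow>
    (\<forall>x. (\<forall>j\<in>J. (\<Sum>i\<in>I. x i * M i j) = 0) \<longrightarrow> (\<forall>i\<in>I. x i = 0))" (is "?L \<longleftrightarrow> ?R")
proof
  assume L: ?L
  show ?R
  proof (intro allI impI)
    fix x assume x: "\<forall>j\<in>J. (\<Sum>i\<in>I. x i * M i j) = 0"
    let ?u = "\<lambda>v. x (inv_into I (mat_row M J) v)"
    have inj: "inj_on (mat_row M J) I" and ind: "fun_vs.independent (mat_row M J ` I)"
      using L by (auto simp: rows_independent_def)
    have "(\<Sum>v\<in>mat_row M J ` I. (\<lambda>j. ?u v * v j)) = (\<Sum>i\<in>I. (\<lambda>j. x i * mat_row M J i j))"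
      using inj by (subst sum.reindex) (auto intro!: sum.cong)
    also have "\<dots> = 0"
    proof
      fix j show "(\<Sum>i\<in>I. (\<lambda>j. x i * mat_row M J i j)) j = 0 j"
        using x by (cases "j \<in> J") (auto simp: fun_sum_apply mat_row_def)
    qed
    finally have eq: "(\<Sum>v\<in>mat_row M J ` I. (\<lambda>j. ?u v * v j)) = 0" .
    have all: "\<forall>u. (\<Sum>v\<in>mat_row M J ` I. (\<lambda>j. u v * v j)) = 0 \<longrightarrow> (\<forall>v\<in>mat_row M J ` I. u v = 0)"
      using ind unfolding fun_vs.dependent_finite[OF finite_imageI[OF assms]] by blast
    have "\<forall>v\<in>mat_row M J ` I. ?u v = 0" by (rule mp[OF spec[OF all, of ?u] eq])
    then show "\<forall>i\<in>I. x i = 0" using inj by auto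
  qed
next
  assume R: ?R
  have inj: "inj_on (mat_row M J) I"
  proof (rule inj_onI, rule ccontr)
    fix a b assume ab: "a \<in> I" "b \<in> I" "mat_row M J a = mat_row M J b" "a \<noteq> b"
    let ?x = "\<lambda>i. if i = a then 1 else if i = b then - 1 else 0 :: real"
    have "(\<Sum>i\<in>I. ?x i * M i j) = 0" if "j \<in> J" for j
    proof -
      have "(\<Sum>i\<in>I. ?x i * M i j) = (\<Sum>i\<in>{a,b}. ?x i * M i j)"
        using ab assms by (intro sum.mono_neutral_right) auto
      also have "\<dots> = 0"
      proof -
        have "M a j = M b j" using that fun_cong[OF ab(3), of j] by (simp add: mat_row_def)
        then show ?thesis using \<open>a \<noteq> b\<close> by simp
      qed
      finally show ?thesis .
    qed
    then have "?x a = 0" using R[rule_format, of ?x a] ab by blast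
    then show False by simp
  qed
  have "fun_vs.independent (mat_row M J ` I)"
  proof
    assume "fun_vs.dependent (mat_row M J ` I)"
    then obtain u v where u: "v \<in> mat_row M J ` I" "u v \<noteq> 0"
      "(\<Sum>v\<in>mat_row M J ` I. (\<lambda>j. u v * v j)) = 0"
      using assms by (subst (asm) fun_vs.dependent_finite) auto
    have "(\<Sum>i\<in>I. (\<lambda>j. u (mat_row M J i) * mat_row M J i j)) = 0"
      using u(3) inj by (subst (asm) sum.reindex) auto
    from fun_cong[OF this] have "(\<Sum>i\<in>I. u (mat_row M J i) * mat_row M J i j) = 0" for j
      by (simp add: fun_sum_apply)
    moreover have "(\<Sum>i\<in>I. u (mat_row M J i) * mat_row M J i j) = (\<Sum>i\<in>I. u (mat_row M J i) * M i j)"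
      if "j \<in> J" for j using that by (intro sum.cong) (simp_all add: mat_row_def)
    ultimately have "\<forall>j\<in>J. (\<Sum>i\<in>I. u (mat_row M J i) * M i j) = 0" by simp
    then show False using R[rule_format, of "\<lambda>i. u (mat_row M J i)"] u by auto
  qed
  with inj show ?L by (simp add: rows_independent_def)
qed

lemma rows_independent_card_le:
  assumes "finite I" "finite J" "rows_independent I J M"
  shows "card I \<le> card J"
proof -
  let ?u = "\<lambda>j k. if k = j then 1 else 0 :: real"
  have "mat_row M J i \<in> fun_vs.span (?u ` J)" for i
  proof -
    have "mat_row M J i = (\<Sum>j\<in>J. (\<lambda>k. M i j * ?u j k))"
      using assms by (auto simp: fun_eq_iff fun_sum_apply mat_row_def if_distrib cong: if_cong)
    also have "\<dots> \<in> fun_vs.span (?u ` J)"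
      by (intro fun_vs.span_sum fun_vs.span_scale fun_vs.span_base) auto
    finally show ?thesis .
  qed
  then have "card (mat_row M J ` I) \<le> card (?u ` J)"
    using assms fun_vs.independent_span_bound[of "?u ` J" "mat_row M J ` I"]
    by (auto simp: rows_independent_def)
  then show ?thesis
    using assms card_image_le[of J ?u] by (simp add: rows_independent_def card_image)
qed

text \<open>More unknowns than equations. It serves to combine stresses so that prescribed values or
  loads vanish.\<close>

lemma homogeneous_nontrivial:
  fixes m :: "'i \<Rightarrow> 'j \<Rightarrow> real"
  assumes "finite I" "finite J" "card J < card I"
  obtains x where "\<And>j. j \<in> J \<Longrightarrow> (\<Sum>i\<in>I. x i * m i j) = 0" "\<exists>i\<in>I. x i \<noteq> 0"
  using rows_independent_card_le[OF assms(1,2), of m] assms(3) rows_independent_iff[OF assms(1), of J m]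
  by (meson not_le)

lemma mat_rank_independent:
  assumes "rows_independent I J M"
  shows "mat_rank I J M = card I"
  using assms by (simp add: mat_rank_def rows_independent_def fun_vs.dim_eq_card_independent card_image)

text \<open>The exchange property of the linear matroid of rows; it will enlarge an edge set that is
  smaller than a known independent one.\<close>

lemma rows_independent_augment:
  assumes "finite A" "finite B" "rows_independent A J M" "rows_independent B J M" "card A < card B"
  obtains b where "b \<in> B - A" "rows_independent (insert b A) J M"
proof -
  have "\<not> mat_row M J ` B \<subseteq> fun_vs.span (mat_row M J ` A)"
  proof
    assume "mat_row M J ` B \<subseteq> fun_vs.span (mat_row M J ` A)"
    then have "card (mat_row M J ` B) \<le> card (mat_row M J ` A)"
      using assms fun_vs.independent_span_bound[of "mat_row M J ` A" "mat_row M J ` B"]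
      by (auto simp: rows_independent_def)
    then show False using assms by (simp add: rows_independent_def card_image)
  qed
  then obtain b where b: "b \<in> B" "mat_row M J b \<notin> fun_vs.span (mat_row M J ` A)" by auto
  then have nA: "mat_row M J b \<notin> mat_row M J ` A" using fun_vs.span_base[of "mat_row M J b" "mat_row M J ` A"] by auto
  then have "rows_independent (insert b A) J M"
    using assms b by (auto simp: rows_independent_def fun_vs.independent_insert)
  with b nA that show ?thesis by blast
qed

section \<open>Polynomials with rational coefficients\<close>

lemma qeval_superset:
  assumes "finite K" "Poly_Mapping.keys f \<subseteq> K"
  shows "qeval a f = (\<Sum>m \<in> K. of_rat (Poly_Mapping.lookup f m) *
     (\<Prod>x \<in> Poly_Mapping.keys m. a x ^ Poly_Mapping.lookup m x))"
  unfolding qeval_def using assms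
  by (intro sum.mono_neutral_left) (auto simp: in_keys_iff)

lemma qeval_add: "qeval a (f + g) = qeval a f + qeval a g"
proof -
  let ?K = "Poly_Mapping.keys f \<union> Poly_Mapping.keys g"
  show ?thesis
    using Poly_Mapping.keys_add[of f g]
    by (simp add: qeval_superset[of ?K] lookup_add of_rat_add distrib_right sum.distrib)
qed

lemma qeval_zero [simp]: "qeval a 0 = 0"
  by (simp add: qeval_def)

lemma qeval_sum: "qeval a (\<Sum>i\<in>I. f i) = (\<Sum>i\<in>I. qeval a (f i))"
  by (induction I rule: infinite_finite_induct) (auto simp: qeval_add)

lemma qeval_uminus: "qeval a (- f) = - qeval a f"
  using qeval_add[of a f "- f"] by simp

lemma qeval_diff: "qeval a (f - g) = qeval a f - qeval a g"
  using qeval_add[of a f "- g"] by (simp add: qeval_uminus)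

definition monomial_value :: "('x \<Rightarrow> real) \<Rightarrow> ('x \<Rightarrow>\<^sub>0 nat) \<Rightarrow> real" where
  "monomial_value a m = (\<Prod>x \<in> Poly_Mapping.keys m. a x ^ Poly_Mapping.lookup m x)"

lemma monomial_value_superset:
  assumes "finite K" "Poly_Mapping.keys m \<subseteq> K"
  shows "monomial_value a m = (\<Prod>x \<in> K. a x ^ Poly_Mapping.lookup m x)"
  unfolding monomial_value_def using assms
  by (intro prod.mono_neutral_left) (auto simp: in_keys_iff)

lemma monomial_value_add: "monomial_value a (m + n) = monomial_value a m * monomial_value a n"
proof -
  let ?K = "Poly_Mapping.keys m \<union> Poly_Mapping.keys n"
  show ?thesis
    using Poly_Mapping.keys_add[of m n]
    by (simp add: monomial_value_superset[of ?K] lookup_add power_add prod.distrib)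
qed

lemma qeval_single: "qeval a (Poly_Mapping.single m c) = of_rat c * monomial_value a m"
  by (subst qeval_superset[of "{m}"]) (auto simp: monomial_value_def)

lemma poly_mapping_sum_single: "f = (\<Sum>m\<in>Poly_Mapping.keys f. Poly_Mapping.single m (Poly_Mapping.lookup f m))"
proof (rule poly_mapping_eqI)
  fix m
  show "Poly_Mapping.lookup f m =
    Poly_Mapping.lookup (\<Sum>m\<in>Poly_Mapping.keys f. Poly_Mapping.single m (Poly_Mapping.lookup f m)) m"
    by (simp add: lookup_sum lookup_single when_def in_keys_iff)
qed

lemma qeval_mult: "qeval a (f * g) = qeval a f * qeval a g"
proof -
  have "f * g = (\<Sum>m\<in>Poly_Mapping.keys f. \<Sum>n\<in>Poly_Mapping.keys g.
      Poly_Mapping.single (m + n) (Poly_Mapping.lookup f m * Poly_Mapping.lookup g n))"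
    by (subst poly_mapping_sum_single[of f], subst poly_mapping_sum_single[of g])
      (simp add: sum_product mult_single)
  then have "qeval a (f * g) = (\<Sum>m\<in>Poly_Mapping.keys f. \<Sum>n\<in>Poly_Mapping.keys g.
      (of_rat (Poly_Mapping.lookup f m) * monomial_value a m) *
      (of_rat (Poly_Mapping.lookup g n) * monomial_value a n))"
    by (simp add: qeval_sum qeval_single monomial_value_add of_rat_mult mult_ac)
  then show ?thesis
    by (simp add: qeval_def sum_product monomial_value_def)
qed

lemma qeval_qvar [simp]: "qeval a (qvar x) = a x"
  by (simp add: qvar_def qeval_single monomial_value_def)

lemma qeval_one [simp]: "qeval a 1 = 1"
  unfolding single_one[symmetric] by (subst qeval_single) (simp add: monomial_value_def)

lemma qpolys_zero [simp]: "0 \<in> qpolys X"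
  by (simp add: qpolys_def)

lemma qpolys_one [simp]: "1 \<in> qpolys X"
  by (simp add: qpolys_def)

lemma qpolys_qvar [simp]: "qvar x \<in> qpolys X \<longleftrightarrow> x \<in> X"
  by (auto simp: qpolys_def qvar_def)

lemma qpolys_diff: "f \<in> qpolys X \<Longrightarrow> g \<in> qpolys X \<Longrightarrow> f - g \<in> qpolys X"
  using Poly_Mapping.keys_diff[of f g] by (fastforce simp: qpolys_def)

lemma qpolys_mult: "f \<in> qpolys X \<Longrightarrow> g \<in> qpolys X \<Longrightarrow> f * g \<in> qpolys X"
proof -
  assume fg: "f \<in> qpolys X" "g \<in> qpolys X"
  show "f * g \<in> qpolys X" unfolding qpolys_def
  proof (clarify)
    fix m x assume "m \<in> Poly_Mapping.keys (f * g)" "x \<in> Poly_Mapping.keys m"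
    then obtain b c where "m = b + c" "b \<in> Poly_Mapping.keys f" "c \<in> Poly_Mapping.keys g"
      using Poly_Mapping.keys_mult[of f g] by blast
    then show "x \<in> X" using fg Poly_Mapping.keys_add[of b c] \<open>x \<in> Poly_Mapping.keys m\<close>
      by (fastforce simp: qpolys_def)
  qed
qed

lemma qpolys_uminus: "f \<in> qpolys X \<Longrightarrow> - f \<in> qpolys X"
  using qpolys_diff[of 0 X f] by simp

text \<open>Fraction-free Gaussian elimination; the witness is the product of the pivots.\<close>

lemma rows_independent_witness:
  fixes m :: "'i \<Rightarrow> 'j \<Rightarrow> 'x qpoly"
  assumes "finite I" "\<And>i j. i \<in> I \<Longrightarrow> j \<in> J \<Longrightarrow> m i j \<in> qpolys X"
    and "rows_independent I J (\<lambda>i j. qeval a (m i j))"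
  shows "\<exists>f\<in>qpolys X. qeval a f \<noteq> 0 \<and>
    (\<forall>b. qeval b f \<noteq> 0 \<longrightarrow> rows_independent I J (\<lambda>i j. qeval b (m i j)))"
  using assms
proof (induction I arbitrary: m rule: finite_induct)
  case empty
  show ?case by (intro bexI[of _ 1]) (auto simp: rows_independent_iff)
next
  case (insert i0 I)
  have ind: "\<forall>x. (\<forall>j\<in>J. (\<Sum>i\<in>insert i0 I. x i * qeval a (m i j)) = 0) \<longrightarrow> (\<forall>i\<in>insert i0 I. x i = 0)"
    using insert.prems(2) insert.hyps by (subst (asm) rows_independent_iff) auto
  have "\<exists>j0\<in>J. qeval a (m i0 j0) \<noteq> 0"
  proof (rule ccontr)
    assume "\<not> ?thesis"
    then have "\<forall>j\<in>J. (\<Sum>i\<in>insert i0 I. (if i = i0 then 1 else 0) * qeval a (m i j)) = 0"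
      using insert.hyps by (simp add: sum.neutral)
    then show False using ind[rule_format, of "\<lambda>i. if i = i0 then 1 else 0" i0] by simp
  qed
  then obtain j0 where j0: "j0 \<in> J" "qeval a (m i0 j0) \<noteq> 0" by blast
  define m' where "m' i j = m i0 j0 * m i j - m i j0 * m i0 j" for i j
  have m': "qeval b (m' i j) = qeval b (m i0 j0) * qeval b (m i j) - qeval b (m i j0) * qeval b (m i0 j)"
    for b i j by (simp add: m'_def qeval_diff qeval_mult)
  \<comment> \<open>A combination of the reduced rows is a combination of the original ones in which
    \<open>i0\<close> receives the coefficient that cancels column \<open>j0\<close>.\<close>
  have comb: "(\<Sum>i\<in>I. x i * qeval b (m' i j)) =
      (\<Sum>i\<in>insert i0 I. (if i = i0 then - (\<Sum>i\<in>I. x i * qeval b (m i j0)) else qeval b (m i0 j0) * x i) * qeval b (m i j))"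
    for x b j
  proof -
    have "(\<Sum>i\<in>I. (if i = i0 then - (\<Sum>i\<in>I. x i * qeval b (m i j0)) else qeval b (m i0 j0) * x i) * qeval b (m i j)) =
      (\<Sum>i\<in>I. qeval b (m i0 j0) * x i * qeval b (m i j))"
      using insert.hyps by (intro sum.cong) auto
    then show ?thesis
      using insert.hyps
      by (simp add: m' right_diff_distrib sum_subtractf sum_distrib_left sum_distrib_right mult_ac)
  qed
  have "rows_independent I J (\<lambda>i j. qeval a (m' i j))"
    unfolding rows_independent_iff[OF insert.hyps(1)]
  proof (intro allI impI ballI)
    fix x i assume x: "\<forall>j\<in>J. (\<Sum>i\<in>I. x i * qeval a (m' i j)) = 0" and i: "i \<in> I"
    have "i \<noteq> i0" using i insert.hyps by auto
    moreover have "(if i = i0 then - (\<Sum>i\<in>I. x i * qeval a (m i j0)) else qeval a (m i0 j0) * x i) = 0"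
      using x i by (intro ind[rule_format, of "\<lambda>i. if i = i0 then - (\<Sum>i\<in>I. x i * qeval a (m i j0)) else qeval a (m i0 j0) * x i" i])
        (auto simp only: comb[symmetric])
    ultimately show "x i = 0" using j0 by simp
  qed
  moreover have "m' i j \<in> qpolys X" if "i \<in> I" "j \<in> J" for i j
    using insert.prems(1) j0 that by (auto simp: m'_def intro!: qpolys_diff qpolys_mult)
  ultimately obtain f where f: "f \<in> qpolys X" "qeval a f \<noteq> 0"
    "\<And>b. qeval b f \<noteq> 0 \<Longrightarrow> rows_independent I J (\<lambda>i j. qeval b (m' i j))"
    using insert.IH[of m'] by blast
  show ?case
  proof (intro bexI[of _ "m i0 j0 * f"] conjI allI impI)
    show "m i0 j0 * f \<in> qpolys X" using f insert.prems j0 by (auto intro!: qpolys_mult)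
    show "qeval a (m i0 j0 * f) \<noteq> 0" using f j0 by (simp add: qeval_mult)
    fix b assume b: "qeval b (m i0 j0 * f) \<noteq> 0"
    then have piv: "qeval b (m i0 j0) \<noteq> 0" and ri: "rows_independent I J (\<lambda>i j. qeval b (m' i j))"
      using f by (auto simp: qeval_mult)
    have fin: "finite (insert i0 I)" using insert.hyps by simp
    show "rows_independent (insert i0 I) J (\<lambda>i j. qeval b (m i j))"
      unfolding rows_independent_iff[OF fin]
    proof (intro allI impI)
      fix x assume x: "\<forall>j\<in>J. (\<Sum>i\<in>insert i0 I. x i * qeval b (m i j)) = 0"
      then have x': "x i0 * qeval b (m i0 j) = - (\<Sum>i\<in>I. x i * qeval b (m i j))" if "j \<in> J" for j
        using that insert.hyps by (auto simp: add_eq_0_iff2)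
      have "(\<Sum>i\<in>I. x i * qeval b (m' i j)) = 0" if "j \<in> J" for j
      proof -
        have "(\<Sum>i\<in>I. x i * qeval b (m' i j)) =
          qeval b (m i0 j0) * (\<Sum>i\<in>I. x i * qeval b (m i j)) - qeval b (m i0 j) * (\<Sum>i\<in>I. x i * qeval b (m i j0))"
          by (simp add: m' right_diff_distrib sum_subtractf sum_distrib_left mult_ac)
        moreover have "(\<Sum>i\<in>I. x i * qeval b (m i j)) = - (x i0 * qeval b (m i0 j))"
          "(\<Sum>i\<in>I. x i * qeval b (m i j0)) = - (x i0 * qeval b (m i0 j0))"
          using x'[OF that] x'[OF j0(1)] by simp_all
        ultimately show ?thesis by simp
      qed
      then have 0: "\<forall>i\<in>I. x i = 0" using ri insert.hyps by (subst (asm) rows_independent_iff) auto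
      then have "x i0 = 0" using x' j0 piv by fastforce
      with 0 show "\<forall>i\<in>insert i0 I. x i = 0" by simp
    qed
  qed
qed

section \<open>Generic points\<close>

text \<open>A finitely supported function is determined by its graph over the support, and a
  countable set has only countably many finite subsets.\<close>

lemma countable_poly_mapping:
  assumes "countable (UNIV :: 'a set)" "countable (UNIV :: 'b::zero set)"
  shows "countable (UNIV :: ('a \<Rightarrow>\<^sub>0 'b) set)"
proof -
  let ?g = "\<lambda>f :: 'a \<Rightarrow>\<^sub>0 'b. (\<lambda>m. (m, Poly_Mapping.lookup f m)) ` Poly_Mapping.keys f"
  have "inj ?g"
  proof (rule injI, rule poly_mapping_eqI)
    fix f g :: "'a \<Rightarrow>\<^sub>0 'b" and k assume eq: "?g f = ?g g"
    have "(k, b) \<in> ?g f \<longleftrightarrow> b = Poly_Mapping.lookup f k \<and> b \<noteq> 0" for f :: "'a \<Rightarrow>\<^sub>0 'b" and b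
      by (auto simp: in_keys_iff)
    with eq show "Poly_Mapping.lookup f k = Poly_Mapping.lookup g k" by metis
  qed
  moreover have "countable (UNIV :: ('a \<times> 'b) set)"
    using assms by (metis UNIV_Times_UNIV countable_SIGMA)
  then have "countable {A :: ('a \<times> 'b) set. finite A \<and> A \<subseteq> UNIV}"
    by (rule countable_Collect_finite_subset)
  then have "countable (range ?g)"
    by (rule countable_subset[rotated]) auto
  ultimately show ?thesis by (rule countable_image_inj_on[rotated])
qed

text \<open>Reads \<open>f\<close> as a polynomial in \<open>x\<close> alone. \<open>g\<close> is
  the coefficient of the highest power of \<open>x\<close>, a polynomial in the other variables, so
  \<open>P\<close> is nonzero as soon as \<open>g\<close> does not vanish at
  \<open>a\<close>.\<close>

lemma leading_coefficient:
  fixes f :: "'x qpoly"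
  assumes "f \<in> qpolys (insert x X)" "x \<notin> X" "f \<noteq> 0"
  obtains g P where "g \<in> qpolys X" "g \<noteq> 0" "\<And>t. qeval (a(x := t)) f = poly P t"
    "qeval a g = coeff P (Max ((\<lambda>m. Poly_Mapping.lookup m x) ` Poly_Mapping.keys f))"
proof -
  define k where "k = Max ((\<lambda>m. Poly_Mapping.lookup m x) ` Poly_Mapping.keys f)"
  \<comment> \<open>Multiplies a monomial by the top power of \<open>x\<close>, so that
    \<open>map_key s\<close> extracts the coefficient of that power; maximality of \<open>k\<close>
    keeps \<open>x\<close> out of \<open>g\<close>.\<close>
  define s where "s m = m + Poly_Mapping.single x k" for m :: "'x \<Rightarrow>\<^sub>0 nat"
  define g where "g = Poly_Mapping.map_key s f"
  have "inj s" by (auto simp: s_def inj_def)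
  then have lg: "Poly_Mapping.lookup g m = Poly_Mapping.lookup f (s m)" for m
    by (simp add: g_def map_key.rep_eq)
  have le: "Poly_Mapping.lookup m x \<le> k" if "m \<in> Poly_Mapping.keys f" for m
    using that by (simp add: k_def)
  have sx: "Poly_Mapping.lookup (s m) x = Poly_Mapping.lookup m x + k" for m
    by (simp add: s_def lookup_add)
  have sy: "y \<noteq> x \<Longrightarrow> Poly_Mapping.lookup (s m) y = Poly_Mapping.lookup m y" for m y
    by (simp add: s_def lookup_add lookup_single)
  have gx: "Poly_Mapping.lookup m x = 0" if "m \<in> Poly_Mapping.keys g" for m
    using le[of "s m"] that sx[of m] by (simp add: in_keys_iff lg)
  have keys: "Poly_Mapping.keys (s m) - {x} = Poly_Mapping.keys m" if "m \<in> Poly_Mapping.keys g" for m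
  proof (rule set_eqI)
    show "y \<in> Poly_Mapping.keys (s m) - {x} \<longleftrightarrow> y \<in> Poly_Mapping.keys m" for y
      using gx[OF that] sy[of y m] by (cases "y = x") (auto simp: in_keys_iff)
  qed
  have g: "g \<in> qpolys X"
    unfolding qpolys_def
  proof (clarify)
    fix m y assume m: "m \<in> Poly_Mapping.keys g" and y: "y \<in> Poly_Mapping.keys m"
    have "s m \<in> Poly_Mapping.keys f" using m by (simp add: in_keys_iff lg)
    then have "Poly_Mapping.keys (s m) \<subseteq> insert x X" using assms by (auto simp: qpolys_def)
    then show "y \<in> X" using keys[OF m] y by auto
  qed
  have pre: "\<exists>m'. s m' = m" if "Poly_Mapping.lookup m x = k" for m
  proof
    show "s (Poly_Mapping.update x 0 m) = m"
      by (rule poly_mapping_eqI)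
        (use that in \<open>auto simp: s_def lookup_add lookup_update lookup_single when_def\<close>)
  qed
  have "k \<in> (\<lambda>m. Poly_Mapping.lookup m x) ` Poly_Mapping.keys f"
    using assms(3) unfolding k_def by (intro Max_in) auto
  then obtain m0 where m0: "m0 \<in> Poly_Mapping.keys f" "Poly_Mapping.lookup m0 x = k" by auto
  with pre obtain m1 where "s m1 = m0" by blast
  with m0 have "Poly_Mapping.lookup g m1 \<noteq> 0" by (simp add: lg in_keys_iff)
  then have "g \<noteq> 0" by auto
  define b where "b m = of_rat (Poly_Mapping.lookup f m) *
    (\<Prod>y\<in>Poly_Mapping.keys m - {x}. a y ^ Poly_Mapping.lookup m y)" for m
  define P where "P = (\<Sum>m\<in>Poly_Mapping.keys f. monom (b m) (Poly_Mapping.lookup m x))"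
  have "qeval (a(x := t)) f = poly P t" for t
  proof -
    have "(\<Prod>y\<in>Poly_Mapping.keys m. (a(x := t)) y ^ Poly_Mapping.lookup m y) =
      (\<Prod>y\<in>Poly_Mapping.keys m - {x}. a y ^ Poly_Mapping.lookup m y) * t ^ Poly_Mapping.lookup m x" for m
    proof -
      have "(\<Prod>y\<in>Poly_Mapping.keys m. (a(x := t)) y ^ Poly_Mapping.lookup m y) =
        (\<Prod>y\<in>insert x (Poly_Mapping.keys m). (a(x := t)) y ^ Poly_Mapping.lookup m y)"
        by (intro prod.mono_neutral_left) (auto simp: in_keys_iff)
      also have "\<dots> = t ^ Poly_Mapping.lookup m x *
        (\<Prod>y\<in>Poly_Mapping.keys m - {x}. (a(x := t)) y ^ Poly_Mapping.lookup m y)"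
        by (subst prod.insert_remove) auto
      also have "(\<Prod>y\<in>Poly_Mapping.keys m - {x}. (a(x := t)) y ^ Poly_Mapping.lookup m y) =
        (\<Prod>y\<in>Poly_Mapping.keys m - {x}. a y ^ Poly_Mapping.lookup m y)"
        by (intro prod.cong) auto
      finally show ?thesis by simp
    qed
    then show ?thesis by (simp add: qeval_def P_def poly_sum poly_monom b_def mult_ac)
  qed
  moreover have "qeval a g = coeff P k"
  proof -
    have "coeff P k = (\<Sum>m\<in>Poly_Mapping.keys f. if Poly_Mapping.lookup m x = k then b m else 0)"
      by (simp add: P_def coeff_sum)
    also have "\<dots> = sum b {m\<in>Poly_Mapping.keys f. Poly_Mapping.lookup m x = k}"
      by (simp add: sum.inter_filter)
    also have "{m\<in>Poly_Mapping.keys f. Poly_Mapping.lookup m x = k} = s ` Poly_Mapping.keys g"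
      using pre gx by (auto simp: in_keys_iff lg sx) (metis imageI in_keys_iff lg)
    also have "sum b (s ` Poly_Mapping.keys g) = (\<Sum>m\<in>Poly_Mapping.keys g. b (s m))"
      by (subst sum.reindex) (use \<open>inj s\<close> in \<open>auto intro: inj_on_subset\<close>)
    also have "\<dots> = qeval a g"
      unfolding qeval_def b_def
    proof (intro sum.cong refl arg_cong2[where f = "(*)"])
      fix m assume m: "m \<in> Poly_Mapping.keys g"
      show "real_of_rat (Poly_Mapping.lookup f (s m)) = real_of_rat (Poly_Mapping.lookup g m)"
        by (simp add: lg)
      show "(\<Prod>y\<in>Poly_Mapping.keys (s m) - {x}. a y ^ Poly_Mapping.lookup (s m) y) =
        (\<Prod>x\<in>Poly_Mapping.keys m. a x ^ Poly_Mapping.lookup m x)"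
        unfolding keys[OF m] by (intro prod.cong) (use gx[OF m] sy in_keys_iff in \<open>metis\<close>)+
    qed
    finally show ?thesis by simp
  qed
  ultimately show ?thesis using that[of g P] g \<open>g \<noteq> 0\<close> by (simp add: k_def)
qed

text \<open>Coordinates are chosen one at a time: each of the countably many nonzero polynomials
  excludes finitely many values of the new coordinate, and the reals are uncountable.\<close>

lemma algebraically_independent_point_exists:
  fixes X :: "'x::countable set"
  assumes "finite X"
  shows "\<exists>a. \<forall>f\<in>qpolys X. qeval a f = 0 \<longrightarrow> f = 0"
  using assms
proof (induction X rule: finite_induct)
  case empty
  have "f = 0" if "f \<in> qpolys {}" "qeval a f = 0" for f :: "'x qpoly" and a
  proof -
    have keys: "m = 0" if "m \<in> Poly_Mapping.keys f" for m
      using \<open>f \<in> qpolys {}\<close> that by (auto simp: qpolys_def keys_eq_empty)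
    then have "qeval a f = of_rat (Poly_Mapping.lookup f 0)"
      by (subst qeval_superset[of "{0}"]) auto
    then have "Poly_Mapping.lookup f 0 = 0" using that by simp
    then have "Poly_Mapping.keys f = {}" using keys by (metis equals0I in_keys_iff)
    then show ?thesis by simp
  qed
  then show ?case by blast
next
  case (insert x X)
  then obtain a where a: "\<And>f. f \<in> qpolys X \<Longrightarrow> qeval a f = 0 \<Longrightarrow> f = 0" by blast
  let ?F = "{f \<in> qpolys (insert x X). f \<noteq> 0}"
  have "countable {t. qeval (a(x := t)) f = 0}" if "f \<in> ?F" for f
  proof -
    obtain g P where gP: "g \<in> qpolys X" "g \<noteq> 0" "\<And>t. qeval (a(x := t)) f = poly P t"
      "qeval a g = coeff P (Max ((\<lambda>m. Poly_Mapping.lookup m x) ` Poly_Mapping.keys f))"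
      using leading_coefficient[of f x X a] \<open>f \<in> ?F\<close> insert.hyps by (metis (lifting) mem_Collect_eq)
    then have "P \<noteq> 0" using a[of g] by auto
    then show ?thesis using poly_roots_finite[of P] gP by (simp add: countable_finite)
  qed
  moreover have "countable (UNIV :: 'x qpoly set)"
    by (intro countable_poly_mapping) auto
  then have "countable ?F" by (rule countable_subset[rotated]) auto
  ultimately have "countable (\<Union>f\<in>?F. {t. qeval (a(x := t)) f = 0})"
    by (intro countable_UN)
  then have "(\<Union>f\<in>?F. {t. qeval (a(x := t)) f = 0}) \<noteq> UNIV"
    using uncountable_UNIV_real by metis
  then obtain t where "t \<notin> (\<Union>f\<in>?F. {t. qeval (a(x := t)) f = 0})" by blast
  then show ?case by (intro exI[of _ "a(x := t)"]) blast
qed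

lemma generic_points_exist:
  assumes "finite V"
  shows "\<exists>q. generic_points d (V :: 'v::countable set) q"
proof -
  obtain a where a: "\<forall>f\<in>qpolys (V \<times> {..<d}). qeval a f = 0 \<longrightarrow> f = 0"
    using algebraically_independent_point_exists[of "V \<times> {..<d}"] assms by auto
  have "(\<lambda>(v, i). (curry a) v i) = a" by auto
  with a show ?thesis by (auto simp: generic_points_def intro!: exI[of _ "curry a"])
qed

text \<open>The witness polynomial does not vanish at \<open>a\<close>, so it is not the zero
  polynomial and cannot vanish at \<open>q\<close>.\<close>

lemma generic_points_rows_independent:
  assumes "generic_points d V q" "finite I"
    and "\<And>i j. i \<in> I \<Longrightarrow> j \<in> J \<Longrightarrow> m i j \<in> qpolys (V \<times> {..<d})"
    and "rows_independent I J (\<lambda>i j. qeval a (m i j))"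
  shows "rows_independent I J (\<lambda>i j. qeval (\<lambda>(v, i). q v i) (m i j))"
proof -
  obtain f where f: "f \<in> qpolys (V \<times> {..<d})" "qeval a f \<noteq> 0"
    "\<And>b. qeval b f \<noteq> 0 \<Longrightarrow> rows_independent I J (\<lambda>i j. qeval b (m i j))"
    using rows_independent_witness[OF assms(2-4)] by blast
  then show ?thesis using assms(1) unfolding generic_points_def by (metis qeval_zero)
qed

section \<open>Specialisation on the variety of frameworks on spheres\<close>

definition radius :: "('v \<Rightarrow> 'c option) \<Rightarrow> ('c \<Rightarrow> real) \<Rightarrow> 'v \<Rightarrow> real" where
  "radius col r v = (case col v of None \<Rightarrow> 1 | Some c \<Rightarrow> r c)"

text \<open>The real points of the variety that carries the frameworks; the radii may be negative.\<close>

definition on_spheres :: "nat \<Rightarrow> 'v set \<Rightarrow> ('v \<Rightarrow> 'c option) \<Rightarrow> ('c \<Rightarrow> real) \<Rightarrow> ('v \<Rightarrow> nat \<Rightarrow> real) \<Rightarrow> bool"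
  where "on_spheres d V col r p \<longleftrightarrow> (\<forall>v\<in>V. (\<Sum>i\<le>d. (p v i)\<^sup>2) = (radius col r v)\<^sup>2)"

lemma framework_on_spheres:
  assumes "framework d V C col r p"
  shows "on_spheres d V col r p"
  unfolding on_spheres_def
proof
  fix v assume "v \<in> V"
  then have "L2_set (p v) {..d} = radius col r v" using assms by (simp add: framework_def radius_def)
  then show "(\<Sum>i\<le>d. (p v i)\<^sup>2) = (radius col r v)\<^sup>2"
    by (metis L2_set_def real_sqrt_ge_zero real_sqrt_pow2 sum_nonneg zero_le_power2)
qed

lemma qeval_sphere_poly:
  assumes "on_spheres d V col r p" "v \<in> V"
  shows "qeval (case_sum (\<lambda>(v, i). p v i) r) (sphere_poly d col v) = 0"
  using assms
  by (auto simp: sphere_poly_def qeval_diff qeval_sum qeval_mult on_spheres_def radius_def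
      power2_eq_square split: option.splits)

text \<open>A witness polynomial that vanishes at \<open>p\<close> would lie in the ideal of the
  sphere polynomials and vanish on the whole variety, contrary to its value at
  \<open>p'\<close>.\<close>

lemma generic_framework_rows_independent:
  assumes gen: "generic_framework d V C col r p" and "on_spheres d V col r' p'" "finite I"
    and "\<And>i j. i \<in> I \<Longrightarrow> j \<in> J \<Longrightarrow> m i j \<in> qpolys (coords d V C)"
    and "rows_independent I J (\<lambda>i j. qeval (case_sum (\<lambda>(v, i). p' v i) r') (m i j))"
  shows "rows_independent I J (\<lambda>i j. qeval (case_sum (\<lambda>(v, i). p v i) r) (m i j))"
proof -
  obtain f where f: "f \<in> qpolys (coords d V C)" "qeval (case_sum (\<lambda>(v, i). p' v i) r') f \<noteq> 0"
    "\<And>b. qeval b f \<noteq> 0 \<Longrightarrow> rows_independent I J (\<lambda>i j. qeval b (m i j))"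
    using rows_independent_witness[OF assms(3-5)] by blast
  have "qeval (case_sum (\<lambda>(v, i). p v i) r) f \<noteq> 0"
  proof
    assume "qeval (case_sum (\<lambda>(v, i). p v i) r) f = 0"
    moreover have "f \<noteq> 0" using f(2) by auto
    ultimately obtain q where q: "f = (\<Sum>v\<in>V. q v * sphere_poly d col v)"
      using gen f(1) by (auto simp: generic_framework_def qideal_def)
    have "qeval (case_sum (\<lambda>(v, i). p' v i) r') f = 0"
      unfolding q qeval_sum qeval_mult
      using qeval_sphere_poly[OF assms(2)] by (simp add: sum.neutral)
    then show False using f(2) by simp
  qed
  then show ?thesis by (rule f(3))
qed

section \<open>Stresses\<close>

text \<open>For a framework on spheres the vertex rows can be absorbed into free diagonal entries \<open>d\<close>
  of the stress matrix.\<close>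

definition stress :: "'v set \<Rightarrow> 'v set set \<Rightarrow> ('v \<Rightarrow> nat \<Rightarrow> real) \<Rightarrow> ('v set \<Rightarrow> real) \<Rightarrow> ('v \<Rightarrow> real) \<Rightarrow> bool"
  where "stress V F p \<omega> d \<longleftrightarrow> (\<forall>e. e \<notin> F \<longrightarrow> \<omega> e = 0) \<and>
    (\<forall>v\<in>V. \<forall>i\<le>2. (\<Sum>u\<in>V - {v}. \<omega> {u, v} * p u i) + d v * p v i = 0)"

text \<open>The pairing of a stress with the column of the radius of colour \<open>c\<close>.\<close>

definition load :: "'v set \<Rightarrow> ('v \<Rightarrow> 'c option) \<Rightarrow> ('v set \<Rightarrow> real) \<Rightarrow> ('v \<Rightarrow> real) \<Rightarrow> 'c \<Rightarrow> real" where
  "load V col \<omega> d c = (\<Sum>v\<in>{v\<in>V. col v = Some c}. d v + (\<Sum>u\<in>V - {v}. \<omega> {u, v}))"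

text \<open>\<open>K = C\<close> gives independence of the rigidity matrix, \<open>K = {}\<close>
  the planar rigidity matroid, and \<open>K = {c}\<close> tests a single load. Only
  \<open>\<omega>\<close> has to vanish, since at nonzero points the diagonal then vanishes
  too.\<close>

definition stress_free ::
  "'v set \<Rightarrow> ('v \<Rightarrow> 'c option) \<Rightarrow> 'v set set \<Rightarrow> 'c set \<Rightarrow> ('v \<Rightarrow> nat \<Rightarrow> real) \<Rightarrow> bool" where
  "stress_free V col F K p \<longleftrightarrow>
     (\<forall>\<omega> d. stress V F p \<omega> d \<longrightarrow> (\<forall>c\<in>K. load V col \<omega> d c = 0) \<longrightarrow> (\<forall>e. \<omega> e = 0))"

definition nonzero_on :: "'v set \<Rightarrow> ('v \<Rightarrow> nat \<Rightarrow> real) \<Rightarrow> bool" where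
  "nonzero_on V p \<longleftrightarrow> (\<forall>v\<in>V. \<exists>i\<le>2. p v i \<noteq> 0)"

lemma on_spheres_nonzero:
  assumes "on_spheres 2 V col r p" "\<And>v. v \<in> V \<Longrightarrow> radius col r v \<noteq> 0"
  shows "nonzero_on V p"
  unfolding nonzero_on_def
proof (rule ballI, rule ccontr)
  fix v assume v: "v \<in> V" and "\<not> (\<exists>i\<le>2. p v i \<noteq> 0)"
  then have "(\<Sum>i\<le>2. (p v i)\<^sup>2) = 0" by simp
  then show False using assms v by (simp add: on_spheres_def)
qed

lemma finite_complete_edges_subset:
  assumes "finite V" "F \<subseteq> complete_edges V"
  shows "finite F"
  using assms by (auto simp: complete_edges_def intro: finite_subset[of F "Pow V"])

lemma sum_incident_edges:
  assumes "finite V" "F \<subseteq> complete_edges V" "v \<in> V"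
  shows "(\<Sum>e\<in>{e\<in>F. v \<in> e}. f e) = (\<Sum>u\<in>V - {v}. if {u, v} \<in> F then f {u, v} else (0::'a::comm_monoid_add))"
proof -
  have "bij_betw (\<lambda>u. {u, v}) {u\<in>V - {v}. {u, v} \<in> F} {e\<in>F. v \<in> e}"
    unfolding bij_betw_def
  proof
    show "inj_on (\<lambda>u. {u, v}) {u\<in>V - {v}. {u, v} \<in> F}" by (auto simp: inj_on_def doubleton_eq_iff)
    show "(\<lambda>u. {u, v}) ` {u\<in>V - {v}. {u, v} \<in> F} = {e\<in>F. v \<in> e}"
    proof (intro equalityI subsetI)
      fix e assume e: "e \<in> {e\<in>F. v \<in> e}"
      then have "card e = 2" "e \<subseteq> V" using assms by (auto simp: complete_edges_def)
      then obtain u where "e = {u, v}" "u \<noteq> v" using e by (auto simp: card_2_iff)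
      then show "e \<in> (\<lambda>u. {u, v}) ` {u\<in>V - {v}. {u, v} \<in> F}" using e \<open>e \<subseteq> V\<close> by auto
    qed auto
  qed
  then have "(\<Sum>e\<in>{e\<in>F. v \<in> e}. f e) = (\<Sum>u\<in>{u\<in>V - {v}. {u, v} \<in> F}. f {u, v})"
    by (rule sum.reindex_bij_betw[symmetric])
  also have "\<dots> = (\<Sum>u\<in>V - {v}. if {u, v} \<in> F then f {u, v} else 0)"
    using assms by (intro sum.inter_filter) auto
  finally show ?thesis .
qed

lemma sum_edge_row:
  assumes "finite V" "F \<subseteq> complete_edges V" "v \<in> V"
  shows "(\<Sum>e\<in>F. x e * edge_row p e (v, i)) =
    (\<Sum>u\<in>V - {v}. (if {u, v} \<in> F then x {u, v} else 0) * (p v i - p u i))"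
proof -
  have "(\<Sum>e\<in>F. x e * edge_row p e (v, i)) = (\<Sum>e\<in>{e\<in>F. v \<in> e}. x e * edge_row p e (v, i))"
    using finite_complete_edges_subset[OF assms(1,2)]
    by (intro sum.mono_neutral_right) (auto simp: edge_row_def)
  also have "\<dots> = (\<Sum>u\<in>V - {v}. if {u, v} \<in> F then x {u, v} * edge_row p {u, v} (v, i) else 0)"
    using assms by (rule sum_incident_edges)
  also have "\<dots> = (\<Sum>u\<in>V - {v}. (if {u, v} \<in> F then x {u, v} else 0) * (p v i - p u i))"
    by (intro sum.cong) (auto simp: edge_row_def)
  finally show ?thesis .
qed

text \<open>Writing the coefficient of the vertex row of \<open>v\<close> as
  \<open>- d v - (\<Sum>u\<in>V - {v}. \<omega> {u, v})\<close> turns the differences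
  \<open>p v - p u\<close> into the points \<open>p u\<close>, and the columns of the radii into
  loads. Nonzero points are needed to recover the vertex coefficients from
  \<open>\<omega>\<close>.\<close>

lemma rows_independent_iff_stress_free:
  assumes fin: "finite V" and F: "F \<subseteq> complete_edges V" and nz: "nonzero_on V p"
  shows "rows_independent (F <+> V) ((V \<times> {..2}) <+> K) (rigidity_matrix col p) \<longleftrightarrow>
    stress_free V col F K p"
proof -
  have finF: "finite F" by (rule finite_complete_edges_subset[OF fin F])
  have c1: "(\<Sum>x\<in>F <+> V. y x * rigidity_matrix col p x (Inl (v, i))) =
      (\<Sum>u\<in>V - {v}. (if {u, v} \<in> F then y (Inl {u, v}) else 0) * (p v i - p u i)) + y (Inr v) * p v i"
    if "v \<in> V" for y v i
    using that fin finF sum_edge_row[OF fin F that, of "\<lambda>e. y (Inl e)" p i]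
    by (simp add: sum.Plus rigidity_matrix_def if_distrib[of "\<lambda>t. _ * t"] cong: if_cong)
  have c2: "(\<Sum>x\<in>F <+> V. y x * rigidity_matrix col p x (Inr c)) = - (\<Sum>v\<in>{v\<in>V. col v = Some c}. y (Inr v))"
    for y c
  proof -
    have "(\<Sum>x\<in>F <+> V. y x * rigidity_matrix col p x (Inr c)) = (\<Sum>v\<in>V. if col v = Some c then - y (Inr v) else 0)"
      using fin finF by (simp add: sum.Plus rigidity_matrix_def if_distrib[of "\<lambda>t. _ * t"] cong: if_cong)
    also have "\<dots> = (\<Sum>v\<in>{v\<in>V. col v = Some c}. - y (Inr v))"
      using fin by (intro sum.inter_filter[symmetric])
    finally show ?thesis by (simp add: sum_negf)
  qed
  have fin2: "finite (F <+> V)" using fin finF by simp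
  show ?thesis
    unfolding rows_independent_iff[OF fin2]
  proof
    assume R: "\<forall>x. (\<forall>j\<in>V \<times> {..2} <+> K. (\<Sum>i\<in>F <+> V. x i * rigidity_matrix col p i j) = 0) \<longrightarrow>
      (\<forall>i\<in>F <+> V. x i = 0)"
    show "stress_free V col F K p"
      unfolding stress_free_def
    proof (intro allI impI)
      fix \<omega> d e assume st: "stress V F p \<omega> d" and ld: "\<forall>c\<in>K. load V col \<omega> d c = 0"
      define y where "y = case_sum \<omega> (\<lambda>v. - d v - (\<Sum>u\<in>V - {v}. \<omega> {u, v}))"
      have "(\<Sum>i\<in>F <+> V. y i * rigidity_matrix col p i j) = 0" if j: "j \<in> V \<times> {..2} <+> K" for j
      proof (cases j)
        case (Inl w)
        then obtain v i where w: "w = (v, i)" "v \<in> V" "i \<le> 2" using j by auto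
        have "(\<Sum>i\<in>F <+> V. y i * rigidity_matrix col p i j) =
          (\<Sum>u\<in>V - {v}. \<omega> {u, v} * (p v i - p u i)) + (- d v - (\<Sum>u\<in>V - {v}. \<omega> {u, v})) * p v i"
          unfolding Inl w(1) c1[OF w(2)] using st
          by (intro arg_cong2[where f = "(+)"] sum.cong) (auto simp: y_def stress_def)
        also have "\<dots> = - ((\<Sum>u\<in>V - {v}. \<omega> {u, v} * p u i) + d v * p v i)"
          by (simp add: right_diff_distrib sum_subtractf sum_distrib_left sum_distrib_right algebra_simps)
        also have "\<dots> = 0" using st w by (simp add: stress_def)
        finally show ?thesis .
      next
        case (Inr c)
        then have "c \<in> K" using j by auto
        then have "load V col \<omega> d c = 0" using ld by blast
        then have "(\<Sum>v\<in>{v\<in>V. col v = Some c}. - (d v + (\<Sum>u\<in>V - {v}. \<omega> {u, v}))) = 0"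
          by (simp only: load_def sum_negf)
        then show ?thesis unfolding Inr c2 by (simp add: y_def)
      qed
      then have "y (Inl e) = 0" if "e \<in> F" using R that by blast
      then show "\<omega> e = 0" using st by (cases "e \<in> F") (auto simp: y_def stress_def)
    qed
  next
    assume S: "stress_free V col F K p"
    show "\<forall>x. (\<forall>j\<in>V \<times> {..2} <+> K. (\<Sum>i\<in>F <+> V. x i * rigidity_matrix col p i j) = 0) \<longrightarrow>
      (\<forall>i\<in>F <+> V. x i = 0)"
    proof (intro allI impI)
      fix y assume y: "\<forall>j\<in>V \<times> {..2} <+> K. (\<Sum>i\<in>F <+> V. y i * rigidity_matrix col p i j) = 0"
      define \<omega> where "\<omega> e = (if e \<in> F then y (Inl e) else 0)" for e
      define d where "d v = - y (Inr v) - (\<Sum>u\<in>V - {v}. \<omega> {u, v})" for v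
      have y1: "(\<Sum>u\<in>V - {v}. \<omega> {u, v} * (p v i - p u i)) + y (Inr v) * p v i = 0"
        if "v \<in> V" "i \<le> 2" for v i
        using y[rule_format, of "Inl (v, i)"] that unfolding c1[OF that(1)] by (auto simp: \<omega>_def)
      have "stress V F p \<omega> d"
        unfolding stress_def
      proof (intro conjI allI impI ballI)
        fix v i assume v: "v \<in> V" "i \<le> (2::nat)"
        have "(\<Sum>u\<in>V - {v}. \<omega> {u, v} * p u i) + d v * p v i =
          - ((\<Sum>u\<in>V - {v}. \<omega> {u, v} * (p v i - p u i)) + y (Inr v) * p v i)"
          by (simp add: d_def right_diff_distrib sum_subtractf sum_distrib_left sum_distrib_right algebra_simps)
        then show "(\<Sum>u\<in>V - {v}. \<omega> {u, v} * p u i) + d v * p v i = 0" using y1[OF v] by simp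
      qed (simp add: \<omega>_def)
      moreover have "load V col \<omega> d c = 0" if "c \<in> K" for c
        using y[rule_format, OF InrI[OF that]] unfolding c2 by (simp add: load_def d_def sum_negf)
      ultimately have \<omega>0: "\<omega> e = 0" for e using S by (auto simp: stress_free_def)
      have "y (Inr v) = 0" if "v \<in> V" for v
        using nz that y1[OF that] \<omega>0 by (auto simp: nonzero_on_def)
      moreover have "y (Inl e) = 0" if "e \<in> F" for e using \<omega>0[of e] that by (simp add: \<omega>_def)
      ultimately show "\<forall>i\<in>F <+> V. y i = 0" by auto
    qed
  qed
qed

lemma rows_independent_edge_row_iff:
  assumes fin: "finite V" and F: "F \<subseteq> complete_edges V"
  shows "rows_independent F (V \<times> {..<2}) (edge_row q) \<longleftrightarrow>
    (\<forall>\<omega>. (\<forall>e. e \<notin> F \<longrightarrow> \<omega> e = 0) \<longrightarrow>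
      (\<forall>v\<in>V. \<forall>i<2. (\<Sum>u\<in>V - {v}. \<omega> {u, v} * (q v i - q u i)) = 0) \<longrightarrow> (\<forall>e. \<omega> e = 0))"
  (is "?L \<longleftrightarrow> ?R")
proof -
  have finF: "finite F" by (rule finite_complete_edges_subset[OF fin F])
  show ?thesis
    unfolding rows_independent_iff[OF finF]
  proof
    assume L: "\<forall>x. (\<forall>j\<in>V \<times> {..<2}. (\<Sum>i\<in>F. x i * edge_row q i j) = 0) \<longrightarrow> (\<forall>i\<in>F. x i = 0)"
    show ?R
    proof (intro allI impI)
      fix \<omega> e assume \<omega>: "\<forall>e. e \<notin> F \<longrightarrow> \<omega> e = 0"
        "\<forall>v\<in>V. \<forall>i<2. (\<Sum>u\<in>V - {v}. \<omega> {u, v} * (q v i - q u i)) = 0"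
      have "(\<Sum>e\<in>F. \<omega> e * edge_row q e (v, i)) = 0" if "v \<in> V" "i < 2" for v i
      proof -
        have "(if {u, v} \<in> F then \<omega> {u, v} else 0) = \<omega> {u, v}" for u using \<omega>(1) by auto
        then show ?thesis using \<omega>(2) that by (simp add: sum_edge_row[OF fin F])
      qed
      then have "\<forall>e\<in>F. \<omega> e = 0" using L by auto
      then show "\<omega> e = 0" using \<omega>(1) by blast
    qed
  next
    assume R: ?R
    show "\<forall>x. (\<forall>j\<in>V \<times> {..<2}. (\<Sum>i\<in>F. x i * edge_row q i j) = 0) \<longrightarrow> (\<forall>i\<in>F. x i = 0)"
    proof (intro allI impI)
      fix x assume x: "\<forall>j\<in>V \<times> {..<2}. (\<Sum>i\<in>F. x i * edge_row q i j) = 0"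
      define \<omega> where "\<omega> e = (if e \<in> F then x e else 0)" for e
      have "(\<Sum>u\<in>V - {v}. \<omega> {u, v} * (q v i - q u i)) = 0" if "v \<in> V" "i < 2" for v i
        using x[rule_format, of "(v, i)"] that by (simp add: sum_edge_row[OF fin F] \<omega>_def)
      then have "\<omega> e = 0" for e using R[rule_format, of \<omega>] by (simp add: \<omega>_def)
      then show "\<forall>e\<in>F. x e = 0" unfolding \<omega>_def by metis
    qed
  qed
qed

section \<open>Polynomial matrix entries, rescaling and central projection\<close>

lemma rigidity_matrix_polynomial:
  fixes V :: "'v set" and C :: "'c set"
  obtains m where
    "\<And>x y (p :: 'v \<Rightarrow> nat \<Rightarrow> real) r. qeval (case_sum (\<lambda>(v, i). p v i) r) (m x y) = rigidity_matrix col p x y"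
    "\<And>x y. F \<subseteq> complete_edges V \<Longrightarrow> x \<in> F <+> V \<Longrightarrow> y \<in> coords d V C \<Longrightarrow> m x y \<in> qpolys (coords d V C)"
proof -
  let ?q = "\<lambda>v i. qvar (Inl (v, i)) :: (('v \<times> nat) + 'c) qpoly"
  define m :: "'v set + 'v \<Rightarrow> ('v \<times> nat) + 'c \<Rightarrow> (('v \<times> nat) + 'c) qpoly" where "m x y = (case x of
        Inl e \<Rightarrow> (case y of Inl (w, i) \<Rightarrow> if w \<in> e then (\<Sum>u\<in>e. ?q w i - ?q u i) else 0 | Inr c \<Rightarrow> 0)
      | Inr v \<Rightarrow> (case y of Inl (w, i) \<Rightarrow> (if w = v then ?q v i else 0)
                         | Inr c \<Rightarrow> (if col v = Some c then - 1 else 0)))" for x y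
  have sum: "(\<And>u. u \<in> e \<Longrightarrow> f u \<in> qpolys X) \<Longrightarrow> (\<Sum>u\<in>e. f u) \<in> qpolys X" for e and f :: "_ \<Rightarrow> _ qpoly" and X
  proof (induction e rule: infinite_finite_induct)
    case (insert u e)
    then show ?case using qpolys_diff[of "f u" X "- sum f e"] qpolys_uminus[of "sum f e" X] by simp
  qed auto
  show thesis
  proof
    show "qeval (case_sum (\<lambda>(v, i). p v i) r) (m x y) = rigidity_matrix col p x y"
      for x y r and p :: "'v \<Rightarrow> nat \<Rightarrow> real"
      by (auto simp: m_def rigidity_matrix_def edge_row_def qeval_sum qeval_diff qeval_uminus
          split: sum.splits)
    show "m x y \<in> qpolys (coords d V C)"
      if "F \<subseteq> complete_edges V" "x \<in> F <+> V" "y \<in> coords d V C" for x y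
      using that
      by (auto simp: m_def coords_def complete_edges_def qpolys_uminus intro!: sum qpolys_diff
          split: sum.splits) blast+
  qed
qed

lemma edge_row_polynomial:
  fixes V :: "'v set"
  obtains m where
    "\<And>x y (q :: 'v \<Rightarrow> nat \<Rightarrow> real). qeval (\<lambda>(v, i). q v i) (m x y) = edge_row q x y"
    "\<And>x y. F \<subseteq> complete_edges V \<Longrightarrow> x \<in> F \<Longrightarrow> y \<in> V \<times> {..<d} \<Longrightarrow> m x y \<in> qpolys (V \<times> {..<d})"
proof -
  let ?q = "\<lambda>v i. qvar (v, i) :: ('v \<times> nat) qpoly"
  define m :: "'v set \<Rightarrow> 'v \<times> nat \<Rightarrow> ('v \<times> nat) qpoly" where "m e = (\<lambda>(w, i). if w \<in> e then (\<Sum>u\<in>e. ?q w i - ?q u i) else 0)" for e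
  have sum: "(\<And>u. u \<in> e \<Longrightarrow> f u \<in> qpolys X) \<Longrightarrow> (\<Sum>u\<in>e. f u) \<in> qpolys X" for e and f :: "_ \<Rightarrow> _ qpoly" and X
  proof (induction e rule: infinite_finite_induct)
    case (insert u e)
    then show ?case using qpolys_diff[of "f u" X "- sum f e"] qpolys_uminus[of "sum f e" X] by simp
  qed auto
  show thesis
  proof
    show "qeval (\<lambda>(v, i). q v i) (m x y) = edge_row q x y" for x y and q :: "'v \<Rightarrow> nat \<Rightarrow> real"
      by (cases y) (simp add: m_def edge_row_def qeval_sum qeval_diff)
    show "m x y \<in> qpolys (V \<times> {..<d})"
      if "F \<subseteq> complete_edges V" "x \<in> F" "y \<in> V \<times> {..<d}" for x y
      using that
      by (auto simp: m_def complete_edges_def intro!: sum qpolys_diff) blast+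
  qed
qed

text \<open>Scaling the points is undone by multiplying the stress matrix on both sides by the
  inverse diagonal matrix. This covers central projection and reflections in the origin. Loads are
  not preserved in general, whence \<open>K = {}\<close> in the next lemma.\<close>

lemma stress_rescale:
  assumes "stress V F p \<omega> d" "F \<subseteq> complete_edges V" "\<And>v. v \<in> V \<Longrightarrow> s v \<noteq> 0"
  shows "stress V F (\<lambda>v i. s v * p v i) (\<lambda>e. \<omega> e / (\<Prod>w\<in>e. s w)) (\<lambda>v. d v / (s v)\<^sup>2)"
  unfolding stress_def
proof (intro conjI allI impI ballI)
  fix v i assume v: "v \<in> V" "i \<le> (2::nat)"
  have "(\<Sum>u\<in>V - {v}. \<omega> {u, v} / (\<Prod>w\<in>{u, v}. s w) * (s u * p u i)) = (\<Sum>u\<in>V - {v}. \<omega> {u, v} * p u i) / s v"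
    unfolding sum_divide_distrib using assms(3) by (intro sum.cong) auto
  then have "(\<Sum>u\<in>V - {v}. \<omega> {u, v} / (\<Prod>w\<in>{u, v}. s w) * (s u * p u i)) + d v / (s v)\<^sup>2 * (s v * p v i) =
    ((\<Sum>u\<in>V - {v}. \<omega> {u, v} * p u i) + d v * p v i) / s v"
    using assms(3)[OF v(1)] by (simp add: add_divide_distrib power2_eq_square)
  then show "(\<Sum>u\<in>V - {v}. \<omega> {u, v} / (\<Prod>w\<in>{u, v}. s w) * (s u * p u i)) + d v / (s v)\<^sup>2 * (s v * p v i) = 0"
    using assms(1) v by (simp add: stress_def)
qed (use assms(1) in \<open>simp add: stress_def\<close>)

lemma stress_free_rescale:
  assumes "stress_free V col F {} (\<lambda>v i. s v * p v i)" "finite V" "F \<subseteq> complete_edges V"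
    "\<And>v. v \<in> V \<Longrightarrow> s v \<noteq> 0"
  shows "stress_free V col F {} p"
  unfolding stress_free_def
proof (intro allI impI)
  fix \<omega> d e assume st: "stress V F p \<omega> d"
  have "\<omega> e / (\<Prod>w\<in>e. s w) = 0"
    using assms(1) stress_rescale[OF st assms(3), of s] assms(4) unfolding stress_free_def by blast
  moreover have "(\<Prod>w\<in>e. s w) \<noteq> 0" if "e \<in> F"
  proof -
    have "e \<subseteq> V" using that assms(3) by (auto simp: complete_edges_def)
    then show ?thesis using assms(2,4) finite_subset[of e V] by (auto simp: prod_zero_iff)
  qed
  ultimately show "\<omega> e = 0" using st by (cases "e \<in> F") (auto simp: stress_def)
qed

text \<open>Central projection from the sphere to the plane at height 1.\<close>

lemma stress_free_cone_iff:
  assumes fin: "finite V" and F: "F \<subseteq> complete_edges V"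
  shows "stress_free V col F {} (\<lambda>v i. if i < 2 then q v i else 1) \<longleftrightarrow>
    rows_independent F (V \<times> {..<2}) (edge_row q)"
proof -
  have *: "stress V F (\<lambda>v i. if i < 2 then q v i else 1) \<omega> d \<longleftrightarrow>
     (\<forall>e. e \<notin> F \<longrightarrow> \<omega> e = 0) \<and> (\<forall>v\<in>V. d v = - (\<Sum>u\<in>V - {v}. \<omega> {u, v})) \<and>
      (\<forall>v\<in>V. \<forall>i<2. (\<Sum>u\<in>V - {v}. \<omega> {u, v} * (q v i - q u i)) = 0)" for \<omega> d
  proof -
    have "(\<forall>i\<le>2. (\<Sum>u\<in>V - {v}. \<omega> {u, v} * (if i < 2 then q u i else 1)) + d v * (if i < 2 then q v i else 1) = 0) \<longleftrightarrow>
      d v = - (\<Sum>u\<in>V - {v}. \<omega> {u, v}) \<and> (\<forall>i<2. (\<Sum>u\<in>V - {v}. \<omega> {u, v} * (q v i - q u i)) = 0)"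
      (is "?A \<longleftrightarrow> ?B") for v
    proof -
      have "?A \<longleftrightarrow> (\<Sum>u\<in>V - {v}. \<omega> {u, v}) + d v = 0 \<and>
          (\<forall>i<2. (\<Sum>u\<in>V - {v}. \<omega> {u, v} * q u i) + d v * q v i = 0)"
        by (auto simp: le_less)
      also have "\<dots> \<longleftrightarrow> ?B"
        by (auto simp: add_eq_0_iff right_diff_distrib sum_subtractf sum_distrib_right[symmetric])
      finally show ?thesis .
    qed
    then show ?thesis unfolding stress_def by auto
  qed
  show ?thesis
    unfolding rows_independent_edge_row_iff[OF fin F] stress_free_def *
  proof safe
    fix \<omega> e
    assume S: "\<forall>\<omega> d. (\<forall>e. e \<notin> F \<longrightarrow> \<omega> e = 0) \<and> (\<forall>v\<in>V. d v = - (\<Sum>u\<in>V - {v}. \<omega> {u, v})) \<and>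
        (\<forall>v\<in>V. \<forall>i<2. (\<Sum>u\<in>V - {v}. \<omega> {u, v} * (q v i - q u i)) = 0) \<longrightarrow>
        (\<forall>c\<in>{}. load V col \<omega> d c = 0) \<longrightarrow> (\<forall>e. \<omega> e = 0)"
      and "\<forall>e. e \<notin> F \<longrightarrow> \<omega> e = 0"
        "\<forall>v\<in>V. \<forall>i<2. (\<Sum>u\<in>V - {v}. \<omega> {u, v} * (q v i - q u i)) = 0"
    then show "\<omega> e = 0"
      using S[rule_format, of \<omega> "\<lambda>v. - (\<Sum>u\<in>V - {v}. \<omega> {u, v})" e] by blast
  qed blast
qed

lemma rows_independent_singleton: "rows_independent {a} {b} (\<lambda>i j. x) \<longleftrightarrow> x \<noteq> 0"
  by (auto simp: rows_independent_iff)

lemma stress_cong: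
  assumes "\<And>v i. v \<in> V \<Longrightarrow> i \<le> 2 \<Longrightarrow> p v i = p' v i"
  shows "stress V F p \<omega> d \<longleftrightarrow> stress V F p' \<omega> d"
proof -
  have "(\<Sum>u\<in>V - {v}. \<omega> {u, v} * p u i) = (\<Sum>u\<in>V - {v}. \<omega> {u, v} * p' u i)" if "i \<le> 2" for v i
    using assms that by (intro sum.cong) auto
  then show ?thesis unfolding stress_def using assms by simp
qed

lemma generic_points_distinct:
  assumes "generic_points d V q" "u \<in> V" "v \<in> V" "u \<noteq> v" "i < d"
  shows "q u i \<noteq> q v i"
proof
  let ?f = "qvar (u, i) - qvar (v, i) :: ('a \<times> nat) qpoly"
  assume "q u i = q v i"
  then have "qeval (\<lambda>(v, i). q v i) ?f = 0" by (simp add: qeval_diff)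
  moreover have "?f \<in> qpolys (V \<times> {..<d})" using assms by (intro qpolys_diff) auto
  ultimately have "?f = 0" using assms(1) unfolding generic_points_def by blast
  then have "qeval (\<lambda>x. if x = (u, i) then 1 else 0) ?f = 0" by simp
  then show False using assms by (simp add: qeval_diff)
qed

text \<open>The rows \<open>t\<close> are the infinitesimal isometries of the plane: two
  translations and a rotation. Together with the edge rows of \<open>I\<close> they stay
  independent, in a space with two columns for each vertex of \<open>W\<close>.\<close>

lemma planar_rank_bound:
  assumes fin: "finite V" and gen: "generic_points 2 V q" and W: "W \<subseteq> V" "card W \<ge> 2"
    and I: "I \<subseteq> complete_edges W" and ind: "rows_independent I (V \<times> {..<2}) (edge_row q)"
  shows "card I + 3 \<le> 2 * card W"
proof -
  have finW: "finite W" using fin W finite_subset by blast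
  have finI: "finite I" by (rule finite_complete_edges_subset[OF finW I])
  have IV: "I \<subseteq> complete_edges V" using I W by (auto simp: complete_edges_def)
  define t where "t k = (\<lambda>(w, i :: nat). if k = (0::nat) then (if i = 0 then 1 else 0)
    else if k = 1 then (if i = 0 then 0 else 1) else (if i = 0 then - q w 1 else q w 0))" for k
  define M where "M x = (case x of Inl e \<Rightarrow> edge_row q e | Inr k \<Rightarrow> t k)" for x
  have "rows_independent (I <+> {..2}) (W \<times> {..<2}) M"
    unfolding rows_independent_iff[OF finite_Plus[OF finI finite_atMost]]
  proof (intro allI impI)
    fix y assume y: "\<forall>j\<in>W \<times> {..<2}. (\<Sum>x\<in>I <+> {..2}. y x * M x j) = 0"
    define \<tau> where "\<tau> w i = (\<Sum>k\<le>2. y (Inr k) * t k (w, i))" for w i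
    have \<tau>0: "\<tau> w 0 = y (Inr 0) - y (Inr 2) * q w 1" and \<tau>1: "\<tau> w 1 = y (Inr 1) + y (Inr 2) * q w 0" for w
      by (simp_all add: \<tau>_def t_def numeral_2_eq_2)
    define \<rho> where "\<rho> w i = (\<Sum>e\<in>I. y (Inl e) * edge_row q e (w, i))" for w i
    have \<rho>\<tau>: "\<rho> w i = - \<tau> w i" if "w \<in> W" "i < 2" for w i
    proof -
      have "(\<Sum>x\<in>I <+> {..2}. y x * M x (w, i)) = \<rho> w i + \<tau> w i"
        using finI by (simp add: sum.Plus M_def \<rho>_def \<tau>_def)
      moreover have "(\<Sum>x\<in>I <+> {..2}. y x * M x (w, i)) = 0" using y that by auto
      ultimately show ?thesis by simp
    qed
    \<comment> \<open>Edge rows annihilate the infinitesimal isometry \<open>\<tau>\<close>, which therefore has norm 0.\<close>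
    have orth: "(\<Sum>w\<in>W. \<Sum>i<2. edge_row q e (w, i) * \<tau> w i) = 0" if e: "e \<in> I" for e
    proof -
      obtain a b where ab: "e = {a, b}" "a \<noteq> b" "a \<in> W" "b \<in> W"
        using e I by (auto simp: complete_edges_def card_2_iff)
      have "(\<Sum>w\<in>W. \<Sum>i<2. edge_row q e (w, i) * \<tau> w i) = (\<Sum>w\<in>{a, b}. \<Sum>i<2. edge_row q e (w, i) * \<tau> w i)"
        using ab finW by (intro sum.mono_neutral_right) (auto simp: edge_row_def)
      also have "\<dots> = 0"
        using ab by (simp add: edge_row_def numeral_2_eq_2 \<tau>0 \<tau>1[unfolded One_nat_def] algebra_simps)
      finally show ?thesis .
    qed
    have "(\<Sum>w\<in>W. \<Sum>i<2. (\<tau> w i)\<^sup>2) = - (\<Sum>w\<in>W. \<Sum>i<2. \<rho> w i * \<tau> w i)"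
      unfolding sum_negf[symmetric] by (intro sum.cong) (auto simp: \<rho>\<tau> power2_eq_square)
    also have "(\<Sum>w\<in>W. \<Sum>i<2. \<rho> w i * \<tau> w i) =
      (\<Sum>w\<in>W. \<Sum>i<2. \<Sum>e\<in>I. y (Inl e) * (edge_row q e (w, i) * \<tau> w i))"
      by (simp add: \<rho>_def sum_distrib_right mult.assoc)
    also have "\<dots> = (\<Sum>e\<in>I. y (Inl e) * (\<Sum>w\<in>W. \<Sum>i<2. edge_row q e (w, i) * \<tau> w i))"
      by (simp add: sum_distrib_left sum.swap[of _ I] cong: sum.cong)
    also have "\<dots> = 0" using orth by (simp add: sum.neutral)
    finally have "(\<Sum>w\<in>W. \<Sum>i<2. (\<tau> w i)\<^sup>2) = 0" by simp
    then have \<tau>z: "\<tau> w i = 0" if "w \<in> W" "i < 2" for w i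
      using that finW by (auto simp: sum_nonneg_eq_0_iff sum_nonneg)
    obtain a b where ab: "a \<in> W" "b \<in> W" "a \<noteq> b"
      using W(2) by (metis card_2_iff' obtain_subset_with_card_n subset_iff)
    \<comment> \<open>Two points with different second coordinates exclude a rotation; this is where
      two vertices are needed.\<close>
    then have "q a 1 \<noteq> q b 1" using W by (intro generic_points_distinct[OF gen]) auto
    then have y2: "y (Inr 2) = 0" using \<tau>z[OF ab(1), of 0] \<tau>z[OF ab(2), of 0] by (auto simp: \<tau>0)
    have yt: "y (Inr k) = 0" if "k \<le> 2" for k
    proof -
      have "k = 0 \<or> k = 1 \<or> k = 2" using that by auto
      then show ?thesis using y2 \<tau>z[OF ab(1), of 0] \<tau>z[OF ab(1), of 1] by (auto simp: \<tau>0 \<tau>1[unfolded One_nat_def])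
    qed
    have "(\<Sum>e\<in>I. y (Inl e) * edge_row q e (v, i)) = 0" if "v \<in> V" "i < 2" for v i
    proof (cases "v \<in> W")
      case True
      then show ?thesis using \<rho>\<tau>[of v i] \<tau>z[of v i] that by (simp add: \<rho>_def)
    next
      case False
      then show ?thesis using I by (intro sum.neutral) (auto simp: edge_row_def complete_edges_def)
    qed
    then have "\<forall>e\<in>I. y (Inl e) = 0"
      using ind unfolding rows_independent_iff[OF finI] by (auto dest: spec[of _ "\<lambda>e. y (Inl e)"])
    with yt show "\<forall>x\<in>I <+> {..2}. y x = 0" by auto
  qed
  then have "card (I <+> {..2::nat}) \<le> card (W \<times> {..<2::nat})"
    using finI finW by (intro rows_independent_card_le[of _ _ M]) auto
  then show ?thesis using finI by (simp add: card_Plus card_cartesian_product)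
qed

section \<open>Generic frameworks on concentric spheres\<close>

text \<open>Countability of the vertex type serves the existence of generic planar points.\<close>

locale generic_spherical =
  fixes V :: "'v::countable set" and C :: "'c set" and col :: "'v \<Rightarrow> 'c option"
    and r :: "'c \<Rightarrow> real" and p :: "'v \<Rightarrow> nat \<Rightarrow> real"
  assumes finite_V: "finite V"
    and colours: "colouring V C col"
    and generic: "generic_framework 2 V C col r p"
begin

lemma finite_C: "finite C"
proof -
  have "finite (Some ` C)" using colours finite_V finite_subset[of "Some ` C" "col ` V"]
    by (simp add: colouring_def)
  then show ?thesis by (rule finite_imageD) simp
qed

lemma colour_in_C: "v \<in> V \<Longrightarrow> col v = Some c \<Longrightarrow> c \<in> C"
  using colours by (force simp: colouring_def)

lemma spheres: "on_spheres 2 V col r p"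
  using generic by (auto simp: generic_framework_def intro: framework_on_spheres)

lemma radius_pos: "v \<in> V \<Longrightarrow> radius col r v > 0"
  using generic colour_in_C by (auto simp: generic_framework_def framework_def radius_def split: option.splits)

lemma nonzero: "nonzero_on V p"
  using radius_pos by (intro on_spheres_nonzero[OF spheres]) fastforce

lemma generic_nonzero:
  assumes "on_spheres 2 V col r' p'" "f \<in> qpolys (coords 2 V C)"
    and "qeval (case_sum (\<lambda>(v, i). p' v i) r') f \<noteq> 0"
  shows "qeval (case_sum (\<lambda>(v, i). p v i) r) f \<noteq> 0"
  using generic_framework_rows_independent[OF generic assms(1), of "{()}" "{()}" "\<lambda>_ _. f"] assms
  by (simp add: rows_independent_singleton)

text \<open>Independence need only be exhibited at one point of the variety. In the contrapositive,
  a dependency at \<open>p\<close> survives reflections of points and the motion of a vertex on its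
  sphere.\<close>

lemma stress_free_generic:
  assumes "on_spheres 2 V col r' p'" "nonzero_on V p'" "F \<subseteq> complete_edges V" "K \<subseteq> C"
    and "stress_free V col F K p'"
  shows "stress_free V col F K p"
proof -
  obtain m where m: "\<And>x y (p :: 'v \<Rightarrow> nat \<Rightarrow> real) r. qeval (case_sum (\<lambda>(v, i). p v i) r) (m x y) = rigidity_matrix col p x y"
    "\<And>x y. x \<in> F <+> V \<Longrightarrow> y \<in> coords 2 V C \<Longrightarrow> m x y \<in> qpolys (coords 2 V C)"
    using rigidity_matrix_polynomial[of col F V 2 C] assms(3) by metis
  have "finite (F <+> V)" using finite_complete_edges_subset[OF finite_V assms(3)] finite_V by simp
  moreover have "(V \<times> {..2}) <+> K \<subseteq> coords 2 V C" using assms(4) by (auto simp: coords_def)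
  moreover have "rows_independent (F <+> V) ((V \<times> {..2}) <+> K) (\<lambda>x y. qeval (case_sum (\<lambda>(v, i). p' v i) r') (m x y))"
    unfolding m using assms(5) rows_independent_iff_stress_free[OF finite_V assms(3,2)] by blast
  ultimately have "rows_independent (F <+> V) ((V \<times> {..2}) <+> K) (\<lambda>x y. qeval (case_sum (\<lambda>(v, i). p v i) r) (m x y))"
    using m(2) by (intro generic_framework_rows_independent[OF generic assms(1)]) auto
  then show ?thesis
    unfolding m using rows_independent_iff_stress_free[OF finite_V assms(3) nonzero] by blast
qed

lemma radius_distinct:
  assumes "u \<in> V" "v \<in> V" "col u \<noteq> col v"
  shows "radius col r u \<noteq> radius col r v"
proof -
  define \<rho> :: "'v \<Rightarrow> (('v \<times> nat) + 'c) qpoly"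
    where "\<rho> w = (case col w of None \<Rightarrow> 1 | Some c \<Rightarrow> qvar (Inr c))" for w
  have \<rho>: "qeval (case_sum (\<lambda>(v, i). p v i) r) (\<rho> w) = radius col r w" for w r and p :: "'v \<Rightarrow> nat \<Rightarrow> real"
    by (auto simp: \<rho>_def radius_def split: option.splits)
  \<comment> \<open>Radius 2 for the colour of \<open>u\<close> and 3 for all others keeps
    \<open>u\<close> and \<open>v\<close> apart also if one of them is uncoloured and so has radius
    1.\<close>
  define r' :: "'c \<Rightarrow> real" where "r' c = (if Some c = col u then 2 else 3)" for c
  let ?p = "\<lambda>w i. if i = (0::nat) then radius col r' w else 0"
  have "on_spheres 2 V col r' ?p"
    by (auto simp: on_spheres_def if_distrib[of "\<lambda>x. x\<^sup>2"] cong: if_cong)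
  moreover have "\<rho> u - \<rho> v \<in> qpolys (coords 2 V C)"
    using assms colour_in_C
    by (intro qpolys_diff) (auto simp: \<rho>_def coords_def split: option.splits)
  moreover have "radius col r' u \<noteq> radius col r' v"
    using assms(3) by (cases "col u"; cases "col v") (auto simp: radius_def r'_def)
  ultimately have "qeval (case_sum (\<lambda>(v, i). p v i) r) (\<rho> u - \<rho> v) \<noteq> 0"
    by (intro generic_nonzero) (auto simp: qeval_diff \<rho>)
  then show ?thesis by (simp add: qeval_diff \<rho>)
qed

text \<open>Makes central projection to height 1 possible; the special position puts all points at
  the same pole.\<close>

lemma last_coordinate_nonzero:
  assumes "v \<in> V"
  shows "p v 2 \<noteq> 0"
proof -
  have "on_spheres 2 V col (\<lambda>_. 1) (\<lambda>w i. if i = 2 then 1 else 0)"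
    by (auto simp: on_spheres_def radius_def if_distrib[of "\<lambda>x. x\<^sup>2"] split: option.splits cong: if_cong)
  moreover have "qvar (Inl (v, 2)) \<in> qpolys (coords 2 V C)" using assms by (auto simp: coords_def)
  ultimately show ?thesis using generic_nonzero[of "\<lambda>_. 1" _ "qvar (Inl (v, 2))"] by fastforce
qed

text \<open>The points of \<open>A\<close> are specialised to distinct unit vectors of the axes.
  This independence is what determines a stress at a vertex of small degree.\<close>

lemma at_most_three_independent:
  assumes "A \<subseteq> V" "card A \<le> 3" "\<And>i. i \<le> 2 \<Longrightarrow> (\<Sum>u\<in>A. c u * p u i) = 0" "u \<in> A"
  shows "c u = 0"
proof -
  have finA: "finite A" using assms(1) finite_V by (rule finite_subset)
  obtain h :: "'v \<Rightarrow> nat" where h: "h ` A \<subseteq> {..2}" "inj_on h A"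
    using card_le_inj[OF finA finite_atMost, of 2] assms(2) by auto
  \<comment> \<open>\<open>min 2\<close> keeps the vertices outside \<open>A\<close>, where
    \<open>h\<close> is arbitrary, on the unit sphere.\<close>
  let ?p = "\<lambda>u i. if i = min 2 (h u) then 1 else 0 :: real"
  have "on_spheres 2 V col (\<lambda>_. 1) ?p"
    by (auto simp: on_spheres_def radius_def if_distrib[of "\<lambda>x. x\<^sup>2"] split: option.splits cong: if_cong)
  moreover have "rows_independent A {..2} ?p"
    unfolding rows_independent_iff[OF finA]
  proof (intro allI impI ballI)
    fix x v assume x: "\<forall>j\<in>{..2}. (\<Sum>i\<in>A. x i * ?p i j) = 0" and v: "v \<in> A"
    have mh: "min 2 (h w) = h w" if "w \<in> A" for w using that h by auto
    have "(\<Sum>i\<in>A. x i * ?p i (h v)) = (\<Sum>i\<in>A. if i = v then x i else 0)"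
      using h v mh by (intro sum.cong) (auto simp: inj_on_def)
    also have "\<dots> = x v" using finA v by simp
    finally show "x v = 0" using x h v by auto
  qed
  ultimately have "rows_independent A {..2} p"
    using generic_framework_rows_independent[OF generic, of "\<lambda>_. 1" ?p A "{..2}" "\<lambda>u i. qvar (Inl (u, i))"]
      finA assms(1) by (auto simp: coords_def)
  then show ?thesis using assms(3,4) unfolding rows_independent_iff[OF finA] by auto
qed

text \<open>Both directions specialise after a central projection: a planar realisation is lifted to
  height 1 and scaled to the given radii, and conversely the points on the spheres are divided by
  their last coordinates. Without load conditions, stresses thus see only the planar
  matroid.\<close>

lemma generic_rigidity_indep_iff:
  assumes F: "F \<subseteq> complete_edges V"
  shows "generic_rigidity_indep 2 V F \<longleftrightarrow> stress_free V col F {} p"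
proof
  assume "generic_rigidity_indep 2 V F"
  then obtain q where "rows_independent F (V \<times> {..<2}) (edge_row q)"
    by (auto simp: generic_rigidity_indep_def)
  then have sf: "stress_free V col F {} (\<lambda>v i. if i < 2 then q v i else 1)"
    using stress_free_cone_iff[OF finite_V F] by blast
  define s where "s v = radius col r v / sqrt ((q v 0)\<^sup>2 + (q v 1)\<^sup>2 + 1)" for v
  have s: "s v \<noteq> 0" if "v \<in> V" for v
  proof -
    have "(q v 0)\<^sup>2 + (q v 1)\<^sup>2 + 1 > 0" by (smt (verit) zero_le_power2)
    then show ?thesis using radius_pos[OF that] by (simp add: s_def)
  qed
  let ?p = "\<lambda>v i. s v * (if i < 2 then q v i else 1)"
  have "on_spheres 2 V col r ?p"
    unfolding on_spheres_def
  proof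
    fix v assume "v \<in> V"
    have pos: "(q v 0)\<^sup>2 + (q v 1)\<^sup>2 + 1 > 0" by (smt (verit) zero_le_power2)
    have "(\<Sum>i\<le>2. (?p v i)\<^sup>2) = (s v)\<^sup>2 * ((q v 0)\<^sup>2 + (q v 1)\<^sup>2 + 1)"
      by (simp add: numeral_2_eq_2 power_mult_distrib algebra_simps)
    also have "\<dots> = (radius col r v)\<^sup>2" using pos by (simp add: s_def power_divide)
    finally show "(\<Sum>i\<le>2. (?p v i)\<^sup>2) = (radius col r v)\<^sup>2" .
  qed
  moreover have "stress_free V col F {} ?p"
  proof (rule stress_free_rescale[OF _ finite_V F])
    show "1 / s v \<noteq> 0" if "v \<in> V" for v using s that by simp
    show "stress_free V col F {} (\<lambda>v i. 1 / s v * (s v * (if i < 2 then q v i else 1)))"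
      using sf s stress_cong[of V "\<lambda>v i. 1 / s v * (s v * (if i < 2 then q v i else 1))"
        "\<lambda>v i. if i < 2 then q v i else 1" F]
      by (simp add: stress_free_def)
  qed
  moreover have "nonzero_on V ?p"
    using s by (auto simp: nonzero_on_def intro!: exI[of _ 2])
  ultimately show "stress_free V col F {} p" by (intro stress_free_generic[OF _ _ F]) auto
next
  assume sf: "stress_free V col F {} p"
  define q where "q v i = p v i / p v 2" for v i
  have "stress_free V col F {} (\<lambda>v i. if i < 2 then q v i else 1)"
  proof (rule stress_free_rescale[OF _ finite_V F])
    have "p v 2 * (if i < 2 then q v i else 1) = p v i" if "v \<in> V" "i \<le> 2" for v i
      using last_coordinate_nonzero[OF that(1)] that(2) by (auto simp: q_def le_less)
    then have "stress V F (\<lambda>v i. p v 2 * (if i < 2 then q v i else 1)) \<omega> d \<longleftrightarrow> stress V F p \<omega> d" for \<omega> d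
      by (rule stress_cong)
    then show "stress_free V col F {} (\<lambda>v i. p v 2 * (if i < 2 then q v i else 1))"
      using sf by (simp add: stress_free_def)
  qed (rule last_coordinate_nonzero)
  then have ri: "rows_independent F (V \<times> {..<2}) (edge_row q)"
    using stress_free_cone_iff[OF finite_V F] by blast
  obtain m where m: "\<And>x y (q :: 'v \<Rightarrow> nat \<Rightarrow> real). qeval (\<lambda>(v, i). q v i) (m x y) = edge_row q x y"
    "\<And>x y. x \<in> F \<Longrightarrow> y \<in> V \<times> {..<2} \<Longrightarrow> m x y \<in> qpolys (V \<times> {..<2})"
    using edge_row_polynomial[of F V 2] F by metis
  obtain q' where q': "generic_points 2 V q'" using generic_points_exist finite_V by blast
  have "rows_independent F (V \<times> {..<2}) (\<lambda>i j. qeval (\<lambda>(v, i). q' v i) (m i j))"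
    using ri m(2)
    by (intro generic_points_rows_independent[OF q' finite_complete_edges_subset[OF finite_V F],
          where a = "\<lambda>(v, i). q v i"]) (auto simp: m(1))
  then show "generic_rigidity_indep 2 V F"
    using q' F by (auto simp: generic_rigidity_indep_def m(1))
qed

lemma stress_free_card_le:
  assumes "W \<subseteq> V" "card W \<ge> 2" "F \<subseteq> complete_edges W" "stress_free V col F {} p"
  shows "card F + 3 \<le> 2 * card W"
proof -
  have "F \<subseteq> complete_edges V" using assms by (auto simp: complete_edges_def)
  then have "generic_rigidity_indep 2 V F" using assms generic_rigidity_indep_iff by blast
  then show ?thesis
    using planar_rank_bound[OF finite_V _ assms(1-3)] by (auto simp: generic_rigidity_indep_def)
qed

end

section \<open>Linear combinations of stresses, and rank one stresses\<close>

lemma stress_combine: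
  assumes "stress V F p \<omega> d" "stress V F p \<omega>' d'"
  shows "stress V F p (\<lambda>e. a * \<omega> e + b * \<omega>' e) (\<lambda>v. a * d v + b * d' v)"
  unfolding stress_def
proof (intro conjI allI impI ballI)
  fix v i assume v: "v \<in> V" "i \<le> (2::nat)"
  have "(\<Sum>u\<in>V - {v}. (a * \<omega> {u, v} + b * \<omega>' {u, v}) * p u i) + (a * d v + b * d' v) * p v i =
    a * ((\<Sum>u\<in>V - {v}. \<omega> {u, v} * p u i) + d v * p v i) + b * ((\<Sum>u\<in>V - {v}. \<omega>' {u, v} * p u i) + d' v * p v i)"
    by (simp add: distrib_left distrib_right sum.distrib sum_distrib_left mult.assoc)
  then show "(\<Sum>u\<in>V - {v}. (a * \<omega> {u, v} + b * \<omega>' {u, v}) * p u i) + (a * d v + b * d' v) * p v i = 0"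
    using assms v by (simp add: stress_def)
qed (use assms in \<open>simp add: stress_def\<close>)

lemma load_combine:
  "load V col (\<lambda>e. a * \<omega> e + b * \<omega>' e) (\<lambda>v. a * d v + b * d' v) c =
    a * load V col \<omega> d c + b * load V col \<omega>' d' c"
  by (simp add: load_def sum.distrib sum_distrib_left distrib_left)

lemma stress_zero: "stress V F p (\<lambda>_. 0) (\<lambda>_. 0)"
  by (simp add: stress_def)

lemma stress_sum:
  assumes "\<And>i. i \<in> I \<Longrightarrow> stress V F p (\<omega> i) (d i)"
  shows "stress V F p (\<lambda>e. \<Sum>i\<in>I. x i * \<omega> i e) (\<lambda>v. \<Sum>i\<in>I. x i * d i v)"
  using assms
proof (induction I rule: infinite_finite_induct)
  case (insert i I)
  then show ?case using stress_combine[of V F p "\<omega> i" "d i" "\<lambda>e. \<Sum>i\<in>I. x i * \<omega> i e" "\<lambda>v. \<Sum>i\<in>I. x i * d i v" "x i" 1]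
    by simp
qed (simp_all add: stress_zero)

lemma load_sum:
  "load V col (\<lambda>e. \<Sum>i\<in>I. x i * \<omega> i e) (\<lambda>v. \<Sum>i\<in>I. x i * d i v) c = (\<Sum>i\<in>I. x i * load V col (\<omega> i) (d i) c)"
proof (induction I rule: infinite_finite_induct)
  case (insert i I)
  then show ?case
    using load_combine[of V col "x i" "\<omega> i" 1 "\<lambda>e. \<Sum>i\<in>I. x i * \<omega> i e" "d i" "\<lambda>v. \<Sum>i\<in>I. x i * d i v" c] by simp
qed (simp_all add: load_def)

lemma stress_restrict:
  assumes "stress V F p \<omega> d" "\<And>e. e \<in> F \<Longrightarrow> e \<notin> F' \<Longrightarrow> \<omega> e = 0"
  shows "stress V F' p \<omega> d"
  using assms unfolding stress_def by blast

lemma stress_mono: "stress V F p \<omega> d \<Longrightarrow> F \<subseteq> F' \<Longrightarrow> stress V F' p \<omega> d"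
  unfolding stress_def by blast

lemma stress_support: "stress V F p \<omega> d \<Longrightarrow> \<omega> e \<noteq> 0 \<Longrightarrow> e \<in> F"
  unfolding stress_def by blast

lemma stress_equilibrium:
  "stress V F p \<omega> d \<Longrightarrow> v \<in> V \<Longrightarrow> i \<le> 2 \<Longrightarrow> (\<Sum>u\<in>V - {v}. \<omega> {u, v} * p u i) + d v * p v i = 0"
  unfolding stress_def by blast

lemma stress_free_mono: "stress_free V col F K p \<Longrightarrow> F' \<subseteq> F \<Longrightarrow> stress_free V col F' K p"
  unfolding stress_free_def using stress_mono by blast

lemma stress_freeD:
  "stress_free V col F K p \<Longrightarrow> stress V F p \<omega> d \<Longrightarrow> (\<And>c. c \<in> K \<Longrightarrow> load V col \<omega> d c = 0) \<Longrightarrow> \<omega> e = 0"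
  unfolding stress_free_def by blast

lemma stress_diagonal_zero:
  assumes "nonzero_on V p" "stress V F p \<omega> d" "v \<in> V" "\<And>u. u \<in> V - {v} \<Longrightarrow> \<omega> {u, v} = 0"
  shows "d v = 0"
proof -
  obtain i where i: "i \<le> 2" "p v i \<noteq> 0" using assms by (auto simp: nonzero_on_def)
  have "(\<Sum>u\<in>V - {v}. \<omega> {u, v} * p u i) + d v * p v i = 0"
    using assms i by (intro stress_equilibrium)
  moreover have "(\<Sum>u\<in>V - {v}. \<omega> {u, v} * p u i) = 0" using assms(4) by (simp add: sum.neutral)
  ultimately show ?thesis using i by simp
qed

lemma load_zero:
  assumes "nonzero_on V p" "stress V F p \<omega> d" "\<And>e v. \<omega> e \<noteq> 0 \<Longrightarrow> v \<in> e \<Longrightarrow> col v \<noteq> Some c"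
  shows "load V col \<omega> d c = 0"
proof -
  have "\<omega> {u, v} = 0" if "col v = Some c" for u v using assms(3)[of "{u, v}" v] that by auto
  then show ?thesis using stress_diagonal_zero[OF assms(1,2)] by (simp add: load_def sum.neutral)
qed

text \<open>The hypothesis embeds the stresses of \<open>E\<close> into the plane by their values on \<open>f\<close> and \<open>g\<close>.\<close>

lemma two_stresses_span:
  assumes "stress_free V col (E - {f, g}) {} p"
    and "stress V E p \<omega>1 d1" "\<omega>1 a \<noteq> 0" "stress V E p \<omega>2 d2" "\<omega>2 a = 0" "\<omega>2 b \<noteq> 0"
    and "stress V E p \<omega>3 d3" "\<omega>3 a = 0" "\<omega>3 b = 0"
  shows "\<omega>3 e = 0"
proof (rule ccontr)
  assume e: "\<omega>3 e \<noteq> 0"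
  let ?\<omega> = "\<lambda>i::nat. if i = 0 then \<omega>1 else if i = 1 then \<omega>2 else \<omega>3"
  let ?d = "\<lambda>i::nat. if i = 0 then d1 else if i = 1 then d2 else d3"
  \<comment> \<open>Some combination of the three stresses vanishes at \<open>f\<close> and
    \<open>g\<close> and is therefore zero; its values at \<open>a\<close>, \<open>b\<close> and
    \<open>e\<close> kill the coefficients in turn.\<close>
  have "card {f, g} \<le> 2" by (simp add: card_insert_if)
  then obtain x where x: "\<And>j. j \<in> {f, g} \<Longrightarrow> (\<Sum>i\<in>{..<3}. x i * ?\<omega> i j) = 0" "\<exists>i\<in>{..<3}. x i \<noteq> 0"
    using homogeneous_nontrivial[of "{..<3::nat}" "{f, g}" ?\<omega>] by auto
  have "stress V E p (\<lambda>e. \<Sum>i\<in>{..<3}. x i * ?\<omega> i e) (\<lambda>v. \<Sum>i\<in>{..<3}. x i * ?d i v)"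
    using assms by (intro stress_sum) auto
  then have "stress V (E - {f, g}) p (\<lambda>e. \<Sum>i\<in>{..<3}. x i * ?\<omega> i e) (\<lambda>v. \<Sum>i\<in>{..<3}. x i * ?d i v)"
  proof (rule stress_restrict)
    fix e assume "e \<in> E" "e \<notin> E - {f, g}"
    then have "e \<in> {f, g}" by blast
    then show "(\<Sum>i\<in>{..<3}. x i * ?\<omega> i e) = 0" by (rule x(1))
  qed
  then have "(\<Sum>i\<in>{..<3}. x i * ?\<omega> i e) = 0" for e using stress_freeD[OF assms(1)] by blast
  then have z: "x 0 * \<omega>1 e + x 1 * \<omega>2 e + x 2 * \<omega>3 e = 0" for e
    by (simp add: eval_nat_numeral)
  have x0: "x 0 = 0" using z[of a] assms(3,5,8) by simp
  have x1: "x 1 = 0" using z[of b] assms(6,9) x0 by simp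
  have x2: "x 2 = 0" using z[of e] e x0 x1 by simp
  obtain i where i: "i < 3" "x i \<noteq> 0" using x(2) by blast
  then have "i = 0 \<or> i = 1 \<or> i = 2" by linarith
  with i x0 x1 x2 show False by metis
qed

text \<open>The diagonal entries \<open>(\<mu> v)\<^sup>2\<close> of this rank one matrix are supplied separately.\<close>

definition rank1 :: "'v set \<Rightarrow> ('v \<Rightarrow> real) \<Rightarrow> 'v set \<Rightarrow> real" where
  "rank1 V \<mu> e = (if e \<in> complete_edges V then \<Prod>w\<in>e. \<mu> w else 0)"

lemma rank1_pair: "u \<in> V \<Longrightarrow> v \<in> V \<Longrightarrow> u \<noteq> v \<Longrightarrow> rank1 V \<mu> {u, v} = \<mu> u * \<mu> v"
  by (simp add: rank1_def complete_edges_def)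

text \<open>The matrix with entries \<open>\<mu> u * \<mu> v\<close> annihilates the points because
  \<open>\<mu>\<close> does, so every linear relation of the points yields a stress of the complete
  graph.\<close>

lemma rank1_stress:
  assumes "finite V" "\<And>i. i \<le> 2 \<Longrightarrow> (\<Sum>v\<in>V. \<mu> v * p v i) = 0"
  shows "stress V (complete_edges V) p (rank1 V \<mu>) (\<lambda>v. (\<mu> v)\<^sup>2)"
  unfolding stress_def
proof (intro conjI allI impI ballI)
  fix v i assume v: "v \<in> V" "i \<le> (2::nat)"
  have "(\<Sum>u\<in>V - {v}. rank1 V \<mu> {u, v} * p u i) = \<mu> v * (\<Sum>u\<in>V - {v}. \<mu> u * p u i)"
    unfolding sum_distrib_left using v by (intro sum.cong) (auto simp: rank1_pair)
  moreover have "(\<Sum>u\<in>V - {v}. \<mu> u * p u i) = - (\<mu> v * p v i)"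
    using assms(2)[OF v(2)] sum.remove[OF assms(1) v(1), of "\<lambda>u. \<mu> u * p u i"] by simp
  ultimately show "(\<Sum>u\<in>V - {v}. rank1 V \<mu> {u, v} * p u i) + (\<mu> v)\<^sup>2 * p v i = 0"
    by (simp add: power2_eq_square)
qed (simp add: rank1_def)

text \<open>Row \<open>v\<close> of the rank one matrix sums to \<open>\<mu> v\<close> times the
  total of \<open>\<mu>\<close>.\<close>

lemma rank1_load:
  assumes "finite V"
  shows "load V col (rank1 V \<mu>) (\<lambda>v. (\<mu> v)\<^sup>2) c = (\<Sum>v\<in>{v\<in>V. col v = Some c}. \<mu> v) * (\<Sum>v\<in>V. \<mu> v)"
  unfolding load_def sum_distrib_right
proof (intro sum.cong refl)
  fix v assume "v \<in> {v \<in> V. col v = Some c}"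
  then have v: "v \<in> V" by simp
  have "(\<Sum>u\<in>V - {v}. rank1 V \<mu> {u, v}) = \<mu> v * (\<Sum>u\<in>V - {v}. \<mu> u)"
    unfolding sum_distrib_left using v by (intro sum.cong) (auto simp: rank1_pair)
  moreover have "(\<Sum>u\<in>V. \<mu> u) = \<mu> v + (\<Sum>u\<in>V - {v}. \<mu> u)"
    using sum.remove[OF assms v, of \<mu>] by simp
  ultimately show "(\<mu> v)\<^sup>2 + (\<Sum>u\<in>V - {v}. rank1 V \<mu> {u, v}) = \<mu> v * (\<Sum>v\<in>V. \<mu> v)"
    by (simp add: power2_eq_square distrib_left)
qed

section \<open>Loads under reflections, and relocation of a vertex\<close>

context generic_spherical
begin

lemma stress_proportional:
  assumes dim: "\<forall>\<omega> d. stress V F p \<omega> d \<longrightarrow> \<omega> e0 = 0 \<longrightarrow> (\<forall>e. \<omega> e = 0)"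
    and "stress V F p \<omega> d" "stress V F p \<omega>' d'" "\<omega> e0 \<noteq> 0"
  obtains t where "\<And>e. \<omega>' e = t * \<omega> e" "\<And>v. v \<in> V \<Longrightarrow> d' v = t * d v"
proof -
  define t where "t = \<omega>' e0 / \<omega> e0"
  have st: "stress V F p (\<lambda>e. 1 * \<omega>' e + (- t) * \<omega> e) (\<lambda>v. 1 * d' v + (- t) * d v)"
    by (rule stress_combine[OF assms(3,2)])
  have "1 * \<omega>' e0 + (- t) * \<omega> e0 = 0" using assms(4) by (simp add: t_def)
  then have z: "1 * \<omega>' e + (- t) * \<omega> e = 0" for e using dim st by blast
  show thesis
  proof
    show "\<omega>' e = t * \<omega> e" for e using z[of e] by simp
    show "d' v = t * d v" if "v \<in> V" for v
    proof -
      have "1 * d' v + (- t) * d v = 0" by (rule stress_diagonal_zero[OF nonzero st that z])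
      then show ?thesis by simp
    qed
  qed
qed

text \<open>If the load vanished, genericity would make it vanish for all reflections of the points
  \<open>p u\<close> in the origin. The alternating sum over reflections of the ends of \<open>e\<close> isolates the
  contribution of \<open>e\<close>.\<close>

lemma load_nonzero:
  assumes F: "F \<subseteq> complete_edges V"
    and dim: "\<forall>\<omega> d. stress V F p \<omega> d \<longrightarrow> \<omega> e0 = 0 \<longrightarrow> (\<forall>e. \<omega> e = 0)"
    and st: "stress V F p \<omega> d" and e: "\<omega> e \<noteq> 0" "w \<in> e" "col w = Some c"
  shows "load V col \<omega> d c \<noteq> 0"
proof
  assume ld: "load V col \<omega> d c = 0"
  define s where "s X v = (if v \<in> X then - 1 else 1 :: real)" for X and v :: 'v
  have s2: "s X v * s X v = 1" "(s X v)\<^sup>2 = 1" "s X v \<noteq> 0" for X v by (auto simp: s_def)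
  have eF: "e \<in> F" using stress_support[OF st e(1)] .
  then have "card e = 2" "e \<subseteq> V" using F by (auto simp: complete_edges_def)
  then obtain u where u: "e = {u, w}" "u \<noteq> w" "u \<in> V" "w \<in> V" using e(2) by (auto simp: card_2_iff)
  have "c \<in> C" using e(3) u colour_in_C by blast
  have "\<omega> e0 \<noteq> 0" using dim st e(1) by blast
  \<comment> \<open>The reflected framework has a nonzero stress without load on \<open>c\<close>.
    Pulled back to \<open>p\<close> it is a multiple of \<open>\<omega>\<close>, so the load
    vanishes for the signed copy of \<open>\<omega>\<close>; the diagonal stays the same because
    signs square to 1.\<close>
  have L: "load V col (\<lambda>e. \<omega> e * (\<Prod>w\<in>e. s X w)) d c = 0" for X
  proof -
    let ?p = "\<lambda>v i. s X v * p v i"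
    have "on_spheres 2 V col r ?p" using spheres by (simp add: on_spheres_def power_mult_distrib s2)
    moreover have "nonzero_on V ?p" using nonzero by (simp add: nonzero_on_def s2)
    moreover have "\<not> stress_free V col F {c} p"
      using st ld e(1) by (auto simp: stress_free_def)
    ultimately have "\<not> stress_free V col F {c} ?p"
      using stress_free_generic[of r ?p F "{c}"] F \<open>c \<in> C\<close> by auto
    then obtain \<omega>' d' e' where st': "stress V F ?p \<omega>' d'" and ld': "load V col \<omega>' d' c = 0" and "\<omega>' e' \<noteq> 0"
      by (auto simp: stress_free_def)
    have "stress V F (\<lambda>v i. s X v * (s X v * p v i)) (\<lambda>e. \<omega>' e / (\<Prod>w\<in>e. s X w)) (\<lambda>v. d' v / (s X v)\<^sup>2)"
      by (rule stress_rescale[OF st' F]) (simp add: s2)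
    then have st'': "stress V F p (\<lambda>e. \<omega>' e / (\<Prod>w\<in>e. s X w)) d'"
      by (simp add: mult.assoc[symmetric] s2)
    obtain t where t: "\<And>e. \<omega>' e / (\<Prod>w\<in>e. s X w) = t * \<omega> e" "\<And>v. v \<in> V \<Longrightarrow> d' v = t * d v"
      using stress_proportional[OF dim st st'' \<open>\<omega> e0 \<noteq> 0\<close>] by blast
    have nz: "(\<Prod>w\<in>e. s X w) \<noteq> 0" for e by (induction e rule: infinite_finite_induct) (auto simp: s2)
    then have t': "\<omega>' e = t * (\<omega> e * (\<Prod>w\<in>e. s X w))" for e using t(1)[of e] by (simp add: field_simps)
    with \<open>\<omega>' e' \<noteq> 0\<close> have "t \<noteq> 0" by auto
    have "load V col \<omega>' d' c = t * load V col (\<lambda>e. \<omega> e * (\<Prod>w\<in>e. s X w)) d c"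
      by (simp add: load_def t' t(2) sum_distrib_left distrib_left)
    with ld' \<open>t \<noteq> 0\<close> show ?thesis by simp
  qed
  define h where "h e' = \<omega> e' * (\<Prod>x\<in>e'. s {} x) - \<omega> e' * (\<Prod>x\<in>e'. s {w} x) - \<omega> e' * (\<Prod>x\<in>e'. s {u} x)
    + \<omega> e' * (\<Prod>x\<in>e'. s {u, w} x)" for e'
  have h: "h {a, b} = (if {a, b} = e then 4 * \<omega> e else 0)" if ab: "a \<noteq> b" for a b
  proof -
    have pr: "(\<Prod>x\<in>{a, b}. s X x) = s X a * s X b" for X using that by simp
    have hab: "h {a, b} = \<omega> {a, b} * (s {} a * s {} b - s {w} a * s {w} b - s {u} a * s {u} b + s {u, w} a * s {u, w} b)"
      unfolding h_def pr by (simp add: algebra_simps)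
    consider "a \<notin> {u, w}" | "b \<notin> {u, w}" | "a = u" "b = w" | "a = w" "b = u" using ab by blast
    then show ?thesis
    proof cases
      case 1
      then have "{a, b} \<noteq> e" using u(1) by blast
      with 1 show ?thesis unfolding hab using u(2) by (simp add: s_def)
    next
      case 2
      then have "{a, b} \<noteq> e" using u(1) by blast
      with 2 show ?thesis unfolding hab using u(2) by (simp add: s_def)
    next
      case 3
      then show ?thesis unfolding hab using u(1,2) by (simp add: s_def)
    next
      case 4
      then have "{a, b} = e" using u(1) by blast
      with 4 show ?thesis unfolding hab using u(2) by (simp add: s_def)
    qed
  qed
  let ?Vc = "{v\<in>V. col v = Some c}"
  \<comment> \<open>The diagonal entries cancel, as the signs 1, -1, -1, 1 add up to 0.\<close>
  have "0 = (\<Sum>v\<in>?Vc. \<Sum>a\<in>V - {v}. h {a, v})"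
    using L[of "{}"] L[of "{w}"] L[of "{u}"] L[of "{u, w}"]
    by (simp add: load_def h_def sum.distrib sum_subtractf)
  also have "\<dots> = (\<Sum>v\<in>?Vc. if v \<in> e then 4 * \<omega> e else 0)"
  proof (intro sum.cong refl)
    fix v assume v: "v \<in> ?Vc"
    have "(\<Sum>a\<in>V - {v}. h {a, v}) = (\<Sum>a\<in>V - {v}. if {a, v} = e then 4 * \<omega> e else 0)"
      by (intro sum.cong) (auto simp: h)
    also have "\<dots> = (if v \<in> e then 4 * \<omega> e else 0)"
    proof (cases "v \<in> e")
      case True
      then obtain b where b: "e = {b, v}" "b \<noteq> v" "b \<in> V" using u by (auto simp: insert_commute)
      then have "(\<Sum>a\<in>V - {v}. if {a, v} = e then 4 * \<omega> e else 0) = (\<Sum>a\<in>V - {v}. if a = b then 4 * \<omega> e else 0)"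
        by (intro sum.cong) (auto simp: doubleton_eq_iff)
      then show ?thesis using True b finite_V by simp
    next
      case False
      then have "{a, v} \<noteq> e" for a by blast
      then show ?thesis using False by simp
    qed
    finally show "(\<Sum>a\<in>V - {v}. h {a, v}) = (if v \<in> e then 4 * \<omega> e else 0)" .
  qed
  also have "\<dots> = (\<Sum>v\<in>{v\<in>?Vc. v \<in> e}. 4 * \<omega> e)"
    using finite_V by (intro sum.inter_filter[symmetric]) auto
  \<comment> \<open>Every end of \<open>e\<close> of colour \<open>c\<close> contributes the same
    amount \<open>4 * \<omega> e\<close>, so two such ends do not cancel.\<close>
  finally have "of_nat (card {v\<in>?Vc. v \<in> e}) * (4 * \<omega> e) = 0" by simp
  then have "card {v\<in>?Vc. v \<in> e} = 0" using e(1) by simp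
  moreover have "w \<in> {v\<in>?Vc. v \<in> e}" using e u by simp
  ultimately show False using finite_V by auto
qed

text \<open>By genericity, a dependency survives when \<open>v\<close> is moved to any other point of its sphere.
  Subtracting a rank one stress then frees \<open>v\<close> from all stressed edges.\<close>

lemma relocate_vertex:
  assumes E: "E \<subseteq> complete_edges V" and v: "v \<in> V" and N: "N = {u\<in>V - {v}. {u, v} \<in> E}" "card N \<le> 3"
    and dep: "\<not> stress_free V col E C p" and free: "stress_free V col {e\<in>E. v \<notin> e} C p"
    and P: "(\<Sum>i\<le>2. (\<Sum>u\<in>N. a u * p u i)\<^sup>2) = (radius col r v)\<^sup>2"
    and \<mu>: "\<mu> = (\<lambda>u. if u = v then - 1 else if u \<in> N then a u else 0)"
  obtains \<omega> d \<kappa> where "\<kappa> \<noteq> 0" "stress V (complete_edges V) p \<omega> d" "\<And>e. v \<in> e \<Longrightarrow> \<omega> e = 0"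
    "\<And>e. v \<notin> e \<Longrightarrow> e \<notin> E \<Longrightarrow> \<omega> e = - \<kappa> * rank1 V \<mu> e"
    "\<And>c. c \<in> C \<Longrightarrow> load V col \<omega> d c = - \<kappa> * ((\<Sum>u\<in>{u\<in>V. col u = Some c}. \<mu> u) * (\<Sum>u\<in>V. \<mu> u))"
proof -
  have NV: "N \<subseteq> V" "v \<notin> N" "finite N" using N finite_V by auto
  define q where "q = p(v := (\<lambda>i. \<Sum>u\<in>N. a u * p u i))"
  have qv: "q v i = (\<Sum>u\<in>N. a u * p u i)" and qu: "u \<noteq> v \<Longrightarrow> q u = p u" for u i
    by (auto simp: q_def)
  have "on_spheres 2 V col r q"
    unfolding on_spheres_def
  proof
    fix u assume "u \<in> V"
    then show "(\<Sum>i\<le>2. (q u i)\<^sup>2) = (radius col r u)\<^sup>2"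
      using spheres P by (cases "u = v") (auto simp: qv qu on_spheres_def)
  qed
  moreover from this have nzq: "nonzero_on V q" using radius_pos by (intro on_spheres_nonzero) fastforce+
  ultimately have "\<not> stress_free V col E C q" using dep stress_free_generic E by blast
  then obtain \<omega>0 d0 e0 where st0: "stress V E q \<omega>0 d0" and ld0: "\<And>c. c \<in> C \<Longrightarrow> load V col \<omega>0 d0 c = 0"
    and e0: "\<omega>0 e0 \<noteq> 0" by (auto simp: stress_free_def)
  \<comment> \<open>Equilibrium at the moved vertex is a linear relation among the at most three
    points of \<open>N\<close>, which forces the stress on the edges at \<open>v\<close>.\<close>
  define \<kappa> where "\<kappa> = d0 v"
  have "(\<Sum>u\<in>N. (\<omega>0 {u, v} + \<kappa> * a u) * p u i) = 0" if "i \<le> 2" for i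
  proof -
    have "(\<Sum>u\<in>V - {v}. \<omega>0 {u, v} * q u i) = (\<Sum>u\<in>N. \<omega>0 {u, v} * p u i)"
      using st0 finite_V N by (intro sum.mono_neutral_cong_right) (auto simp: qu stress_def)
    then have "(\<Sum>u\<in>N. \<omega>0 {u, v} * p u i) + \<kappa> * (\<Sum>u\<in>N. a u * p u i) = 0"
      using stress_equilibrium[OF st0 v that] by (simp add: \<kappa>_def qv)
    then show ?thesis by (simp add: distrib_right sum.distrib sum_distrib_left mult.assoc)
  qed
  then have \<omega>0v: "\<omega>0 {u, v} = - \<kappa> * a u" if "u \<in> N" for u
    using at_most_three_independent[OF NV(1) N(2) _ that, of "\<lambda>u. \<omega>0 {u, v} + \<kappa> * a u"] by simp
  \<comment> \<open>Since \<open>\<mu> v = - 1\<close>, the rank one stress is \<open>- a u\<close>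
    on \<open>{u, v}\<close> and its diagonal entry at \<open>v\<close> is 1; subtracting
    \<open>\<kappa>\<close> times it clears both.\<close>
  define \<omega> where "\<omega> = (\<lambda>e. 1 * \<omega>0 e + (- \<kappa>) * rank1 V \<mu> e)"
  define d where "d = (\<lambda>u. 1 * d0 u + (- \<kappa>) * (\<mu> u)\<^sup>2)"
  have "(\<Sum>u\<in>V. \<mu> u * q u i) = 0" for i
  proof -
    have "(\<Sum>u\<in>V. \<mu> u * q u i) = - q v i + (\<Sum>u\<in>V - {v}. \<mu> u * q u i)"
      using sum.remove[OF finite_V v, of "\<lambda>u. \<mu> u * q u i"] by (simp add: \<mu>)
    also have "(\<Sum>u\<in>V - {v}. \<mu> u * q u i) = (\<Sum>u\<in>N. a u * p u i)"
      using finite_V N NV by (intro sum.mono_neutral_cong_right) (auto simp: qu \<mu>)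
    finally show ?thesis by (simp add: qv)
  qed
  then have stq: "stress V (complete_edges V) q \<omega> d"
    unfolding \<omega>_def d_def by (intro stress_combine stress_mono[OF st0 E] rank1_stress[OF finite_V])
  have pair0: "\<omega> {u, v} = 0" if "u \<in> V - {v}" for u
  proof (cases "u \<in> N")
    case True
    then show ?thesis using that v by (simp add: \<omega>_def \<omega>0v rank1_pair \<mu>)
  next
    case False
    then have "\<omega>0 {u, v} = 0" using st0 that N by (auto simp: stress_def)
    then show ?thesis using False that v by (simp add: \<omega>_def rank1_pair \<mu>)
  qed
  have \<omega>v: "\<omega> e = 0" if ve: "v \<in> e" for e
  proof (cases "e \<in> complete_edges V")
    case True
    then obtain u where "e = {u, v}" "u \<in> V - {v}" using ve by (auto simp: complete_edges_def card_2_iff)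
    then show ?thesis using pair0 by simp
  next
    case False
    then show ?thesis using stq by (auto simp: stress_def)
  qed
  have dv: "d v = 0" by (simp add: d_def \<kappa>_def \<mu>)
  \<comment> \<open>As \<open>v\<close> now carries neither stress nor diagonal entry, it may return
    to \<open>p v\<close>.\<close>
  have stp: "stress V (complete_edges V) p \<omega> d"
    unfolding stress_def
  proof (intro conjI allI impI ballI)
    fix w i assume w: "w \<in> V" "i \<le> (2::nat)"
    have "(\<Sum>u\<in>V - {w}. \<omega> {u, w} * p u i) = (\<Sum>u\<in>V - {w}. \<omega> {u, w} * q u i)"
    proof (intro sum.cong refl)
      show "\<omega> {u, w} * p u i = \<omega> {u, w} * q u i" for u
        using \<omega>v[of "{u, w}"] by (cases "u = v") (auto simp: qu)
    qed
    moreover have "d w * p w i = d w * q w i" using dv by (cases "w = v") (auto simp: qu)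
    ultimately show "(\<Sum>u\<in>V - {w}. \<omega> {u, w} * p u i) + d w * p w i = 0"
      using stress_equilibrium[OF stq w] by linarith
  qed (use stq in \<open>simp add: stress_def\<close>)
  have ld: "load V col \<omega> d c = - \<kappa> * ((\<Sum>u\<in>{u\<in>V. col u = Some c}. \<mu> u) * (\<Sum>u\<in>V. \<mu> u))" if "c \<in> C" for c
    unfolding \<omega>_def d_def load_combine rank1_load[OF finite_V] using ld0[OF that] by simp
  have \<omega>E: "\<omega> e = - \<kappa> * rank1 V \<mu> e" if "e \<notin> E" for e
    using st0 that by (simp add: \<omega>_def stress_def)
  \<comment> \<open>For \<open>\<kappa> = 0\<close> nothing was subtracted, and
    \<open>\<omega>0\<close> itself would be a load-free stress of the edges that avoid
    \<open>v\<close>.\<close>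
  have \<kappa>: "\<kappa> \<noteq> 0"
  proof
    assume "\<kappa> = 0"
    then have "stress V {e\<in>E. v \<notin> e} p \<omega> d"
      using \<omega>v \<omega>E by (intro stress_restrict[OF stp]) auto
    then have "\<omega> e0 = 0" using stress_freeD[OF free] ld \<open>\<kappa> = 0\<close> by simp
    then show False using e0 \<open>\<kappa> = 0\<close> by (simp add: \<omega>_def)
  qed
  show thesis
    by (rule that[OF \<kappa> stp]) (fact \<omega>v, rule \<omega>E, assumption, fact ld)
qed

end

section \<open>Sparsity implies independence\<close>

context generic_spherical
begin

text \<open>Independence in \<open>\<N>\<^sub>2\<close>, with \<open>card F - r\<^sub>2(F)\<close> expressed by a set \<open>D\<close> of edges that carries all stresses.\<close>

definition sparse :: "'v set set \<Rightarrow> bool" where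
  "sparse E \<longleftrightarrow> (\<forall>F\<subseteq>E. \<exists>D\<subseteq>F. card D \<le> colour_count col F \<and> stress_free V col (F - D) {} p)"

lemma sparse_mono: "sparse E \<Longrightarrow> E' \<subseteq> E \<Longrightarrow> sparse E'"
  unfolding sparse_def by blast

lemma colours_subset:
  assumes "F \<subseteq> complete_edges V"
  shows "{c. Some c \<in> col ` \<Union>F} \<subseteq> C"
proof
  fix c assume "c \<in> {c. Some c \<in> col ` \<Union>F}"
  then obtain e v where "e \<in> F" "v \<in> e" "col v = Some c" by force
  then show "c \<in> C" using assms colour_in_C by (auto simp: complete_edges_def)
qed

lemma colour_countI:
  assumes "F \<subseteq> complete_edges V" "K \<subseteq> {c. Some c \<in> col ` \<Union>F}"
  shows "card K \<le> colour_count col F"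
  unfolding colour_count_def
  using assms finite_subset[OF colours_subset finite_C] by (intro card_mono) auto

text \<open>All but at most two edges are independent in the plane, which gives at most 2|W| - 3 + 2
  edges on the set W of end vertices and a degree sum below 4|W|.\<close>

lemma low_degree_vertex:
  assumes "E \<subseteq> complete_edges V" "E \<noteq> {}" "stress_free V col (E - {f, g}) {} p"
  obtains v where "v \<in> \<Union>E" "card {u\<in>V - {v}. {u, v} \<in> E} \<le> 3"
proof -
  let ?W = "\<Union>E"
  have finE: "finite E" by (rule finite_complete_edges_subset[OF finite_V assms(1)])
  have WV: "?W \<subseteq> V" using assms(1) by (auto simp: complete_edges_def)
  have finW: "finite ?W" by (rule finite_subset[OF WV finite_V])
  obtain e where e: "e \<in> E" using assms(2) by blast
  have "card e = 2" using e assms(1) by (auto simp: complete_edges_def)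
  then have "card ?W \<ge> 2" using e finW card_mono[of ?W e] by auto
  moreover have "E - {f, g} \<subseteq> complete_edges ?W" using assms(1) by (auto simp: complete_edges_def)
  ultimately have "card (E - {f, g}) + 3 \<le> 2 * card ?W"
    using stress_free_card_le[OF WV] assms(3) by blast
  moreover have "card E \<le> card (E - {f, g}) + card {f, g}"
  proof -
    have "card E \<le> card ((E - {f, g}) \<union> {f, g})" using finE by (intro card_mono) auto
    also have "\<dots> \<le> card (E - {f, g}) + card {f, g}" by (rule card_Un_le)
    finally show ?thesis .
  qed
  moreover have "card {f, g} \<le> 2" by (simp add: card_insert_if)
  ultimately have bound: "card E + 1 \<le> 2 * card ?W" by linarith
  have "(\<Sum>v\<in>?W. card {e\<in>E. v \<in> e}) = (\<Sum>v\<in>?W. \<Sum>e\<in>E. if v \<in> e then 1 else 0)"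
    using finE by (simp add: sum.inter_filter[symmetric])
  also have "\<dots> = (\<Sum>e\<in>E. \<Sum>v\<in>?W. if v \<in> e then 1 else 0)" by (rule sum.swap)
  also have "\<dots> = (\<Sum>e\<in>E. 2)"
  proof (intro sum.cong refl)
    fix e assume e: "e \<in> E"
    have "(\<Sum>v\<in>?W. if v \<in> e then 1 else 0) = card {v\<in>?W. v \<in> e}"
      using finW by (simp add: sum.inter_filter[symmetric])
    also have "{v\<in>?W. v \<in> e} = e" using e by blast
    finally show "(\<Sum>v\<in>?W. if v \<in> e then 1 else 0) = (2::nat)"
      using e assms(1) by (auto simp: complete_edges_def)
  qed
  finally have degs: "(\<Sum>v\<in>?W. card {e\<in>E. v \<in> e}) = 2 * card E" by simp
  have "\<exists>v\<in>?W. card {e\<in>E. v \<in> e} \<le> 3"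
  proof (rule ccontr)
    assume "\<not> ?thesis"
    then have "\<And>v. v \<in> ?W \<Longrightarrow> 4 \<le> card {e\<in>E. v \<in> e}" by force
    then have "(\<Sum>v\<in>?W. 4) \<le> (\<Sum>v\<in>?W. card {e\<in>E. v \<in> e})" by (rule sum_mono)
    then show False using degs bound by simp
  qed
  then obtain v where v: "v \<in> ?W" "card {e\<in>E. v \<in> e} \<le> 3" by blast
  have "card {e\<in>E. v \<in> e} = (\<Sum>u\<in>V - {v}. if {u, v} \<in> E then 1 else 0)"
    using sum_incident_edges[OF finite_V assms(1), of v "\<lambda>_. 1::nat"] v WV by auto
  also have "\<dots> = card {u\<in>V - {v}. {u, v} \<in> E}"
    using finite_V by (simp add: sum.inter_filter[symmetric])
  finally show thesis using that v by simp
qed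

text \<open>Without the edge to \<open>x\<close>, equilibrium at \<open>v\<close> relates
  \<open>v\<close> and at most two neighbours, whose points are independent.\<close>

lemma stress_at_low_degree_vertex:
  assumes st: "stress V E p \<omega> d" and v: "v \<in> V" and N: "N = {u\<in>V - {v}. {u, v} \<in> E}" "card N \<le> 3"
    and x: "x \<in> N" "\<omega> {x, v} = 0" and u: "u \<in> N"
  shows "\<omega> {u, v} = 0"
proof -
  have finN: "finite N" and vN: "v \<notin> N" using N finite_V by auto
  let ?A = "insert v (N - {x})"
  have "card ?A = card N" using vN finN x card_gt_0_iff[of N] by auto
  then have cA: "card ?A \<le> 3" using N by simp
  have z: "(\<Sum>u\<in>?A. (if u = v then d v else \<omega> {u, v}) * p u i) = 0" if "i \<le> 2" for i
  proof -
    have "(\<Sum>u\<in>?A. (if u = v then d v else \<omega> {u, v}) * p u i) = d v * p v i + (\<Sum>u\<in>N - {x}. \<omega> {u, v} * p u i)"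
    proof -
      have "(\<Sum>u\<in>N - {x}. (if u = v then d v else \<omega> {u, v}) * p u i) = (\<Sum>u\<in>N - {x}. \<omega> {u, v} * p u i)"
        using vN by (intro sum.cong) auto
      then show ?thesis using finN vN by simp
    qed
    also have "(\<Sum>u\<in>N - {x}. \<omega> {u, v} * p u i) = (\<Sum>u\<in>V - {v}. \<omega> {u, v} * p u i)"
      using finite_V N x st by (intro sum.mono_neutral_left) (auto simp: stress_def)
    finally show ?thesis using stress_equilibrium[OF st v that] by simp
  qed
  show ?thesis
  proof (cases "u = x")
    case False
    then have "(if u = v then d v else \<omega> {u, v}) = 0"
      using N v u by (intro at_most_three_independent[OF _ cA z]) auto
    moreover have "u \<noteq> v" using u vN by blast
    ultimately show ?thesis by simp
  qed (use x in simp)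
qed

text \<open>A minimal counterexample \<open>E\<close> carries a nowhere zero stress without loads, and the space
  of all its stresses has dimension 2. A vertex \<open>v\<close> of degree 3 is moved onto the line through a
  neighbour, which shows that the loads of the stress avoiding \<open>v\<close> single out a colour missing at
  \<open>v\<close> and its neighbours, and then into the plane of two neighbours \<open>h\<close>, \<open>h'\<close>, which yields an
  uncoloured stress through \<open>h h'\<close>. These combine to a stress of \<open>E\<close> that misses a colour.\<close>

lemma sparse_imp_stress_free:
  assumes C2: "card C \<le> 2"
  shows "E \<subseteq> complete_edges V \<Longrightarrow> sparse E \<Longrightarrow> stress_free V col E C p"
proof (induction "card E" arbitrary: E rule: less_induct)
  case less
  note E = less.prems(1) and sparse = less.prems(2)
  have finE: "finite E" by (rule finite_complete_edges_subset[OF finite_V E])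
  have IH: "stress_free V col E' C p" if "E' \<subset> E" for E'
    using that less.hyps[of E'] E sparse_mono[OF sparse] psubset_card_mono[OF finE that] by auto
  show ?case
  proof (rule ccontr)
    assume dep: "\<not> stress_free V col E C p"
    then obtain \<omega>0 d0 e' where st0: "stress V E p \<omega>0 d0" and ld0: "\<And>c. c \<in> C \<Longrightarrow> load V col \<omega>0 d0 c = 0"
      and e': "\<omega>0 e' \<noteq> 0" by (auto simp: stress_free_def)
    have supp: "\<omega>0 e \<noteq> 0" if "e \<in> E" for e
    proof
      assume "\<omega>0 e = 0"
      then have s: "stress V (E - {e}) p \<omega>0 d0" using that by (intro stress_restrict[OF st0]) auto
      have f: "stress_free V col (E - {e}) C p" using that by (intro IH) auto
      have "\<omega>0 e' = 0" by (rule stress_freeD[OF f s ld0])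
      then show False using e' by simp
    qed
    have "E \<noteq> {}" using stress_support[OF st0 e'] by blast
    obtain D where D: "D \<subseteq> E" "card D \<le> colour_count col E" "stress_free V col (E - D) {} p"
      using sparse unfolding sparse_def by blast
    have finD: "finite D" using D(1) finE finite_subset by blast
    have "colour_count col E \<noteq> 0"
    proof
      assume "colour_count col E = 0"
      then have "D = {}" using D(2) finD by simp
      then have "\<omega>0 e' = 0" using stress_freeD[OF D(3)] st0 by simp
      then show False using e' by simp
    qed
    then obtain e1 w1 cc where e1: "e1 \<in> E" "w1 \<in> e1" "col w1 = Some cc"
      by (auto simp: colour_count_def card_eq_0_iff) metis
    have w1: "w1 \<in> V" using e1 E by (auto simp: complete_edges_def)
    \<comment> \<open>Otherwise the value at \<open>e\<close> determines a stress, and the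
      reflection argument gives \<open>\<omega>0\<close> a nonzero load on
      \<open>cc\<close>.\<close>
    have two_dim: "\<exists>\<omega> d. stress V E p \<omega> d \<and> \<omega> e = 0 \<and> (\<exists>e'. \<omega> e' \<noteq> 0)" for e
    proof (rule ccontr)
      assume "\<not> ?thesis"
      then have "\<forall>\<omega> d. stress V E p \<omega> d \<longrightarrow> \<omega> e = 0 \<longrightarrow> (\<forall>e. \<omega> e = 0)" by blast
      then have "load V col \<omega>0 d0 cc \<noteq> 0"
        by (rule load_nonzero[OF E _ st0 supp[OF e1(1)] e1(2,3)])
      then show False using ld0 colour_in_C[OF w1 e1(3)] by simp
    qed
    \<comment> \<open>Every nonzero stress is nonzero somewhere on \<open>D\<close>, which a single
      edge cannot achieve; this leaves exactly two colours.\<close>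
    have "\<not> D \<subseteq> {e}" for e
    proof
      assume De: "D \<subseteq> {e}"
      obtain \<omega> d e'' where \<omega>: "stress V E p \<omega> d" "\<omega> e = 0" "\<omega> e'' \<noteq> 0" using two_dim by blast
      then have "stress V (E - D) p \<omega> d" using De by (intro stress_restrict[OF \<omega>(1)]) auto
      then show False using stress_freeD[OF D(3)] \<omega>(3) by blast
    qed
    then have "card D \<ge> 2"
      by (metis card_le_Suc0_iff_eq[OF finD] insert_absorb2 not_less_eq_eq numeral_2_eq_2 singletonI subsetI)
    moreover have "colour_count col E \<le> card C"
      unfolding colour_count_def by (rule card_mono[OF finite_C colours_subset[OF E]])
    ultimately have cards: "card D = 2" "card C = 2" "colour_count col E = 2" using C2 D(2) by auto
    then obtain f g where fg: "D = {f, g}" by (auto simp: card_2_iff)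
    obtain c1 c2 where C: "C = {c1, c2}" "c1 \<noteq> c2" using cards(2) by (auto simp: card_2_iff)
    have KE: "{c. Some c \<in> col ` \<Union>E} = C"
      using colours_subset[OF E] cards finite_C by (intro card_subset_eq) (auto simp: colour_count_def)
    have span: "\<omega>3 e = 0" if "stress V E p \<omega>1 d1" "\<omega>1 a \<noteq> 0" "stress V E p \<omega>2 d2" "\<omega>2 a = 0" "\<omega>2 b \<noteq> 0"
      "stress V E p \<omega>3 d3" "\<omega>3 a = 0" "\<omega>3 b = 0" for \<omega>1 d1 \<omega>2 d2 \<omega>3 d3 a b e
      using two_stresses_span[OF D(3)[unfolded fg] that] .
    \<comment> \<open>A stress missing the colour \<open>c\<close> is subtracted from
      \<open>\<omega>0\<close> so as to remove an edge \<open>a\<close>. The stresses of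
      \<open>E - {a}\<close> form a line, and the difference is nonzero at an edge touching
      \<open>c\<close> but has no load on \<open>c\<close>, which the reflection argument
      excludes.\<close>
    have all_colours: "\<exists>e w. \<omega> e \<noteq> 0 \<and> w \<in> e \<and> col w = Some c"
      if st: "stress V E p \<omega> d" and a: "\<omega> a \<noteq> 0" and c: "c \<in> C" for \<omega> d a c
    proof (rule ccontr)
      assume no: "\<not> ?thesis"
      have ld: "load V col \<omega> d c = 0" using no by (intro load_zero[OF nonzero st]) blast
      define t where "t = \<omega>0 a / \<omega> a"
      let ?\<omega> = "\<lambda>e. 1 * \<omega>0 e + (- t) * \<omega> e" and ?d = "\<lambda>v. 1 * d0 v + (- t) * d v"
      have st2: "stress V E p ?\<omega> ?d" by (rule stress_combine[OF st0 st])
      have \<omega>a: "?\<omega> a = 0" using a by (simp add: t_def)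
      have "Some c \<in> col ` \<Union>E" using c KE by blast
      then obtain e w where e: "e \<in> E" "w \<in> e" "col w = Some c" by auto
      then have "\<omega> e = 0" using no by blast
      then have \<omega>e: "?\<omega> e \<noteq> 0" using supp[OF e(1)] by simp
      have st3: "stress V (E - {a}) p ?\<omega> ?d"
      proof (rule stress_restrict[OF st2])
        show "?\<omega> e = 0" if "e \<in> E" "e \<notin> E - {a}" for e using \<omega>a that by auto
      qed
      have "\<forall>\<omega>' d'. stress V (E - {a}) p \<omega>' d' \<longrightarrow> \<omega>' e = 0 \<longrightarrow> (\<forall>e. \<omega>' e = 0)"
      proof (intro allI impI)
        fix \<omega>' d' e'' assume s: "stress V (E - {a}) p \<omega>' d'" and z: "\<omega>' e = 0"
        have "\<omega>' a = 0" using s by (auto simp: stress_def)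
        then show "\<omega>' e'' = 0" using span[OF st a st2 \<omega>a \<omega>e stress_mono[OF s]] z by blast
      qed
      then have "load V col ?\<omega> ?d c \<noteq> 0"
        by (rule load_nonzero[of "E - {a}" e ?\<omega> ?d e w c, rotated]) (use E st3 \<omega>e e in blast)+
      then show False unfolding load_combine using ld ld0[OF c] by simp
    qed
    obtain v where v0: "v \<in> \<Union>E" "card {u\<in>V - {v}. {u, v} \<in> E} \<le> 3"
      by (rule low_degree_vertex[OF E \<open>E \<noteq> {}\<close> D(3)[unfolded fg]])
    define N where "N = {u\<in>V - {v}. {u, v} \<in> E}"
    have N3: "card N \<le> 3" using v0 by (simp add: N_def)
    have NV: "N \<subseteq> V" "v \<notin> N" "finite N" using finite_V by (auto simp: N_def)
    have NE: "{u, v} \<in> E" if "u \<in> N" for u using that by (simp add: N_def)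
    obtain ev where ev: "ev \<in> E" "v \<in> ev" using v0 by blast
    then have "ev \<subseteq> V" "card ev = 2" using E by (auto simp: complete_edges_def)
    then obtain x where x0: "ev = {x, v}" "x \<noteq> v" using ev by (auto simp: card_2_iff)
    have v: "v \<in> V" using ev \<open>ev \<subseteq> V\<close> by blast
    have x: "x \<in> N" using x0 ev \<open>ev \<subseteq> V\<close> by (auto simp: N_def)
    have edge_at_v: "\<exists>u\<in>N. e = {u, v}" if e: "e \<in> E" "v \<in> e" for e
    proof -
      have "e \<subseteq> V" "card e = 2" using E e by (auto simp: complete_edges_def)
      then obtain u where "e = {u, v}" "u \<noteq> v" using e by (auto simp: card_2_iff)
      with e \<open>e \<subseteq> V\<close> show ?thesis by (auto simp: N_def)
    qed
    define E' where "E' = {e\<in>E. v \<notin> e}"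
    have xvE': "{x, v} \<notin> E'" by (simp add: E'_def)
    have "E' \<subseteq> E" unfolding E'_def by (rule Collect_restrict)
    moreover have "E' \<noteq> E" using NE[OF x] xvE' by metis
    ultimately have E'E: "E' \<subset> E" by (rule psubsetI)
    have E'V: "E' \<subseteq> complete_edges V" using E E'E by blast
    have freeE': "stress_free V col E' C p" by (rule IH[OF E'E])
    \<comment> \<open>A stress that vanishes at one edge of \<open>v\<close> vanishes at all of
      them, so \<open>\<omega>2\<close> lives on \<open>E'\<close>. Together with
      \<open>\<omega>0\<close> it spans the stresses of \<open>E\<close>.\<close>
    obtain \<omega>2 d2 g' where st2E: "stress V E p \<omega>2 d2" and \<omega>2x: "\<omega>2 {x, v} = 0" and g': "\<omega>2 g' \<noteq> 0"
      using two_dim[of "{x, v}"] by blast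
    have st2: "stress V E' p \<omega>2 d2"
    proof (rule stress_restrict[OF st2E])
      fix e assume "e \<in> E" "e \<notin> E'"
      then obtain u where "u \<in> N" "e = {u, v}" using edge_at_v by (auto simp: E'_def)
      then show "\<omega>2 e = 0" using stress_at_low_degree_vertex[OF st2E v N_def N3 x \<omega>2x] by simp
    qed
    have one_dim: "\<omega> e = 0" if "stress V E p \<omega> d" "\<omega> {x, v} = 0" "\<omega> g' = 0" for \<omega> d e
      using span[OF st0 supp[OF NE[OF x]] st2E \<omega>2x g' that] .
    define A B where "A = load V col \<omega>2 d2 c1" and "B = load V col \<omega>2 d2 c2"
    have AB: "A \<noteq> 0 \<or> B \<noteq> 0"
    proof (rule ccontr)
      assume "\<not> ?thesis"
      then have "load V col \<omega>2 d2 c = 0" if "c \<in> C" for c using that C by (auto simp: A_def B_def)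
      from stress_freeD[OF freeE' st2 this] g' show False by blast
    qed
    \<comment> \<open>\<open>\<omega>2\<close> spans the stresses of \<open>E'\<close>, so their
      pairs of loads are multiples of \<open>(A, B)\<close>. The linear form here detects loads that
      no stress of \<open>E'\<close> has.\<close>
    have annihilate: "B * load V col \<omega> d c1 - A * load V col \<omega> d c2 = 0" if st: "stress V E' p \<omega> d" for \<omega> d
    proof -
      define t where "t = \<omega> g' / \<omega>2 g'"
      have st': "stress V E p (\<lambda>e. 1 * \<omega> e + (- t) * \<omega>2 e) (\<lambda>v. 1 * d v + (- t) * d2 v)"
        using E'E by (intro stress_combine stress_mono[OF st] st2E) auto
      have "\<omega> {x, v} = 0" using st xvE' by (simp add: stress_def)
      then have zx: "1 * \<omega> {x, v} + (- t) * \<omega>2 {x, v} = 0" using \<omega>2x by simp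
      have zg: "1 * \<omega> g' + (- t) * \<omega>2 g' = 0" using g' by (simp add: t_def)
      have z: "1 * \<omega> e + (- t) * \<omega>2 e = 0" for e by (rule one_dim[OF st' zx zg])
      have "load V col (\<lambda>e. 1 * \<omega> e + (- t) * \<omega>2 e) (\<lambda>v. 1 * d v + (- t) * d2 v) c = 0" for c
        by (rule load_zero[OF nonzero st']) (use z in blast)
      then have "load V col \<omega> d c = t * load V col \<omega>2 d2 c" for c unfolding load_combine by simp
      then show ?thesis by (simp add: A_def B_def)
    qed
    \<comment> \<open>On a rank one stress the same form takes the value
      \<open>(\<Sum>u\<in>V. \<mu> u) * (\<Sum>u\<in>V. L u * \<mu> u)\<close>.\<close>
    define L where "L w = (if col w = Some c1 then B else if col w = Some c2 then - A else 0)" for w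
    have L_sum: "B * (\<Sum>u\<in>{u\<in>V. col u = Some c1}. \<mu> u) - A * (\<Sum>u\<in>{u\<in>V. col u = Some c2}. \<mu> u) = (\<Sum>u\<in>V. L u * \<mu> u)" for \<mu>
    proof -
      have "B * (\<Sum>u\<in>{u\<in>V. col u = Some c1}. \<mu> u) - A * (\<Sum>u\<in>{u\<in>V. col u = Some c2}. \<mu> u) =
        (\<Sum>u\<in>V. B * (if col u = Some c1 then \<mu> u else 0) - A * (if col u = Some c2 then \<mu> u else 0))"
        using finite_V by (simp add: sum_subtractf sum_distrib_left[symmetric] sum.inter_filter)
      also have "\<dots> = (\<Sum>u\<in>V. L u * \<mu> u)" using C(2) by (intro sum.cong) (auto simp: L_def)
      finally show ?thesis .
    qed
    define M where "M a u = (if u = v then - 1 else if u \<in> N then a u else 0 :: real)" for a and u :: 'v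
    have M_rank1: "rank1 V (M a) e = 0" if "u \<in> e" "M a u = 0" for a u e
    proof (cases "e \<in> complete_edges V")
      case True
      then have "finite e" using finite_V finite_subset[of e V] by (simp add: complete_edges_def)
      then have "prod (M a) e = 0" using that by (intro prod_zero) blast+
      then show ?thesis by (simp add: rank1_def)
    qed (simp add: rank1_def)
    have relocated: "\<exists>\<omega> d \<kappa>. \<kappa> \<noteq> 0 \<and> stress V (complete_edges V) p \<omega> d \<and> (\<forall>e. v \<in> e \<longrightarrow> \<omega> e = 0) \<and>
        (\<forall>e. v \<notin> e \<longrightarrow> e \<notin> E \<longrightarrow> \<omega> e = - \<kappa> * rank1 V (M a) e) \<and>
        B * load V col \<omega> d c1 - A * load V col \<omega> d c2 = - \<kappa> * (\<Sum>u\<in>V. M a u) * (\<Sum>u\<in>V. L u * M a u)"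
      if P: "(\<Sum>i\<le>2. (\<Sum>u\<in>N. a u * p u i)\<^sup>2) = (radius col r v)\<^sup>2" for a
    proof -
      obtain \<omega> d \<kappa> where R: "\<kappa> \<noteq> 0" "stress V (complete_edges V) p \<omega> d" "\<And>e. v \<in> e \<Longrightarrow> \<omega> e = 0"
        "\<And>e. v \<notin> e \<Longrightarrow> e \<notin> E \<Longrightarrow> \<omega> e = - \<kappa> * rank1 V (M a) e"
        "\<And>c. c \<in> C \<Longrightarrow> load V col \<omega> d c = - \<kappa> * ((\<Sum>u\<in>{u\<in>V. col u = Some c}. M a u) * (\<Sum>u\<in>V. M a u))"
        by (rule relocate_vertex[OF E v N_def N3 dep freeE'[unfolded E'_def] P, of "M a"]) (auto simp: M_def)
      have "B * load V col \<omega> d c1 - A * load V col \<omega> d c2 = - \<kappa> * (\<Sum>u\<in>V. M a u) *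
        (B * (\<Sum>u\<in>{u\<in>V. col u = Some c1}. M a u) - A * (\<Sum>u\<in>{u\<in>V. col u = Some c2}. M a u))"
        using C by (simp add: R(5) algebra_simps)
      then show ?thesis using R(1-4) unfolding L_sum by blast
    qed
    have M_sum: "(\<Sum>u\<in>V. b u * M a u) = - b v + (\<Sum>u\<in>N. b u * a u)" for a b
    proof -
      have "(\<Sum>u\<in>V. b u * M a u) = b v * M a v + (\<Sum>u\<in>V - {v}. b u * M a u)"
        by (rule sum.remove[OF finite_V v])
      also have "(\<Sum>u\<in>V - {v}. b u * M a u) = (\<Sum>u\<in>N. b u * a u)"
        using finite_V NV by (intro sum.mono_neutral_cong_right) (auto simp: M_def)
      finally show ?thesis by (simp add: M_def)
    qed
    \<comment> \<open>With \<open>h\<close> as the only neighbour in use, the rank one stress lives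
      on the single edge \<open>{h, v}\<close>. The relocated stress then belongs to
      \<open>E'\<close>, where the form vanishes, and the two alternatives are the two factors of
      the form.\<close>
    have on_line: "\<rho> = 1 \<or> L h * \<rho> = L v"
      if h: "h \<in> N" and \<rho>: "\<rho>\<^sup>2 * (radius col r h)\<^sup>2 = (radius col r v)\<^sup>2" for h \<rho>
    proof -
      define a where "a u = (if u = h then \<rho> else 0)" for u
      have aS: "(\<Sum>u\<in>N. b u * a u) = b h * \<rho>" for b :: "'v \<Rightarrow> real"
      proof -
        have "(\<Sum>u\<in>N. b u * a u) = (\<Sum>u\<in>N. if u = h then b u * \<rho> else 0)"
          by (intro sum.cong) (auto simp: a_def)
        then show ?thesis using NV h by simp
      qed
      have "(\<Sum>i\<le>2. (\<Sum>u\<in>N. a u * p u i)\<^sup>2) = (\<Sum>i\<le>2. (\<rho> * p h i)\<^sup>2)"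
        using aS[of "\<lambda>u. p u _"] by (simp add: mult.commute)
      also have "\<dots> = \<rho>\<^sup>2 * (\<Sum>i\<le>2. (p h i)\<^sup>2)" by (simp add: power_mult_distrib sum_distrib_left)
      also have "\<dots> = (radius col r v)\<^sup>2" using \<rho> spheres h NV by (auto simp: on_spheres_def)
      finally have Pa: "(\<Sum>i\<le>2. (\<Sum>u\<in>N. a u * p u i)\<^sup>2) = (radius col r v)\<^sup>2" .
      obtain \<omega> d \<kappa> where R: "\<kappa> \<noteq> 0" "stress V (complete_edges V) p \<omega> d" "\<forall>e. v \<in> e \<longrightarrow> \<omega> e = 0"
        "\<forall>e. v \<notin> e \<longrightarrow> e \<notin> E \<longrightarrow> \<omega> e = - \<kappa> * rank1 V (M a) e"
        "B * load V col \<omega> d c1 - A * load V col \<omega> d c2 = - \<kappa> * (\<Sum>u\<in>V. M a u) * (\<Sum>u\<in>V. L u * M a u)"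
        using relocated[OF Pa] by (elim exE conjE) (rule that)
      have "stress V E' p \<omega> d"
      proof (rule stress_restrict[OF R(2)])
        fix e assume e: "e \<in> complete_edges V" "e \<notin> E'"
        show "\<omega> e = 0"
        proof (cases "v \<in> e")
          case False
          have "card e = 2" using e by (auto simp: complete_edges_def)
          then have "\<not> e \<subseteq> {h}" using card_mono[of "{h}" e] by auto
          then obtain u where "u \<in> e" "u \<noteq> h" by blast
          then have "M a u = 0" using False by (auto simp: M_def a_def)
          then have "rank1 V (M a) e = 0" using \<open>u \<in> e\<close> by (rule M_rank1[rotated])
          then show ?thesis using R(4) False e by (simp add: E'_def)
        qed (use R(3) in simp)
      qed
      then have "(\<Sum>u\<in>V. 1 * M a u) * (\<Sum>u\<in>V. L u * M a u) = 0" using annihilate R(1,5) by simp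
      then have "(\<rho> - 1) * (L h * \<rho> - L v) = 0" unfolding M_sum aS by simp
      then show ?thesis by auto
    qed
    have L0: "L h = 0 \<and> L v = 0" if h: "h \<in> N" for h
    proof -
      define \<rho> where "\<rho> = radius col r v / radius col r h"
      have hV: "h \<in> V" using h NV by blast
      have \<rho>: "\<rho> > 0" "\<rho>\<^sup>2 * (radius col r h)\<^sup>2 = (radius col r v)\<^sup>2"
        using radius_pos[OF v] radius_pos[OF hV] by (auto simp: \<rho>_def power_divide)
      \<comment> \<open>The antipodal position is always available. The other one gives a second
        equation unless the radii agree; then genericity makes the colours equal, and
        \<open>L v = L h\<close> replaces it.\<close>
      have "- \<rho> \<noteq> 1" using \<rho> by linarith
      then have minus: "L h * (- \<rho>) = L v" using on_line[OF h, of "- \<rho>"] \<rho> by auto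
      show ?thesis
      proof (cases "\<rho> = 1")
        case True
        then have "radius col r v = radius col r h" using radius_pos[OF hV] by (simp add: \<rho>_def)
        then have "col v = col h" using radius_distinct[OF v hV] by blast
        then have "L v = L h" by (simp add: L_def)
        then show ?thesis using minus True by simp
      next
        case False
        then have "L h * \<rho> = L v" using on_line[OF h \<rho>(2)] by blast
        then show ?thesis using minus \<rho>(1) by auto
      qed
    qed
    have LN: "L u = 0" if "u \<in> insert v N" for u using that L0 x by blast
    \<comment> \<open>A colour whose weight in \<open>L\<close> is nonzero cannot occur where
      \<open>L\<close> vanishes.\<close>
    have "\<exists>c\<in>C. \<forall>u\<in>insert v N. col u \<noteq> Some c"
    proof (cases "A = 0")
      case True
      then have "col u \<noteq> Some c1" if "u \<in> insert v N" for u using LN[OF that] AB by (auto simp: L_def)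
      then show ?thesis using C by blast
    next
      case False
      then have "col u \<noteq> Some c2" if "u \<in> insert v N" for u using LN[OF that] C(2) by (auto simp: L_def)
      then show ?thesis using C by blast
    qed
    then obtain c where c: "c \<in> C" "\<forall>u\<in>insert v N. col u \<noteq> Some c" by blast
    have LM0: "(\<Sum>u\<in>V. L u * M a u) = 0" for a unfolding M_sum using L0 x by (simp add: sum.neutral)
    have uncoloured: "\<exists>\<theta> d. stress V (insert {h, h'} E') p \<theta> d \<and> \<theta> {h, h'} \<noteq> 0 \<and>
        (\<forall>e. \<theta> e \<noteq> 0 \<longrightarrow> (\<forall>w\<in>e. col w = None))"
      if h: "h \<in> N" "h' \<in> N" "h \<noteq> h'" and hE: "{h, h'} \<notin> E" for h h'
    proof -
      let ?e = "{h, h'}"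
      have hV: "h \<in> V" "h' \<in> V" "v \<noteq> h" "v \<noteq> h'" using h NV by auto
      have eV: "insert ?e E' \<subseteq> complete_edges V" using E'V hV h(3) by (auto simp: complete_edges_def)
      define S where "S = (\<Sum>i\<le>2. (p h i + p h' i)\<^sup>2)"
      have "S > 0"
      proof (rule ccontr)
        assume "\<not> S > 0"
        then have "S = 0" using sum_nonneg[of "{..2}" "\<lambda>i. (p h i + p h' i)\<^sup>2"] by (simp add: S_def)
        then have "p h i + p h' i = 0" if "i \<le> 2" for i
          using that by (simp add: S_def sum_nonneg_eq_0_iff)
        then have "(\<Sum>u\<in>?e. 1 * p u i) = 0" if "i \<le> 2" for i using that h(3) by simp
        then have "(1::real) = 0"
          by (rule at_most_three_independent[of ?e "\<lambda>_. 1" h, rotated 2]) (use hV h in auto)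
        then show False by simp
      qed
      \<comment> \<open>Scales \<open>p h + p h'\<close> to the sphere of \<open>v\<close>.\<close>
      define t where "t = radius col r v / sqrt S"
      have t: "t \<noteq> 0" "t\<^sup>2 * S = (radius col r v)\<^sup>2"
        using \<open>S > 0\<close> radius_pos[OF v] by (auto simp: t_def power_divide)
      define a where "a u = (if u \<in> ?e then t else 0)" for u
      have "(\<Sum>u\<in>N. a u * p u i) = t * (p h i + p h' i)" for i
      proof -
        have "(\<Sum>u\<in>N. a u * p u i) = (\<Sum>u\<in>?e. t * p u i)"
          using NV h by (intro sum.mono_neutral_cong_right) (auto simp: a_def)
        then show ?thesis using h(3) by (simp add: distrib_left)
      qed
      then have Pa: "(\<Sum>i\<le>2. (\<Sum>u\<in>N. a u * p u i)\<^sup>2) = (radius col r v)\<^sup>2"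
        using t(2) by (simp add: power_mult_distrib S_def sum_distrib_left)
      obtain \<omega> d \<kappa> where R: "\<kappa> \<noteq> 0" "stress V (complete_edges V) p \<omega> d" "\<forall>e. v \<in> e \<longrightarrow> \<omega> e = 0"
        "\<forall>e. v \<notin> e \<longrightarrow> e \<notin> E \<longrightarrow> \<omega> e = - \<kappa> * rank1 V (M a) e"
        "B * load V col \<omega> d c1 - A * load V col \<omega> d c2 = - \<kappa> * (\<Sum>u\<in>V. M a u) * (\<Sum>u\<in>V. L u * M a u)"
        using relocated[OF Pa] by (elim exE conjE) (rule that)
      have \<omega>e: "\<omega> ?e \<noteq> 0"
      proof -
        have "rank1 V (M a) ?e = t * t" using hV h NV by (simp add: rank1_pair M_def a_def)
        then show ?thesis using R(4)[rule_format, of ?e] hE hV R(1) t(1) by auto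
      qed
      have st: "stress V (insert ?e E') p \<omega> d"
      proof (rule stress_restrict[OF R(2)])
        fix e assume e: "e \<in> complete_edges V" "e \<notin> insert ?e E'"
        show "\<omega> e = 0"
        proof (cases "v \<in> e")
          case False
          have "card e = 2" using e by (auto simp: complete_edges_def)
          have "\<not> e \<subseteq> ?e"
          proof
            assume "e \<subseteq> ?e"
            then have "e = ?e" using \<open>card e = 2\<close> h(3) by (intro card_subset_eq) auto
            then show False using e by simp
          qed
          then obtain u where "u \<in> e" "u \<notin> ?e" by blast
          then have "M a u = 0" using False by (auto simp: M_def a_def)
          then have "rank1 V (M a) e = 0" using \<open>u \<in> e\<close> by (rule M_rank1[rotated])
          then show ?thesis using R(4) False e by (simp add: E'_def)
        qed (use R(3) in simp)
      qed
      \<comment> \<open>As \<open>L\<close> vanishes on \<open>v\<close> and \<open>N\<close>, the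
        loads of \<open>\<omega>\<close> are proportional to those of \<open>\<omega>2\<close>, and
        subtracting a multiple of \<open>\<omega>2\<close> leaves a load-free stress through
        \<open>{h, h'}\<close>.\<close>
      have loads: "B * load V col \<omega> d c1 = A * load V col \<omega> d c2" using R(5) by (simp add: LM0)
      define \<tau> where "\<tau> = (if A \<noteq> 0 then load V col \<omega> d c1 / A else load V col \<omega> d c2 / B)"
      have "load V col \<omega> d c = \<tau> * load V col \<omega>2 d2 c" if "c \<in> C" for c
      proof -
        have "load V col \<omega> d c1 = \<tau> * A" "load V col \<omega> d c2 = \<tau> * B"
          using AB loads by (auto simp: \<tau>_def field_simps)
        then show ?thesis using that C by (auto simp: A_def B_def)
      qed
      then have "load V col (\<lambda>e. 1 * \<omega> e + (- \<tau>) * \<omega>2 e) (\<lambda>v. 1 * d v + (- \<tau>) * d2 v) c = 0" if "c \<in> C" for c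
        using that unfolding load_combine by simp
      moreover have "stress V (insert ?e E') p (\<lambda>e. 1 * \<omega> e + (- \<tau>) * \<omega>2 e) (\<lambda>v. 1 * d v + (- \<tau>) * d2 v)"
        by (intro stress_combine st stress_mono[OF st2]) blast
      moreover have "1 * \<omega> ?e + (- \<tau>) * \<omega>2 ?e \<noteq> 0"
        using \<omega>e st2E hE by (simp add: stress_def)
      ultimately have "\<not> stress_free V col (insert ?e E') C p"
        using stress_freeD[of V col "insert ?e E'" C p] by blast
      \<comment> \<open>Deleting \<open>v\<close> loses the edges to both \<open>h\<close> and
        \<open>h'\<close>, while only one edge is added, so the induction hypothesis
        applies.\<close>
      moreover have "card (insert ?e E') < card E"
      proof -
        have "E' \<subseteq> E - {{h, v}, {h', v}}" by (auto simp: E'_def)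
        then have "card E' \<le> card (E - {{h, v}, {h', v}})" using finE by (intro card_mono) auto
        also have "\<dots> = card E - card {{h, v}, {h', v}}"
          using finE NE h by (intro card_Diff_subset) auto
        also have "card {{h, v}, {h', v}} = 2" using h(3) hV by (simp add: card_insert_if doubleton_eq_iff)
        finally have "card E' \<le> card E - 2" .
        moreover have "card E \<ge> card {{h, v}, {h', v}}" using NE h finE by (intro card_mono) auto
        moreover have "card {{h, v}, {h', v}} = 2" using h(3) hV by (simp add: card_insert_if doubleton_eq_iff)
        moreover have "card (insert ?e E') \<le> Suc (card E')" by (rule card_insert_le_m1) simp_all
        ultimately show ?thesis by linarith
      qed
      ultimately have "\<not> sparse (insert ?e E')" using less.hyps[OF _ eV] by blast
      then obtain F where F: "F \<subseteq> insert ?e E'"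
        "\<And>D. D \<subseteq> F \<Longrightarrow> card D \<le> colour_count col F \<Longrightarrow> \<not> stress_free V col (F - D) {} p"
        unfolding sparse_def by blast
      have FV: "F \<subseteq> complete_edges V" using F eV by blast
      have eF: "?e \<in> F"
      proof (rule ccontr)
        assume "?e \<notin> F"
        then have "F \<subseteq> E" using F E'E by blast
        then show False using sparse F(2) unfolding sparse_def by blast
      qed
      have Fe: "F - {?e} \<subseteq> E'" using F by blast
      \<comment> \<open>A stress of these edges is a stress of \<open>E\<close> and touches both
        colours, so \<open>F\<close> may discard two edges. Discarding \<open>{h, h'}\<close> and
        \<open>g'\<close> leaves no stress, since a stress of \<open>E'\<close> is determined by its
        value at \<open>g'\<close>.\<close>
      have freeF: "stress_free V col (F - {?e}) {} p"
      proof (rule ccontr)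
        assume "\<not> ?thesis"
        then obtain \<omega>' d' e'' where s: "stress V (F - {?e}) p \<omega>' d'" "\<omega>' e'' \<noteq> 0"
          by (auto simp: stress_free_def)
        have sE: "stress V E p \<omega>' d'" using Fe E'E by (intro stress_mono[OF s(1)]) blast
        have "C \<subseteq> {c. Some c \<in> col ` \<Union>F}"
        proof
          fix c assume "c \<in> C"
          then obtain e w where ew: "\<omega>' e \<noteq> 0" "w \<in> e" "col w = Some c"
            using all_colours[OF sE s(2)] by blast
          then have "e \<in> F" using stress_support[OF s(1)] by blast
          with ew show "c \<in> {c. Some c \<in> col ` \<Union>F}" by (auto intro!: image_eqI[of _ _ w])
        qed
        from colour_countI[OF FV this] have "2 \<le> colour_count col F" using cards(2) by simp
        moreover have "card (F \<inter> {?e, g'}) \<le> 2"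
        proof -
          have "card (F \<inter> {?e, g'}) \<le> card {?e, g'}" by (intro card_mono) auto
          also have "\<dots> \<le> 2" by (simp add: card_insert_if)
          finally show ?thesis .
        qed
        ultimately have "\<not> stress_free V col (F - (F \<inter> {?e, g'})) {} p" by (intro F(2)) auto
        moreover have "stress_free V col (F - (F \<inter> {?e, g'})) {} p"
          unfolding stress_free_def
        proof (intro allI impI)
          fix \<omega> d e assume s: "stress V (F - (F \<inter> {?e, g'})) p \<omega> d"
          have out: "\<omega> e = 0" if "e \<notin> F - (F \<inter> {?e, g'})" for e
            using s that unfolding stress_def by blast
          have "{x, v} \<notin> F - (F \<inter> {?e, g'})" using Fe xvE' by blast
          then have z: "\<omega> {x, v} = 0" "\<omega> g' = 0" by (simp_all add: out)
          have "stress V E p \<omega> d" using Fe E'E by (intro stress_mono[OF s]) blast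
          then show "\<omega> e = 0" using z by (rule one_dim)
        qed
        ultimately show False by blast
      qed
      \<comment> \<open>A single colour on \<open>F\<close> would permit discarding just
        \<open>{h, h'}\<close>.\<close>
      have "\<not> 1 \<le> colour_count col F"
        using F(2)[of "{?e}"] eF freeF by auto
      then have k0: "colour_count col F = 0" by simp
      have "\<not> stress_free V col F {} p" using F(2)[of "{}"] by simp
      then obtain \<theta> d\<theta> e'' where s: "stress V F p \<theta> d\<theta>" "\<theta> e'' \<noteq> 0" by (auto simp: stress_free_def)
      have "\<theta> ?e \<noteq> 0"
      proof
        assume "\<theta> ?e = 0"
        then have "stress V (F - {?e}) p \<theta> d\<theta>" by (intro stress_restrict[OF s(1)]) auto
        then show False using stress_freeD[OF freeF] s(2) by blast
      qed
      moreover have "col w = None" if e: "\<theta> e \<noteq> 0" "w \<in> e" for e w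
      proof (rule ccontr)
        assume "col w \<noteq> None"
        then obtain c where c: "col w = Some c" by blast
        have "e \<in> F" using stress_support[OF s(1) e(1)] .
        then have "{c} \<subseteq> {c. Some c \<in> col ` \<Union>F}" using e c by (auto intro!: image_eqI[of _ _ w])
        from colour_countI[OF FV this] k0 show False by simp
      qed
      moreover have "stress V (insert ?e E') p \<theta> d\<theta>" by (rule stress_mono[OF s(1) F(1)])
      ultimately show ?thesis by blast
    qed
    have "d0 v \<noteq> 0"
    proof
      assume "d0 v = 0"
      have eq0: "(\<Sum>u\<in>N. \<omega>0 {u, v} * p u i) = 0" if "i \<le> 2" for i
      proof -
        have "(\<Sum>u\<in>N. \<omega>0 {u, v} * p u i) = (\<Sum>u\<in>V - {v}. \<omega>0 {u, v} * p u i)"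
          using finite_V st0 by (intro sum.mono_neutral_left) (auto simp: N_def stress_def)
        then show ?thesis using stress_equilibrium[OF st0 v that] \<open>d0 v = 0\<close> by simp
      qed
      have "\<omega>0 {x, v} = 0"
        by (rule at_most_three_independent[of N "\<lambda>u. \<omega>0 {u, v}" x, OF NV(1) N3 eq0 x])
      then show False using supp[OF NE[OF x]] by simp
    qed
    \<comment> \<open>Equilibrium at \<open>v\<close> expresses \<open>p v\<close> by its
      neighbours, with these coefficients; \<open>v\<close> stays in place this time.\<close>
    define a where "a u = - \<omega>0 {u, v} / d0 v" for u
    define R where "R = rank1 V (M a)"
    have stR: "stress V (complete_edges V) p R (\<lambda>u. (M a u)\<^sup>2)"
      unfolding R_def
    proof (rule rank1_stress[OF finite_V])
      fix i :: nat assume i: "i \<le> 2"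
      have "(\<Sum>u\<in>N. \<omega>0 {u, v} * p u i) = (\<Sum>u\<in>V - {v}. \<omega>0 {u, v} * p u i)"
        using finite_V st0 by (intro sum.mono_neutral_left) (auto simp: N_def stress_def)
      then have "(\<Sum>u\<in>N. \<omega>0 {u, v} * p u i) = - d0 v * p v i"
        using stress_equilibrium[OF st0 v i] by simp
      moreover have "(\<Sum>u\<in>N. p u i * a u) = - (\<Sum>u\<in>N. \<omega>0 {u, v} * p u i) / d0 v"
        by (simp add: a_def sum_divide_distrib sum_negf mult.commute)
      ultimately have "(\<Sum>u\<in>N. p u i * a u) = p v i" using \<open>d0 v \<noteq> 0\<close> by simp
      then show "(\<Sum>u\<in>V. M a u * p u i) = 0" using M_sum[of "\<lambda>u. p u i" a] by (simp add: mult.commute)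
    qed
    \<comment> \<open>The rank one stress lives on the complete graph on \<open>v\<close> and
      \<open>N\<close>. Its edges outside \<open>E\<close> form \<open>T\<close>, and an uncoloured
      stress cancels each of them.\<close>
    define T where "T = {e. e \<subseteq> N \<and> card e = 2} - E"
    have finT: "finite T" using NV(3) by (auto simp: T_def intro: finite_subset[of _ "Pow N"])
    have "\<exists>\<theta> d. stress V (insert e E') p \<theta> d \<and> \<theta> e = R e \<and> (\<forall>e. \<theta> e \<noteq> 0 \<longrightarrow> (\<forall>w\<in>e. col w = None))"
      if eT: "e \<in> T" for e
    proof -
      have "card e = 2" "e \<subseteq> N" "e \<notin> E" using eT by (auto simp: T_def)
      then obtain h h' where e: "e = {h, h'}" "h \<noteq> h'" by (auto simp: card_2_iff)
      then obtain \<theta> d where \<theta>: "stress V (insert e E') p \<theta> d" "\<theta> e \<noteq> 0"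
        "\<forall>e. \<theta> e \<noteq> 0 \<longrightarrow> (\<forall>w\<in>e. col w = None)"
        using uncoloured[of h h'] \<open>e \<subseteq> N\<close> \<open>e \<notin> E\<close> by auto
      have "stress V (insert e E') p (\<lambda>e'. (R e / \<theta> e) * \<theta> e' + 0 * \<theta> e') (\<lambda>v. (R e / \<theta> e) * d v + 0 * d v)"
        by (rule stress_combine[OF \<theta>(1) \<theta>(1)])
      then show ?thesis
        using \<theta>(2,3) by (intro exI[of _ "\<lambda>e'. (R e / \<theta> e) * \<theta> e' + 0 * \<theta> e'"] exI conjI) auto
    qed
    then obtain \<theta> d\<theta> where \<theta>: "\<And>e. e \<in> T \<Longrightarrow> stress V (insert e E') p (\<theta> e) (d\<theta> e)"
      "\<And>e. e \<in> T \<Longrightarrow> \<theta> e e = R e" "\<And>e e' w. e \<in> T \<Longrightarrow> \<theta> e e' \<noteq> 0 \<Longrightarrow> w \<in> e' \<Longrightarrow> col w = None"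
      by metis
    have TV: "T \<subseteq> complete_edges V" using NV by (auto simp: T_def complete_edges_def)
    have \<theta>out: "\<theta> t e = 0" if "t \<in> T" "e \<noteq> t" "e \<notin> E'" for t e
      using \<theta>(1)[OF that(1)] that by (auto simp: stress_def)
    define \<Omega> where "\<Omega> = (\<lambda>e. 1 * R e + (- 1) * (\<Sum>t\<in>T. 1 * \<theta> t e))"
    have "stress V (complete_edges V) p (\<lambda>e. \<Sum>t\<in>T. 1 * \<theta> t e) (\<lambda>v. \<Sum>t\<in>T. 1 * d\<theta> t v)"
      using E'V TV by (intro stress_sum stress_mono[OF \<theta>(1)]) auto
    from stress_combine[OF stR this, of 1 "- 1"]
    obtain d\<Omega> where st\<Omega>: "stress V (complete_edges V) p \<Omega> d\<Omega>" unfolding \<Omega>_def by blast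
    have R0: "R e = 0" if out: "\<not> e \<subseteq> insert v N" for e
    proof -
      obtain u where u: "u \<in> e" "u \<notin> insert v N" using out by blast
      then have "M a u = 0" by (simp add: M_def)
      then show ?thesis unfolding R_def by (rule M_rank1[OF u(1)])
    qed
    have st\<Omega>E: "stress V E p \<Omega> d\<Omega>"
    proof (rule stress_restrict[OF st\<Omega>])
      fix e assume e: "e \<in> complete_edges V" "e \<notin> E"
      then have eE': "e \<notin> E'" using E'E by blast
      show "\<Omega> e = 0"
      proof (cases "e \<in> T")
        case True
        have "(\<Sum>t\<in>T. 1 * \<theta> t e) = (\<Sum>t\<in>T. if t = e then R e else 0)"
          using \<theta>out[OF _ _ eE'] \<theta>(2) by (intro sum.cong) auto
        then show ?thesis using True finT by (simp add: \<Omega>_def)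
      next
        case False
        have "R e = 0"
        proof (cases "v \<in> e")
          case True
          show ?thesis
          proof (rule R0, rule)
            assume sub: "e \<subseteq> insert v N"
            have "card e = 2" using e by (auto simp: complete_edges_def)
            then obtain u where "e = {u, v}" "u \<noteq> v" using True by (auto simp: card_2_iff)
            then show False using sub NE e(2) by auto
          qed
        next
          case v: False
          show ?thesis
            using False e v by (intro R0) (auto simp: T_def complete_edges_def)
        qed
        moreover have "\<theta> t e = 0" if "t \<in> T" for t using \<theta>out[OF that _ eE'] False that by blast
        ultimately show ?thesis by (simp add: \<Omega>_def sum.neutral)
      qed
    qed
    have "\<Omega> {x, v} \<noteq> 0"
    proof -
      have "\<theta> t {x, v} = 0" if "t \<in> T" for t
      proof (rule \<theta>out[OF that _ xvE'])
        show "{x, v} \<noteq> t" using that NV by (auto simp: T_def)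
      qed
      moreover have "R {x, v} = - a x" using x NV v unfolding R_def by (subst rank1_pair) (auto simp: M_def)
      moreover have "a x \<noteq> 0" using supp[OF NE[OF x]] \<open>d0 v \<noteq> 0\<close> by (simp add: a_def)
      ultimately show ?thesis by (simp add: \<Omega>_def sum.neutral)
    qed
    then obtain e w where ew: "\<Omega> e \<noteq> 0" "w \<in> e" "col w = Some c"
      using all_colours[OF st\<Omega>E _ c(1)] by blast
    \<comment> \<open>\<open>w\<close> has the colour that is absent from \<open>v\<close> and
      \<open>N\<close>, so only one of the uncoloured stresses could reach it.\<close>
    have "R e = 0" using ew c(2) by (intro R0) blast
    then have "(\<Sum>t\<in>T. 1 * \<theta> t e) \<noteq> 0" using ew(1) by (auto simp: \<Omega>_def)
    then obtain t where t: "t \<in> T" "1 * \<theta> t e \<noteq> 0" by (rule sum.not_neutral_contains_not_neutral)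
    then have "col w = None" using ew(2) by (intro \<theta>(3)[OF t(1)]) simp
    then show False using ew(3) by simp
  qed
qed

section \<open>The matroid of sparse sets\<close>

lemma stress_free_empty: "stress_free V col {} K p"
  by (auto simp: stress_free_def stress_def)

lemma generic_rigidity_rank_ge:
  assumes "F \<subseteq> complete_edges V" "I \<subseteq> F" "stress_free V col I {} p"
  shows "card I \<le> generic_rigidity_rank 2 V F"
proof -
  have "finite F" by (rule finite_complete_edges_subset[OF finite_V assms(1)])
  then have "finite {I. I \<subseteq> F \<and> generic_rigidity_indep 2 V I}" by simp
  moreover have "generic_rigidity_indep 2 V I"
    using assms by (subst generic_rigidity_indep_iff) auto
  ultimately show ?thesis
    unfolding generic_rigidity_rank_def matroid_rank_def using assms(2) by (intro Max_ge) auto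
qed

lemma generic_rigidity_rank_attained:
  assumes F: "F \<subseteq> complete_edges V"
  obtains I where "I \<subseteq> F" "stress_free V col I {} p" "card I = generic_rigidity_rank 2 V F"
proof -
  let ?S = "{I. I \<subseteq> F \<and> generic_rigidity_indep 2 V I}"
  have "finite F" by (rule finite_complete_edges_subset[OF finite_V F])
  then have "finite ?S" by simp
  moreover have "{} \<in> ?S" using stress_free_empty by (auto simp: generic_rigidity_indep_iff)
  ultimately have "Max (card ` ?S) \<in> card ` ?S" by (intro Max_in) auto
  then obtain I where I: "I \<subseteq> F" "generic_rigidity_indep 2 V I" "card I = Max (card ` ?S)" by auto
  show thesis
  proof (rule that[OF I(1)])
    show "stress_free V col I {} p" using I(2) generic_rigidity_indep_iff[OF order.trans[OF I(1) F]] by simp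
    show "card I = generic_rigidity_rank 2 V F"
      using I(3) by (simp add: generic_rigidity_rank_def matroid_rank_def)
  qed
qed

text \<open>\<open>D\<close> is the complement in \<open>F\<close> of a largest stress-free subset,
  so its size is \<open>card F\<close> minus the planar rank.\<close>

lemma N_indep_imp_sparse:
  assumes "N_indep 2 V col E"
  shows "sparse E"
  unfolding sparse_def
proof (intro allI impI)
  fix F assume F: "F \<subseteq> E"
  have EV: "E \<subseteq> complete_edges V" using assms by (simp add: N_indep_def)
  show "\<exists>D\<subseteq>F. card D \<le> colour_count col F \<and> stress_free V col (F - D) {} p"
  proof (cases "F = {}")
    case True
    then show ?thesis using stress_free_empty by (intro exI[of _ "{}"]) simp
  next
    case False
    have FV: "F \<subseteq> complete_edges V" using F EV by blast
    obtain I where I: "I \<subseteq> F" "stress_free V col I {} p" "card I = generic_rigidity_rank 2 V F"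
      using generic_rigidity_rank_attained[OF FV] by metis
    have "card F \<le> f_fun 2 V col F" using assms F False by (simp add: N_indep_def)
    then have "card (F - I) \<le> colour_count col F"
      using I finite_complete_edges_subset[OF finite_V FV] finite_subset
      by (subst card_Diff_subset) (auto simp: f_fun_def)
    moreover have "F - (F - I) = I" using I(1) by blast
    ultimately show ?thesis using I(2) by (intro exI[of _ "F - I"]) auto
  qed
qed

text \<open>Each edge of \<open>F\<close> outside a planar basis \<open>I\<close> closes a stress
  with \<open>I\<close>. With more such edges than colours on \<open>F\<close>, some nontrivial
  combination of these stresses has no loads; it is not zero, as each such edge occurs in its own
  stress only.\<close>

lemma stress_free_imp_N_indep:
  assumes E: "E \<subseteq> complete_edges V" and free: "stress_free V col E C p"
  shows "N_indep 2 V col E"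
  unfolding N_indep_def
proof (intro conjI allI impI E)
  fix F assume F: "F \<subseteq> E \<and> F \<noteq> {}"
  then have FV: "F \<subseteq> complete_edges V" using E by blast
  have finF: "finite F" by (rule finite_complete_edges_subset[OF finite_V FV])
  obtain I where I: "I \<subseteq> F" "stress_free V col I {} p" "card I = generic_rigidity_rank 2 V F"
    using generic_rigidity_rank_attained[OF FV] by metis
  have finI: "finite I" using I(1) finF by (rule finite_subset)
  have "\<exists>\<omega> d. stress V (insert f I) p \<omega> d \<and> \<omega> f \<noteq> 0" if f: "f \<in> F - I" for f
  proof -
    have "\<not> stress_free V col (insert f I) {} p"
    proof
      assume "stress_free V col (insert f I) {} p"
      then have "card (insert f I) \<le> card I"
        using generic_rigidity_rank_ge[OF FV, of "insert f I"] I f by auto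
      then show False using f finI by simp
    qed
    then obtain \<omega> d e where \<omega>: "stress V (insert f I) p \<omega> d" "\<omega> e \<noteq> 0" by (auto simp: stress_free_def)
    have "\<omega> f \<noteq> 0"
    proof
      assume "\<omega> f = 0"
      then have "stress V I p \<omega> d" by (intro stress_restrict[OF \<omega>(1)]) auto
      then have "\<omega> e = 0" by (rule stress_freeD[OF I(2)]) simp
      then show False using \<omega>(2) by simp
    qed
    with \<omega>(1) show ?thesis by blast
  qed
  then obtain \<omega> d where \<omega>: "\<And>f. f \<in> F - I \<Longrightarrow> stress V (insert f I) p (\<omega> f) (d f)"
    "\<And>f. f \<in> F - I \<Longrightarrow> \<omega> f f \<noteq> 0" by metis
  let ?K = "{c. Some c \<in> col ` \<Union>F}"
  have finK: "finite ?K" by (rule finite_subset[OF colours_subset[OF FV] finite_C])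
  have "card (F - I) \<le> card ?K"
  proof (rule ccontr)
    assume "\<not> ?thesis"
    then obtain x where x: "\<And>c. c \<in> ?K \<Longrightarrow> (\<Sum>f\<in>F - I. x f * load V col (\<omega> f) (d f) c) = 0"
      "\<exists>f\<in>F - I. x f \<noteq> 0"
      using homogeneous_nontrivial[of "F - I" ?K "\<lambda>f. load V col (\<omega> f) (d f)"] finF finK by auto
    let ?\<omega> = "\<lambda>e. \<Sum>f\<in>F - I. x f * \<omega> f e" and ?d = "\<lambda>v. \<Sum>f\<in>F - I. x f * d f v"
    have st: "stress V F p ?\<omega> ?d"
      using I(1) by (intro stress_sum stress_mono[OF \<omega>(1)]) auto
    have "load V col ?\<omega> ?d c = 0" for c
    proof (cases "c \<in> ?K")
      case True
      then show ?thesis unfolding load_sum by (rule x(1))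
    next
      case False
      show ?thesis
      proof (rule load_zero[OF nonzero st])
        fix e v assume "?\<omega> e \<noteq> 0" "v \<in> e"
        then have "e \<in> F" using stress_support[OF st] by blast
        with \<open>v \<in> e\<close> False show "col v \<noteq> Some c" by force
      qed
    qed
    then have z: "?\<omega> e = 0" for e
      using F by (intro stress_freeD[OF stress_free_mono[OF free] st]) auto
    obtain f where f: "f \<in> F - I" "x f \<noteq> 0" using x(2) by blast
    have "?\<omega> f = (\<Sum>g\<in>F - I. if g = f then x f * \<omega> f f else 0)"
    proof (intro sum.cong refl)
      fix g assume g: "g \<in> F - I"
      show "x g * \<omega> g f = (if g = f then x f * \<omega> f f else 0)"
        using \<omega>(1)[OF g] f g by (auto simp: stress_def)
    qed
    also have "\<dots> = x f * \<omega> f f" using f finF by simp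
    finally show False using z[of f] f \<omega>(2)[OF f(1)] by simp
  qed
  moreover have "card F = card I + card (F - I)"
    using I(1) finF finI by (simp add: card_Diff_subset card_mono)
  ultimately show "card F \<le> f_fun 2 V col F"
    using I(3) by (simp add: f_fun_def colour_count_def)
qed

text \<open>At \<open>w\<close> only the edges to \<open>x\<close> and \<open>y\<close> are
  available, and the points of \<open>x\<close>, \<open>y\<close>, \<open>w\<close> are independent;
  the one remaining edge cannot carry a stress. This graph is a planar basis of explicit
  shape.\<close>

lemma stress_free_fan:
  assumes xy: "x \<in> V" "y \<in> V" "x \<noteq> y"
  shows "stress_free V col ({{x, y}} \<union> (\<lambda>w. {w, x}) ` (V - {x, y}) \<union> (\<lambda>w. {w, y}) ` (V - {x, y})) {} p"
    (is "stress_free V col ?B {} p")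
  unfolding stress_free_def
proof (intro allI impI)
  fix \<omega> d e assume st: "stress V ?B p \<omega> d"
  have out: "\<omega> e = 0" if "e \<notin> ?B" for e using st that unfolding stress_def by blast
  have w: "\<omega> {x, w} = 0 \<and> \<omega> {y, w} = 0" if w: "w \<in> V - {x, y}" for w
  proof -
    define c where "c u = (if u = w then d w else \<omega> {u, w})" for u
    have eq: "(\<Sum>u\<in>{x, y, w}. c u * p u i) = 0" if "i \<le> 2" for i
    proof -
      have "(\<Sum>u\<in>V - {w}. \<omega> {u, w} * p u i) = (\<Sum>u\<in>{x, y}. \<omega> {u, w} * p u i)"
      proof (rule sum.mono_neutral_right)
        show "\<forall>u\<in>V - {w} - {x, y}. \<omega> {u, w} * p u i = 0"
        proof
          fix u assume "u \<in> V - {w} - {x, y}"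
          then have "{u, w} \<notin> ?B" using w by (auto simp: doubleton_eq_iff)
          then show "\<omega> {u, w} * p u i = 0" using out by simp
        qed
      qed (use finite_V w xy in auto)
      then show ?thesis
        using stress_equilibrium[OF st _ that, of w] w xy not_sym[of w x] not_sym[of w y]
        by (simp add: c_def add.assoc)
    qed
    have "c u = 0" if "u \<in> {x, y, w}" for u
      by (rule at_most_three_independent[OF _ _ eq that]) (use w xy in \<open>auto simp: card_insert_if\<close>)
    then have "c x = 0" "c y = 0" by simp_all
    then show ?thesis using w by (simp add: c_def split: if_splits)
  qed
  have "\<omega> {y, x} = 0"
  proof -
    define c where "c u = (if u = x then d x else \<omega> {u, x})" for u
    have eq: "(\<Sum>u\<in>{x, y}. c u * p u i) = 0" if "i \<le> 2" for i
    proof -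
      have "(\<Sum>u\<in>V - {x}. \<omega> {u, x} * p u i) = (\<Sum>u\<in>{y}. \<omega> {u, x} * p u i)"
      proof (rule sum.mono_neutral_right)
        show "\<forall>u\<in>V - {x} - {y}. \<omega> {u, x} * p u i = 0"
          using w by (auto simp: insert_commute)
      qed (use finite_V xy in auto)
      then show ?thesis
        using stress_equilibrium[OF st _ that, of x] xy by (simp add: c_def)
    qed
    have "c y = 0"
      by (rule at_most_three_independent[OF _ _ eq]) (use xy in \<open>auto simp: card_insert_if\<close>)
    then show ?thesis using xy by (simp add: c_def)
  qed
  then have "\<omega> {x, y} = 0" by (simp add: insert_commute)
  then show "\<omega> e = 0" using w out[of e] by (cases "e \<in> ?B") (auto simp: insert_commute)
qed

text \<open>A 2-tree in which \<open>m\<close> vertices of pairwise distinct colours have one more edge.\<close>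

lemma sparse_exists:
  assumes V3: "card V \<ge> 3" and m: "m \<le> card C" "m + 3 \<le> card V"
  obtains I where "I \<subseteq> complete_edges V" "sparse I" "card I = 2 * card V - 3 + m"
proof -
  obtain C' where C': "C' \<subseteq> C" "card C' = m" "finite C'"
    using m(1) by (rule obtain_subset_with_card_n)
  have "\<exists>v\<in>V. col v = Some c" if "c \<in> C" for c
  proof -
    have "Some c \<in> col ` V" using colours that by (auto simp: colouring_def)
    then show ?thesis by auto
  qed
  then obtain h where h: "\<And>c. c \<in> C \<Longrightarrow> h c \<in> V \<and> col (h c) = Some c" by metis
  have injh: "inj_on h C'" using h C' by (intro inj_onI) (metis option.inject subsetD)
  have hV: "h ` C' \<subseteq> V" using h C' by auto
  have "card (h ` C') = m" using injh C' by (simp add: card_image)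
  \<comment> \<open>Besides the representatives of the \<open>m\<close> colours, three vertices are
    needed: the hubs \<open>x\<close>, \<open>y\<close> of the fan and the common end
    \<open>z\<close> of the extra edges.\<close>
  then have "card (V - h ` C') \<ge> 3"
    using hV m(2) C' finite_V by (subst card_Diff_subset) auto
  then obtain T where T: "T \<subseteq> V - h ` C'" "card T = 3" by (rule obtain_subset_with_card_n)
  then obtain x y z where xyz: "T = {x, y, z}" "x \<noteq> y" "x \<noteq> z" "y \<noteq> z"
    by (metis card_3_iff)
  have xyzV: "x \<in> V" "y \<in> V" "z \<in> V" "x \<notin> h ` C'" "y \<notin> h ` C'" "z \<notin> h ` C'" using T xyz(1) by auto
  let ?W = "V - {x, y}"
  define A1 where "A1 = (\<lambda>w. {w, x}) ` ?W"
  define A2 where "A2 = (\<lambda>w. {w, y}) ` ?W"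
  define Z where "Z = (\<lambda>c. {h c, z}) ` C'"
  define B where "B = {{x, y}} \<union> A1 \<union> A2"
  have finW: "finite ?W" and cW: "card ?W = card V - 2"
    using finite_V xyzV xyz by (auto simp: card_Diff_subset)
  have cA1: "card A1 = card V - 2" unfolding A1_def
    by (subst card_image) (auto simp: inj_on_def doubleton_eq_iff cW)
  have cA2: "card A2 = card V - 2" unfolding A2_def
    by (subst card_image) (auto simp: inj_on_def doubleton_eq_iff cW)
  have "inj_on (\<lambda>c. {h c, z}) C'"
  proof (rule inj_onI)
    fix a b assume ab: "a \<in> C'" "b \<in> C'" "{h a, z} = {h b, z}"
    then have "h a = h b" using xyzV by (auto simp: doubleton_eq_iff)
    then show "a = b" using injh ab by (auto simp: inj_on_def)
  qed
  then have cZ: "card Z = m" unfolding Z_def using C' by (simp add: card_image)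
  have fins: "finite A1" "finite A2" "finite Z" using finW C' by (simp_all add: A1_def A2_def Z_def)
  have d1: "A1 \<inter> A2 = {}" using xyz by (auto simp: A1_def A2_def doubleton_eq_iff)
  have d2: "{x, y} \<notin> A1 \<union> A2" by (auto simp: A1_def A2_def doubleton_eq_iff)
  have d3: "B \<inter> Z = {}"
  proof -
    have "{h c, z} \<noteq> {x, y}" "{h c, z} \<notin> A1" "{h c, z} \<notin> A2" if "c \<in> C'" for c
      using xyz xyzV that by (auto simp: A1_def A2_def doubleton_eq_iff)
    then show ?thesis by (auto simp: B_def Z_def)
  qed
  have cB: "card B = 2 * card V - 3"
  proof -
    have "B = insert {x, y} (A1 \<union> A2)" by (auto simp: B_def)
    then have "card B = Suc (card A1 + card A2)"
      using fins d1 d2 by (simp add: card_Un_disjoint)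
    then show ?thesis using cA1 cA2 V3 by simp
  qed
  have finB: "finite B" using fins by (simp add: B_def)
  have BZV: "B \<union> Z \<subseteq> complete_edges V"
  proof -
    have "{x, y} \<in> complete_edges V" using xyz xyzV by (simp add: complete_edges_def)
    moreover have "A1 \<subseteq> complete_edges V" "A2 \<subseteq> complete_edges V"
      using xyzV by (auto simp: A1_def A2_def complete_edges_def)
    moreover have "Z \<subseteq> complete_edges V"
    proof
      fix e assume "e \<in> Z"
      then obtain c where "c \<in> C'" "e = {h c, z}" by (auto simp: Z_def)
      moreover from this have "h c \<in> V" "h c \<noteq> z" using hV xyzV by auto
      ultimately show "e \<in> complete_edges V" using xyzV by (simp add: complete_edges_def)
    qed
    ultimately show ?thesis by (auto simp: B_def)
  qed
  have "sparse (B \<union> Z)"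
    unfolding sparse_def
  proof (intro allI impI)
    fix F assume F: "F \<subseteq> B \<union> Z"
    then have FV: "F \<subseteq> complete_edges V" using BZV by blast
    let ?C = "{c \<in> C'. {h c, z} \<in> F}"
    \<comment> \<open>The extra edges in \<open>F\<close> serve as \<open>D\<close>: each brings the
      colour of its own representative into \<open>F\<close>, and what remains is part of the
      fan.\<close>
    have "F \<inter> Z = (\<lambda>c. {h c, z}) ` ?C" by (auto simp: Z_def)
    then have "card (F \<inter> Z) \<le> card ?C" using C' by (simp add: card_image_le)
    moreover have "?C \<subseteq> {c. Some c \<in> col ` \<Union>F}"
    proof
      fix c assume c: "c \<in> ?C"
      then have "h c \<in> \<Union>F" "col (h c) = Some c" using h C' by auto
      then show "c \<in> {c. Some c \<in> col ` \<Union>F}" by (metis imageI mem_Collect_eq)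
    qed
    then have "card ?C \<le> colour_count col F" by (rule colour_countI[OF FV])
    moreover have "stress_free V col B {} p"
      using stress_free_fan[OF xyzV(1,2) xyz(2)] by (simp add: B_def A1_def A2_def)
    then have "stress_free V col (F - F \<inter> Z) {} p" by (rule stress_free_mono) (use F in blast)
    ultimately show "\<exists>D\<subseteq>F. card D \<le> colour_count col F \<and> stress_free V col (F - D) {} p"
      by (intro exI[of _ "F \<inter> Z"]) auto
  qed
  moreover have "card (B \<union> Z) = 2 * card V - 3 + m"
    using cB cZ d3 finB fins by (simp add: card_Un_disjoint)
  ultimately show thesis using that BZV by blast
qed

text \<open>The planar rank is at most \<open>2 * card V - 3\<close>, and at most
  \<open>card C\<close> is added. On 3 or 4 vertices there are only 3 or 6 edges at all, which
  accounts for the minimum; from 5 vertices on the minimum is \<open>card C\<close>.\<close>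

lemma N_indep_card_le:
  assumes V3: "card V \<ge> 3" and C2: "card C \<le> 2" and B: "N_indep 2 V col B"
  shows "card B \<le> 2 * card V - 3 + min (card C) (card V - 3)"
proof (cases "B = {}")
  case False
  have BV: "B \<subseteq> complete_edges V" using B by (simp add: N_indep_def)
  have "card B \<le> f_fun 2 V col B" using B False by (simp add: N_indep_def)
  moreover obtain I where I: "I \<subseteq> B" "stress_free V col I {} p" "card I = generic_rigidity_rank 2 V B"
    using generic_rigidity_rank_attained[OF BV] by metis
  have "card I + 3 \<le> 2 * card V"
    using stress_free_card_le[of V I] I BV V3 by auto
  moreover have "colour_count col B \<le> card C"
    unfolding colour_count_def by (rule card_mono[OF finite_C colours_subset[OF BV]])
  ultimately have le: "card B \<le> 2 * card V - 3 + card C" using I(3) by (simp add: f_fun_def)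
  have "card B \<le> card (complete_edges V)"
    using BV finite_complete_edges_subset[OF finite_V subset_refl] by (rule card_mono[rotated])
  also have "\<dots> = card V choose 2" unfolding complete_edges_def by (rule n_subsets[OF finite_V])
  finally have le2: "card B \<le> card V choose 2" .
  consider "card V = 3" | "card V = 4" | "card V \<ge> 5" using V3 by linarith
  then show ?thesis
  proof cases
    case 1
    then show ?thesis using le2 by (simp add: choose_two)
  next
    case 2
    then show ?thesis using le le2 by (simp add: choose_two min_def)
  next
    case 3
    then show ?thesis using le C2 by (simp add: min_def)
  qed
qed simp

theorem isostatic_iff_tight:
  assumes V3: "card V \<ge> 3" and C2: "card C \<le> 2" and E: "E \<subseteq> complete_edges V"
  shows "isostatic 2 V E C col p \<longleftrightarrow> f_tight 2 V E col"
proof -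
  let ?J = "coords 2 V C" and ?M = "rigidity_matrix col p :: _ \<Rightarrow> ('v \<times> nat) + 'c \<Rightarrow> real"
  \<comment> \<open>The rank demanded by infinitesimal rigidity, less the \<open>card V\<close>
    vertex rows.\<close>
  let ?b = "2 * card V - 3 + min (card C) (card V - 3)"
  have N: "N_indep 2 V col F \<longleftrightarrow> rows_independent (F <+> V) ?J ?M" if F: "F \<subseteq> complete_edges V" for F
  proof -
    have "N_indep 2 V col F \<longleftrightarrow> stress_free V col F C p"
      using N_indep_imp_sparse sparse_imp_stress_free[OF C2 F] stress_free_imp_N_indep[OF F] by blast
    then show ?thesis
      using rows_independent_iff_stress_free[OF finite_V F nonzero, of C col] by (simp add: coords_def)
  qed
  have NV: "F \<subseteq> complete_edges V" if "N_indep 2 V col F" for F using that by (simp add: N_indep_def)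
  have fin: "finite F" if "F \<subseteq> complete_edges V" for F
    using finite_complete_edges_subset[OF finite_V that] .
  have rank: "infinitesimally_rigid 2 V E C col p \<longleftrightarrow> card E = ?b" if "rows_independent (E <+> V) ?J ?M"
  proof -
    have "mat_rank (E <+> V) ?J ?M = card E + card V"
      using mat_rank_independent[OF that] fin[OF E] finite_V by (simp add: card_Plus)
    then show ?thesis using V3 by (auto simp: infinitesimally_rigid_def choose_two)
  qed
  obtain I where I: "I \<subseteq> complete_edges V" "sparse I" "card I = ?b"
    using V3 by (rule sparse_exists[of "min (card C) (card V - 3)"]) (use V3 in simp_all)
  have Iri: "rows_independent (I <+> V) ?J ?M"
    using sparse_imp_stress_free[OF C2 I(1,2)] rows_independent_iff_stress_free[OF finite_V I(1) nonzero, of C col]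
    by (simp add: coords_def)
  show ?thesis
  proof
    assume "isostatic 2 V E C col p"
    then have ri: "rows_independent (E <+> V) ?J ?M" and "infinitesimally_rigid 2 V E C col p"
      by (auto simp: isostatic_def independent_framework_def)
    then have cE: "card E = ?b" using rank by blast
    show "f_tight 2 V E col"
      unfolding f_tight_def matroid_base_def
    proof (intro conjI allI impI)
      show "N_indep 2 V col E" using ri N[OF E] by blast
      fix B assume B: "N_indep 2 V col B \<and> E \<subseteq> B"
      then have "card B \<le> card E" using N_indep_card_le[OF V3 C2] cE by metis
      then show "B = E" using B fin[OF NV] by (intro card_seteq[symmetric]) auto
    qed
  next
    assume "f_tight 2 V E col"
    then have base: "N_indep 2 V col E" "\<And>B. N_indep 2 V col B \<Longrightarrow> E \<subseteq> B \<Longrightarrow> B = E"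
      by (auto simp: f_tight_def matroid_base_def)
    have ri: "rows_independent (E <+> V) ?J ?M" using base(1) N[OF E] by blast
    have "\<not> card E < card I"
    proof
      assume "card E < card I"
      then have "card (E <+> V) < card (I <+> V)"
        using fin[OF E] fin[OF I(1)] finite_V by (simp add: card_Plus)
      \<comment> \<open>Both families contain all vertex rows, so the exchanged row is that of an
        edge.\<close>
      then obtain b where b: "b \<in> (I <+> V) - (E <+> V)" "rows_independent (insert b (E <+> V)) ?J ?M"
        using rows_independent_augment[OF _ _ ri Iri] fin[OF E] fin[OF I(1)] finite_V by auto
      then obtain e where e: "b = Inl e" "e \<in> I" "e \<notin> E" by auto
      have "insert b (E <+> V) = insert e E <+> V" using e by auto
      then have "N_indep 2 V col (insert e E)" using b(2) N[of "insert e E"] E I(1) e(2) by auto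
      then have "insert e E = E" by (rule base(2)) auto
      then show False using e by blast
    qed
    then have "card E = ?b" using I(3) N_indep_card_le[OF V3 C2 base(1)] by linarith
    then show "isostatic 2 V E C col p"
      using ri rank by (simp add: isostatic_def independent_framework_def)
  qed
qed

end

theorem theorem4p8:
  fixes n k :: nat
    and V :: "nat set"
    and E :: "nat set set"
    and C :: "'c set"
    and col :: "nat \<Rightarrow> 'c option"
    and r :: "'c \<Rightarrow> real"
    and p :: "nat \<Rightarrow> nat \<Rightarrow> real"
  assumes "V = {1..n}"
    and "card V \<ge> 3"
    and "coloured_graph k V E C col"
    and "k \<le> 2"
    and "generic_framework 2 V C col r p"
  shows "isostatic 2 V E C col p \<longleftrightarrow> simple_graph V E \<and> f_tight 2 V E col"
proof -
  have graph: "simple_graph V E" and C: "card C \<le> 2"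
    using assms(3,4) by (auto simp: coloured_graph_def)
  interpret generic_spherical V C col r p
    using assms(3,5) by unfold_locales (auto simp: coloured_graph_def simple_graph_def)
  show ?thesis
    using isostatic_iff_tight[OF assms(2) C] graph by (simp add: simple_graph_def)
qed

end
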